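(* Let $a>0$, $b<0$, $b_X>0$ and $U_{\rm e}$ be real constants, and consider the system, for $t\ge0$, $x\in[0,1]$, $$u_t(x,t)=b\,u_x(x,t)+b_XX(t),\qquad u(0,t)=2U_{\rm e}-U(t),$$ $$\dot X(t)=-aX(t)+V(t),\qquad \dot V(t)=0.$$ Let $\bar b<0$ be a known constant with $b<\bar b$, let $\gamma_1,\gamma_2,\gamma_3>0$ and $\bar A<0$. Consider the filters $$v_t(x,t)=\hat b(t)v_x(x,t)+u_x(x,t),\quad v(0,t)=0,$$ $$p_t(x,t)=\hat b(t)p_x(x,t)+X(t),\quad p(0,t)=0,$$ $$\eta_t(x,t)=\hat b(t)\eta_x(x,t)-\hat b(t)u_x(x,t),\quad \eta(0,t)=-U(t)+2U_{\rm e},$$ $$\dot\Omega_0(t)=\bar A\big(\Omega_0(t)-X(t)\big)+V(t),\qquad \dot\Omega(t)=\bar A\,\Omega(t)-X(t),$$ the prediction errors $$\hat e(x,t)=u(x,t)-\hat b(t)v(x,t)-\hat b_X(t)p(x,t)-\eta(x,t),\qquad \hat\epsilon(t)=X(t)-\Omega_0(t)-\Omega(t)\hat a(t),$$ and the update laws $$\dot{\hat b}(t)=-\gamma_1\hat b(t)\,\mathrm{Proj}_{\bar b}\left\{\frac{\int_0^1\hat e(x,t)v(x,t)dx}{1+\int_0^1v(x,t)^2dx+\int_0^1p(x,t)^2dx}\right\},$$ $$\dot{\hat b}_X(t)=-\gamma_2\hat b(t)\frac{\int_0^1\hat e(x,t)p(x,t)dx}{1+\int_0^1v(x,t)^2dx+\int_0^1p(x,t)^2dx},\qquad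 \dot{\hat a}(t)=\gamma_3\frac{\hat\epsilon(t)\Omega(t)}{1+\Omega(t)^2},$$ where $\mathrm{Proj}_{\bar b}\{\tau\}=0$ if $\hat b=\bar b$ and $\tau>0$, and $\mathrm{Proj}_{\bar b}\{\tau\}=\tau$ otherwise. Put $\tilde b=b-\hat b$, $\tilde b_X=b_X-\hat b_X$, $\tilde a=a-\hat a$. Then for all $V(0),X(0),\hat b(0),\hat b_X(0),\hat a(0),\Omega(0),\Omega_0(0)\in\mathbb R$, all $v(\cdot,0),p(\cdot,0),\eta(\cdot,0)\in L_2(0,1)$, all $u(\cdot,0)\in H_1(0,1)$, and all $U$ with $U,\dot U\in\mathcal L_\infty$, $$\|u_x\|,\ \|u\|,\ V,\ X,\ \|v\|,\ \|p\|,\ \|\eta\|,\ \Omega,\ \Omega_0,\ \tilde b,\ \tilde b_X,\ \tilde a\in\mathcal L_\infty,$$ $$\dot{\hat b},\ \dot{\hat b}_X,\ \dot{\hat a},\ \frac{\|\hat e\|}{\sqrt{1+\|v\|^2+\|p\|^2}},\ \frac{|\hat\epsilon|}{\sqrt{1+\Omega^2}}\in\mathcal L_2\cap\mathcal L_\infty.$$ Moreover, if $\lim_{t\to\infty}V(t)=c$ with $c\ne0$, then $\lim_{t\to\infty}\hat a(t)=a$.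
   Context: $\|\cdot\|$ denotes the spatial $L_2(0,1)$ norm, so e.g. $\|u\|$ denotes the function of time $t\mapsto\big(\int_0^1u(x,t)^2dx\big)^{1/2}$. $\mathcal L_\infty$ and $\mathcal L_2$ denote the spaces of bounded, respectively square integrable, functions of time $t\ge0$. $H_1(0,1)$ is the Sobolev space of $L_2(0,1)$ functions with weak derivative in $L_2(0,1)$. Subscripts $t,x$ denote partial derivatives (the subscript in $b_X$ is only part of the name of a constant) and dots denote time derivatives. $\hat b,\hat b_X,\hat a$ are the online estimates of the unknown constants $b,b_X,a$; the PDE and ODE states $u,X,V$ and the input $U$ are assumed measured. The conclusions concern the solution of the coupled system, filters and update laws with the given initial data and input.
   Formalization: The estimate of b is assumed to stay at or below b̄ for all t≥0 (instead of arbitrary b̂(0); for b̂(0)=0, p can be unbounded), and u(·,t) is assumed in H_1 for all t, which forces u(0,0)=2U_e−U(0). *)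

theory Defs
  imports "HOL-Analysis.Analysis"
begin

definition int01 :: "(real \<Rightarrow> real) \<Rightarrow> real" where
  "int01 w = (LINT x|lebesgue_on {0..1}. w x)"

definition in_L2 :: "(real \<Rightarrow> real) \<Rightarrow> bool" where
  "in_L2 w \<longleftrightarrow> w \<in> borel_measurable (lebesgue_on {0..1}) \<and>
     integrable (lebesgue_on {0..1}) (\<lambda>x. (w x)\<^sup>2)"

definition L2norm :: "(real \<Rightarrow> real) \<Rightarrow> real" where
  "L2norm w = sqrt (int01 (\<lambda>x. (w x)\<^sup>2))"

text \<open>Weak derivative on the interval (0,1), tested with compactly supported functions of
  class $C^1$.\<close>

definition has_weak_deriv :: "(real \<Rightarrow> real) \<Rightarrow> (real \<Rightarrow> real) \<Rightarrow> bool" where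
  "has_weak_deriv w w' \<longleftrightarrow>
     (\<forall>\<phi> \<phi>' \<alpha> \<beta>.
        0 < \<alpha> \<and> \<beta> < 1 \<and> (\<forall>x. x \<notin> {\<alpha>..\<beta>} \<longrightarrow> \<phi> x = 0) \<and>
        (\<forall>x. (\<phi> has_real_derivative \<phi>' x) (at x)) \<and> continuous_on UNIV \<phi>'
        \<longrightarrow> int01 (\<lambda>x. w x * \<phi>' x) = - int01 (\<lambda>x. w' x * \<phi> x))"

definition in_H1 :: "(real \<Rightarrow> real) \<Rightarrow> bool" where
  "in_H1 w \<longleftrightarrow> in_L2 w \<and> (\<exists>w'. in_L2 w' \<and> has_weak_deriv w w')"

definition in_Linf_time :: "(real \<Rightarrow> real) \<Rightarrow> bool" where
  "in_Linf_time f \<longleftrightarrow> bounded (f ` {0..})"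

definition in_L2_time :: "(real \<Rightarrow> real) \<Rightarrow> bool" where
  "in_L2_time f \<longleftrightarrow> f \<in> borel_measurable (lebesgue_on {0..}) \<and>
     integrable (lebesgue_on {0..}) (\<lambda>t. (f t)\<^sup>2)"

text \<open>Test functions for the transport equation: class $C^1$ on the closed set
  $[0,1] \times [0,\infty)$ (one-sided derivatives at the boundary), vanishing at $x=1$. They
  need not vanish at $x=0$ or at $t=0$.\<close>

definition transport_test ::
  "(real \<Rightarrow> real \<Rightarrow> real) \<Rightarrow> (real \<Rightarrow> real \<Rightarrow> real) \<Rightarrow> (real \<Rightarrow> real \<Rightarrow> real) \<Rightarrow> bool" where
  "transport_test \<phi> \<phi>x \<phi>t \<longleftrightarrow>
     (\<forall>x\<in>{0..1}. \<forall>t\<in>{0..}.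
        ((\<lambda>y. \<phi> y t) has_real_derivative \<phi>x x t) (at x within {0..1}) \<and>
        ((\<lambda>s. \<phi> x s) has_real_derivative \<phi>t x t) (at t within {0..})) \<and>
     continuous_on ({0..1} \<times> {0..}) (\<lambda>(x, t). \<phi> x t) \<and>
     continuous_on ({0..1} \<times> {0..}) (\<lambda>(x, t). \<phi>x x t) \<and>
     continuous_on ({0..1} \<times> {0..}) (\<lambda>(x, t). \<phi>t x t) \<and>
     (\<forall>t\<ge>0. \<phi> 1 t = 0)"

text \<open>Weak solutions $w \in C([0,\infty); L_2(0,1))$ of
  $w_t = c(t) w_x + f(x,t)$, $w(0,t) = g(t)$, $w(\cdot,0) = w_0$, for a negative speed $c$, so that
  $x=0$ is the inflow end and no condition is imposed at $x=1$. For data merely in $L_2$ neither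
  the derivatives of $w$ nor its value at $x=0$ exist pointwise: the equation is multiplied by
  a test function and integrated by parts over $[0,1] \times [0,T]$, and $g$ and $w_0$ are the
  boundary terms at $x=0$ and $t=0$. The case $T=0$ says that $w(\cdot,0) = w_0$ almost
  everywhere.\<close>

definition transport_solution ::
  "(real \<Rightarrow> real) \<Rightarrow> (real \<Rightarrow> real \<Rightarrow> real) \<Rightarrow> (real \<Rightarrow> real) \<Rightarrow> (real \<Rightarrow> real)
     \<Rightarrow> (real \<Rightarrow> real \<Rightarrow> real) \<Rightarrow> bool" where
  "transport_solution c f g w0 w \<longleftrightarrow>
     (\<forall>t\<ge>0. in_L2 (\<lambda>x. w x t) \<and> in_L2 (\<lambda>x. f x t)) \<and>
     (\<forall>t\<ge>0. ((\<lambda>s. L2norm (\<lambda>x. w x s - w x t)) \<longlongrightarrow> 0) (at t within {0..})) \<and>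
     (\<forall>\<phi> \<phi>x \<phi>t. transport_test \<phi> \<phi>x \<phi>t \<longrightarrow>
        (\<forall>T\<ge>0.
          ((\<lambda>t. int01 (\<lambda>x. w x t * (\<phi>t x t - c t * \<phi>x x t))
                 + int01 (\<lambda>x. f x t * \<phi> x t)
                 - c t * g t * \<phi> 0 t)
           has_integral
             (int01 (\<lambda>x. w x T * \<phi> x T) - int01 (\<lambda>x. w0 x * \<phi> x 0))) {0..T}))"

text \<open>The projected law is an equation on the half-line of values at most \<open>bbar\<close>. This formula
  alone does not keep a trajectory there: one sitting at \<open>bbar\<close> when its argument increases
  through 0 could also leave upwards. Solutions therefore have to be required separately to
  stay in the half-line.\<close>

definition Proj :: "real \<Rightarrow> real \<Rightarrow> real \<Rightarrow> real" where
  "Proj bbar bhat \<tau> = (if bhat = bbar \<and> \<tau> > 0 then 0 else \<tau>)"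

end

theory Submission
  imports Defs
begin

text \<open>Two facts carry the proof. First, the plant parameters enter the filters linearly, so that the
error formed with the true parameters, \<open>e = u - b v - b_X p - \<eta>\<close>, solves the source-free
equation \<open>e_t = bhat e_x\<close> with zero inflow: the sources of \<open>u\<close>, \<open>v\<close>, \<open>p\<close>, \<open>\<eta>\<close> cancel once the
equation of \<open>u\<close> is rewritten with the speed \<open>bhat\<close> (\<open>transport_change_speed\<close>). Second, every speed
is at most a negative constant \<open>m\<close>, so that whatever is in the interval at some time has left it
after the time \<open>1/|m|\<close>.

Consequently \<open>e\<close> vanishes almost everywhere for \<open>t \<ge> t0 = 1/|bbar|\<close>
(\<open>homogeneous_transport_vanishes\<close>), and from then on
\<open>ehat = (b - bhat) v + (bX - bXhat) p\<close>. The gradient structure of the update laws then gives, for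
\<open>W = (b - bhat)\<^sup>2/(2 \<gamma>1) + (bX - bXhat)\<^sup>2/(2 \<gamma>2)\<close>, the inequality
\<open>W' \<le> bbar \<parallel>ehat\<parallel>\<^sup>2 / (1 + \<parallel>v\<parallel>\<^sup>2 + \<parallel>p\<parallel>\<^sup>2)\<close>; the projection can only help, because it acts where
\<open>b - bhat = b - bbar < 0\<close>. Hence \<open>W\<close> is bounded and the normalised error is square integrable
(\<open>in_L2_time_if_dissipated\<close>), and the update laws are dominated by it. On \<open>[0, t0]\<close>
nothing has to be estimated, since all quantities are continuous in time.

The PDE states are only weak solutions with values in \<open>L\<^sub>2\<close>, so energy identities are not at hand;
all bounds are obtained by duality instead. Testing the equation with a profile that is carried
along the characteristics, \<open>\<phi>(x,t) = \<psi>(x + B(T) - B(t))\<close> with \<open>B\<close> the distance travelled, removes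
the state from the interior term and leaves a Duhamel formula for \<open>\<integral> w(x,T) \<psi>(x) dx\<close>
(\<open>transport_duhamel\<close>). In it, sources older than \<open>1/|m|\<close> do not contribute and the inflow term is
a change of variables, so it is bounded by a constant times \<open>\<parallel>\<psi>\<parallel>\<close> uniformly in \<open>T\<close>
(\<open>transport_solution_bound\<close>); such \<open>\<psi>\<close> are dense (\<open>L2norm_le_by_duality\<close>). The bound for
\<open>u_x\<close> comes from the same formula tested with \<open>\<psi>'\<close>: the compatibility of \<open>u\<close> with its inflow
values makes the boundary terms cancel, and the derivative moves to the Lipschitz input
(\<open>transport_solution_derivative_bound\<close>).

For the ODE part, \<open>\<epsilon> = X - \<Omega>0 - a \<Omega>\<close> satisfies \<open>\<epsilon>' = Abar \<epsilon>\<close> and \<open>epshat = \<epsilon> + (a - ahat) \<Omega>\<close>, and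
\<open>(a - ahat)\<^sup>2/2 + \<gamma>3 \<epsilon>\<^sup>2/(4 |Abar|)\<close> plays the role of \<open>W\<close>. Since \<open>V\<close> is constant, \<open>X\<close>, \<open>\<Omega>\<close>
and \<open>\<Omega>0\<close> converge; if \<open>V \<noteq> 0\<close> the limit of \<open>\<Omega>\<close> is not zero, and \<open>a - ahat\<close> solves a linear equation
with damping bounded away from zero and vanishing forcing (\<open>stable_linear_ode_tendsto_0\<close>).\<close>

section \<open>Monotonicity from one-sided derivatives\<close>

text \<open>One-sided information suffices for monotonicity: the set of points \<open>x\<close> at which the increase of \<open>f\<close> is at
most \<open>e (x - a)\<close> is closed, and the hypothesis pushes its supremum to the right. Both the jumping
right-hand side of the projected law and the merely Lipschitz input call for this form.\<close>

lemma nonincreasing_if_Dini_nonpos: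
  fixes f :: "real \<Rightarrow> real"
  assumes ab: "a \<le> b" and cont: "continuous_on {a..b} f"
    and dini: "\<And>x e. a \<le> x \<Longrightarrow> x < b \<Longrightarrow> 0 < e \<Longrightarrow>
      eventually (\<lambda>y. f y - f x \<le> e * (y - x)) (at_right x)"
  shows "f b \<le> f a"
proof -
  have "f b - f a \<le> e * (b - a)" if e: "e > 0" for e
  proof -
    define S where "S = {x \<in> {a..b}. f x - e * x \<le> f a - e * a}"
    have "closed S" unfolding S_def
      by (rule continuous_on_closed_Collect_le) (intro continuous_intros cont closed_atLeastAtMost)+
    have "a \<in> S" using ab by (auto simp: S_def)
    have bd: "bdd_above S" by (rule bdd_aboveI[of _ b]) (auto simp: S_def)
    define s where "s = Sup S"
    have sS: "s \<in> S" unfolding s_def using \<open>closed S\<close> bd \<open>a \<in> S\<close>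
      by (intro closed_contains_Sup) auto
    have "s = b"
    proof (rule ccontr)
      assume "s \<noteq> b"
      with sS have s: "a \<le> s" "s < b" by (auto simp: S_def)
      have "eventually (\<lambda>y. f y - f s \<le> e * (y - s) \<and> s < y \<and> y < b) (at_right s)"
        using dini[OF s e] eventually_at_right_real[OF s(2)] by eventually_elim auto
      then obtain y where y: "f y - f s \<le> e * (y - s)" "s < y" "y < b"
        using eventually_happens' trivial_limit_at_right_real by blast
      have "y \<in> S" using y s sS by (auto simp: S_def algebra_simps)
      then have "y \<le> s" unfolding s_def using bd by (rule cSup_upper)
      then show False using y by simp
    qed
    then show ?thesis using sS by (auto simp: S_def algebra_simps)
  qed
  note * = this
  show ?thesis
  proof (rule field_le_epsilon)
    fix e :: real assume "e > 0"
    then have "f b - f a \<le> e / (b - a + 1) * (b - a)" using ab by (intro *) auto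
    also have "\<dots> \<le> e" using ab \<open>e > 0\<close> by (simp add: field_simps)
    finally show "f b \<le> f a + e" by simp
  qed
qed

lemma nonincreasing_if_right_deriv_nonpos:
  fixes f :: "real \<Rightarrow> real"
  assumes "a \<le> b" "continuous_on {a..b} f"
    and der: "\<And>x. a \<le> x \<Longrightarrow> x < b \<Longrightarrow> (f has_real_derivative f' x) (at_right x)"
    and le: "\<And>x. a \<le> x \<Longrightarrow> x < b \<Longrightarrow> f' x \<le> 0"
  shows "f b \<le> f a"
proof (rule nonincreasing_if_Dini_nonpos[OF assms(1,2)])
  fix x e :: real assume x: "a \<le> x" "x < b" "0 < e"
  have lim: "((\<lambda>y. (f y - f x) / (y - x)) \<longlongrightarrow> f' x) (at_right x)"
    using der[OF x(1,2)] by (simp add: has_field_derivative_iff)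
  then have "eventually (\<lambda>y. (f y - f x) / (y - x) < e) (at_right x)"
    using le[OF x(1,2)] x(3) by (intro order_tendstoD(2)[OF lim]) auto
  then show "eventually (\<lambda>y. f y - f x \<le> e * (y - x)) (at_right x)"
    using eventually_at_right_less[of x] by eventually_elim (simp add: field_simps)
qed

section \<open>The space \<open>L\<^sub>2(0,1)\<close>\<close>

abbreviation I01 :: "real measure" where "I01 \<equiv> lebesgue_on {0..1}"

lemma in_L2_mult: assumes "in_L2 f" "in_L2 g" shows "integrable I01 (\<lambda>x. f x * g x)"
proof (rule Bochner_Integration.integrable_bound[where f="\<lambda>x. (f x)\<^sup>2 + (g x)\<^sup>2"])
  show "integrable I01 (\<lambda>x. (f x)\<^sup>2 + (g x)\<^sup>2)" "(\<lambda>x. f x * g x) \<in> borel_measurable I01"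
    using assms by (auto simp: in_L2_def)
  show "AE x in I01. norm (f x * g x) \<le> norm ((f x)\<^sup>2 + (g x)\<^sup>2)"
  proof (rule AE_I2)
    fix x show "norm (f x * g x) \<le> norm ((f x)\<^sup>2 + (g x)\<^sup>2)"
      using sum_squares_bound[of "\<bar>f x\<bar>" "\<bar>g x\<bar>"] mult_nonneg_nonneg[of "\<bar>f x\<bar>" "\<bar>g x\<bar>"]
      by (simp add: abs_mult del: mult_nonneg_nonneg)
  qed
qed

lemma in_L2_add: assumes "in_L2 f" "in_L2 g" shows "in_L2 (\<lambda>x. f x + g x)"
proof -
  have "integrable I01 (\<lambda>x. (f x)\<^sup>2 + (g x)\<^sup>2 + 2 * (f x * g x))"
    using assms in_L2_mult[OF assms] by (auto simp: in_L2_def)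
  then show ?thesis using assms by (auto simp: in_L2_def power2_sum mult.assoc)
qed

lemma in_L2_cmult: "in_L2 f \<Longrightarrow> in_L2 (\<lambda>x. c * f x)"
  by (auto simp: in_L2_def power_mult_distrib)

lemma in_L2_minus: "in_L2 f \<Longrightarrow> in_L2 (\<lambda>x. - f x)"
  using in_L2_cmult[of f "-1"] by simp

lemma in_L2_diff: assumes "in_L2 f" "in_L2 g" shows "in_L2 (\<lambda>x. f x - g x)"
  using in_L2_add[OF assms(1) in_L2_minus[OF assms(2)]] by simp

lemma in_L2_continuous: assumes "continuous_on {0..1} f" shows "in_L2 f"
  unfolding in_L2_def
  using assms by (auto intro!: continuous_imp_integrable_real continuous_intros
    continuous_imp_measurable_on_sets_lebesgue)

lemma in_L2_const: "in_L2 (\<lambda>x. c)"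
  by (intro in_L2_continuous continuous_intros)

lemmas in_L2_intros = in_L2_add in_L2_cmult in_L2_minus in_L2_diff in_L2_const

lemma int01_add: "integrable I01 f \<Longrightarrow> integrable I01 g \<Longrightarrow> int01 (\<lambda>x. f x + g x) = int01 f + int01 g"
  and int01_diff: "integrable I01 f \<Longrightarrow> integrable I01 g \<Longrightarrow> int01 (\<lambda>x. f x - g x) = int01 f - int01 g"
  and int01_cmult: "int01 (\<lambda>x. c * f x) = c * int01 f"
  by (auto simp: int01_def)

lemma int01_sq_nonneg: "0 \<le> int01 (\<lambda>x. (f x)\<^sup>2)"
  by (simp add: int01_def)

lemma L2norm_nonneg [simp]: "0 \<le> L2norm f"
  by (simp add: L2norm_def int01_sq_nonneg)

lemma L2norm_sq: "(L2norm f)\<^sup>2 = int01 (\<lambda>x. (f x)\<^sup>2)"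
  by (simp add: L2norm_def int01_sq_nonneg)

lemma L2norm_cmult: "L2norm (\<lambda>x. c * f x) = \<bar>c\<bar> * L2norm f"
  by (simp add: L2norm_def power_mult_distrib int01_cmult real_sqrt_mult)

lemma L2norm_minus: "L2norm (\<lambda>x. - f x) = L2norm f"
  by (simp add: L2norm_def)

lemma L2norm_sq_add:
  assumes "in_L2 f" "in_L2 g"
  shows "(L2norm (\<lambda>x. f x + g x))\<^sup>2 = (L2norm f)\<^sup>2 + 2 * int01 (\<lambda>x. f x * g x) + (L2norm g)\<^sup>2"
proof -
  have "int01 (\<lambda>x. (f x + g x)\<^sup>2) = int01 (\<lambda>x. ((f x)\<^sup>2 + 2 * (f x * g x)) + (g x)\<^sup>2)"
    by (simp add: power2_sum algebra_simps)
  also have "\<dots> = int01 (\<lambda>x. (f x)\<^sup>2) + 2 * int01 (\<lambda>x. f x * g x) + int01 (\<lambda>x. (g x)\<^sup>2)"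
    using assms in_L2_mult[OF assms] by (subst int01_add int01_cmult; simp add: in_L2_def)+
  finally show ?thesis by (simp add: L2norm_sq)
qed

text \<open>The squared norm of \<open>f + s g\<close> is a quadratic polynomial in \<open>s\<close> without negative values; its
discriminant gives the inequality.\<close>

lemma int01_Cauchy_Schwarz:
  assumes f: "in_L2 f" and g: "in_L2 g"
  shows "\<bar>int01 (\<lambda>x. f x * g x)\<bar> \<le> L2norm f * L2norm g"
proof -
  have q: "0 \<le> (L2norm f)\<^sup>2 + 2 * s * int01 (\<lambda>x. f x * g x) + s\<^sup>2 * (L2norm g)\<^sup>2" for s
  proof -
    have "0 \<le> (L2norm (\<lambda>x. f x + s * g x))\<^sup>2" by simp
    also have "\<dots> = (L2norm f)\<^sup>2 + 2 * s * int01 (\<lambda>x. f x * g x) + s\<^sup>2 * (L2norm g)\<^sup>2"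
      using L2norm_sq_add[OF f in_L2_cmult[OF g, of s]]
      by (simp add: L2norm_cmult power_mult_distrib int01_cmult mult.left_commute[of _ s])
    finally show ?thesis .
  qed
  define A B C where "A = L2norm f" "B = L2norm g" "C = int01 (\<lambda>x. f x * g x)"
  have q: "0 \<le> A\<^sup>2 + 2 * s * C + s\<^sup>2 * B\<^sup>2" for s using q[of s] by (simp add: A_B_C_def)
  have "A \<ge> 0" "B \<ge> 0" by (auto simp: A_B_C_def)
  have "C\<^sup>2 \<le> (A * B)\<^sup>2"
  proof (cases "B = 0")
    case True
    have "C = 0"
    proof (rule ccontr)
      assume "C \<noteq> 0"
      then show False using q[of "- (A\<^sup>2 + 1) / (2 * C)"] True by (simp add: field_simps)
    qed
    then show ?thesis by simp
  next
    case False
    have "0 \<le> A\<^sup>2 - C\<^sup>2 / B\<^sup>2" using q[of "- C / B\<^sup>2"] False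
      by (simp add: field_simps power2_eq_square)
    then show ?thesis using False by (simp add: divide_le_eq power_mult_distrib)
  qed
  then have "\<bar>C\<bar> \<le> A * B"
    using \<open>A \<ge> 0\<close> \<open>B \<ge> 0\<close> by (metis abs_le_square_iff abs_of_nonneg mult_nonneg_nonneg)
  then show ?thesis by (simp add: A_B_C_def)
qed

lemma L2norm_triangle:
  assumes f: "in_L2 f" and g: "in_L2 g"
  shows "L2norm (\<lambda>x. f x + g x) \<le> L2norm f + L2norm g"
proof (rule power2_le_imp_le)
  show "(L2norm (\<lambda>x. f x + g x))\<^sup>2 \<le> (L2norm f + L2norm g)\<^sup>2"
    using L2norm_sq_add[OF f g] int01_Cauchy_Schwarz[OF f g] by (simp add: power2_sum)
qed simp

lemma L2norm_triangle_diff: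
  assumes f: "in_L2 f" and g: "in_L2 g"
  shows "\<bar>L2norm f - L2norm g\<bar> \<le> L2norm (\<lambda>x. f x - g x)"
proof -
  have "L2norm f \<le> L2norm (\<lambda>x. f x - g x) + L2norm g"
    using L2norm_triangle[OF in_L2_diff[OF f g] g] by simp
  moreover have "L2norm g \<le> L2norm (\<lambda>x. g x - f x) + L2norm f"
    using L2norm_triangle[OF in_L2_diff[OF g f] f] by simp
  moreover have "L2norm (\<lambda>x. g x - f x) = L2norm (\<lambda>x. f x - g x)"
    using L2norm_minus[of "\<lambda>x. f x - g x"] by simp
  ultimately show ?thesis by linarith
qed

lemma L2norm_mono:
  assumes "in_L2 f" "in_L2 g" "\<And>x. x \<in> {0..1} \<Longrightarrow> \<bar>f x\<bar> \<le> \<bar>g x\<bar>"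
  shows "L2norm f \<le> L2norm g"
  unfolding L2norm_def int01_def using assms
  by (intro real_sqrt_le_mono integral_mono) (auto simp: in_L2_def abs_le_square_iff)

lemma L2norm_const: "L2norm (\<lambda>x. c) = \<bar>c\<bar>"
  by (simp add: L2norm_def int01_def measure_restrict_space)

lemma int01_continuous:
  assumes "continuous_on {0..1} f" shows "int01 f = integral {0..1} f"
  unfolding int01_def
  by (intro lebesgue_integral_eq_integral continuous_imp_integrable_real assms) auto

section \<open>Smooth test functions and duality\<close>

text \<open>Two derivatives are required because the bound for the spatial derivative of a solution tests the
transport equation with \<open>\<psi>'\<close>.\<close>

definition C2_test :: "(real \<Rightarrow> real) \<Rightarrow> (real \<Rightarrow> real) \<Rightarrow> (real \<Rightarrow> real) \<Rightarrow> bool" where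
  "C2_test \<psi> \<psi>' \<psi>'' \<longleftrightarrow>
     (\<forall>x. (\<psi> has_real_derivative \<psi>' x) (at x)) \<and> (\<forall>x. (\<psi>' has_real_derivative \<psi>'' x) (at x)) \<and>
     continuous_on UNIV \<psi>'' \<and> (\<exists>\<alpha>>0. \<exists>\<beta><1. \<forall>x. x \<notin> {\<alpha>..\<beta>} \<longrightarrow> \<psi> x = 0)"

lemma C2_test_continuous:
  assumes "C2_test \<psi> \<psi>' \<psi>''"
  shows "continuous_on S \<psi>" "continuous_on S \<psi>'" "continuous_on S \<psi>''"
  using assms unfolding C2_test_def
  by (meson DERIV_isCont continuous_at_imp_continuous_on, meson DERIV_isCont continuous_at_imp_continuous_on,
      meson continuous_on_subset top_greatest)

lemma DERIV_max_0_powers: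
  "((\<lambda>x. (max 0 x)^3) has_real_derivative 3 * (max 0 x)\<^sup>2) (at (x::real))"
  "((\<lambda>x. 3 * (max 0 x)\<^sup>2) has_real_derivative 6 * max 0 x) (at (x::real))"
  "((\<lambda>x. (max 0 x)\<^sup>2) has_real_derivative 2 * max 0 x) (at (x::real))"
proof -
  have sq: "((\<lambda>x. (max 0 x)\<^sup>2) has_real_derivative 2 * max 0 x) (at (x::real))" for x
  proof (cases "x = 0")
    case False
    then consider "x < 0" | "x > 0" by linarith
    then show ?thesis
    proof cases
      case 1
      show ?thesis
        by (rule has_field_derivative_transform_within_open[where f="\<lambda>x. 0" and S="{..<0}"]) (use 1 in auto)
    next
      case 2
      show ?thesis
        by (rule has_field_derivative_transform_within_open[where f="\<lambda>x. x\<^sup>2" and S="{0<..}"])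
          (use 2 in \<open>auto intro!: derivative_eq_intros\<close>)
    qed
  next
    case True
    have "((\<lambda>y::real. (max 0 y)\<^sup>2 / y) \<longlongrightarrow> 0) (at 0)"
    proof (rule Lim_null_comparison)
      show "\<forall>\<^sub>F y::real in at 0. norm ((max 0 y)\<^sup>2 / y) \<le> \<bar>y\<bar>"
        by (rule eventuallyI) (auto simp: max_def power2_eq_square)
      show "((\<lambda>y::real. \<bar>y\<bar>) \<longlongrightarrow> 0) (at 0)" by (auto intro!: tendsto_eq_intros)
    qed
    then show ?thesis using True by (simp add: has_field_derivative_iff)
  qed
  show "((\<lambda>x. (max 0 x)\<^sup>2) has_real_derivative 2 * max 0 x) (at (x::real))" by (rule sq)
  show "((\<lambda>x. 3 * (max 0 x)\<^sup>2) has_real_derivative 6 * max 0 x) (at (x::real))"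
    using DERIV_cmult[OF sq, of 3 x] by simp
  show "((\<lambda>x. (max 0 x)^3) has_real_derivative 3 * (max 0 x)\<^sup>2) (at (x::real))"
  proof -
    have "((\<lambda>x. x * (max 0 x)\<^sup>2) has_real_derivative 1 * (max 0 x)\<^sup>2 + 2 * max 0 x * x) (at x)"
      using DERIV_mult[OF DERIV_ident sq] by simp
    moreover have "(\<lambda>x. x * (max 0 x)\<^sup>2) = (\<lambda>x::real. (max 0 x)^3)"
      by (auto simp: max_def power2_eq_square power3_eq_cube)
    moreover have "1 * (max 0 x)\<^sup>2 + 2 * max 0 x * x = 3 * (max 0 x)\<^sup>2"
      by (auto simp: max_def power2_eq_square)
    ultimately show ?thesis by metis
  qed
qed

text \<open>Cubing the positive part of a parabola gives a twice continuously differentiable function that is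
positive exactly on \<open>]\<alpha>, 1 - \<alpha>[\<close>, at least for \<open>\<alpha> < 1/2\<close>. Products with polynomials are then test functions.\<close>

definition cubic_bump :: "real \<Rightarrow> real \<Rightarrow> real" where
  "cubic_bump \<alpha> x = (max 0 ((x - \<alpha>) * (1 - \<alpha> - x)))^3"

lemma cubic_bump_nonneg: "0 \<le> cubic_bump \<alpha> x" by (simp add: cubic_bump_def)

lemma cubic_bump_le_one:
  assumes "0 < \<alpha>" "\<alpha> < 1/2" shows "cubic_bump \<alpha> x \<le> 1"
proof -
  have "(x - \<alpha>) * (1 - \<alpha> - x) = (1/2 - \<alpha>)\<^sup>2 - (x - 1/2)\<^sup>2"
    by (simp add: power2_eq_square field_simps)
  also have "\<dots> \<le> (1/2 - \<alpha>)\<^sup>2" by simp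
  also have "\<dots> \<le> 1" using assms by (intro power_le_one) auto
  finally show ?thesis unfolding cubic_bump_def by (intro power_le_one) auto
qed

lemma C2_test_cubic_bump_mult:
  assumes "0 < \<alpha>" "\<alpha> < 1/2" and "real_polynomial_function q"
  shows "\<exists>\<psi>' \<psi>''. C2_test (\<lambda>x. cubic_bump \<alpha> x * q x) \<psi>' \<psi>''"
proof -
  obtain q' where q': "real_polynomial_function q'" "\<And>x. (q has_real_derivative q' x) (at x)"
    using has_real_derivative_polynomial_function[OF assms(3)] by blast
  obtain q'' where q'': "real_polynomial_function q''" "\<And>x. (q' has_real_derivative q'' x) (at x)"
    using has_real_derivative_polynomial_function[OF q'(1)] by blast
  have cont_q'': "continuous_on UNIV q''"
    using q''(1) continuous_on_polymonial_function real_polynomial_function_eq by blast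
  have cq: "continuous_on UNIV q" "continuous_on UNIV q'"
    using q' q'' assms(3) continuous_on_polymonial_function real_polynomial_function_eq by blast+
  define z z' :: "real \<Rightarrow> real" where "z = (\<lambda>x. (x - \<alpha>) * (1 - \<alpha> - x))" "z' = (\<lambda>x. 1 - 2 * x)"
  have z: "(z has_real_derivative z' x) (at x)" for x
    unfolding z_z'_def by (auto intro!: derivative_eq_intros simp: algebra_simps)
  have z': "(z' has_real_derivative -2) (at x)" for x
    unfolding z_z'_def by (auto intro!: derivative_eq_intros)
  have cz: "continuous_on UNIV z" "continuous_on UNIV z'" unfolding z_z'_def by (auto intro!: continuous_intros)
  define h1 where "h1 = (\<lambda>x. 3 * (max 0 (z x))\<^sup>2 * z' x)"
  define h2 where "h2 = (\<lambda>x. 6 * max 0 (z x) * z' x * z' x + (-2) * (3 * (max 0 (z x))\<^sup>2))"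
  have p1: "(cubic_bump \<alpha> has_real_derivative h1 x) (at x)" for x
    using DERIV_chain2[OF DERIV_max_0_powers(1) z] unfolding cubic_bump_def z_z'_def h1_def by simp
  have p2: "(h1 has_real_derivative h2 x) (at x)" for x
    unfolding h1_def h2_def using DERIV_mult[OF DERIV_chain2[OF DERIV_max_0_powers(2) z] z'] by simp
  have ch: "continuous_on UNIV h2" "continuous_on UNIV h1" "continuous_on UNIV (cubic_bump \<alpha>)"
    unfolding h2_def h1_def cubic_bump_def by (intro continuous_intros cz)+
  have "C2_test (\<lambda>x. cubic_bump \<alpha> x * q x) (\<lambda>x. h1 x * q x + q' x * cubic_bump \<alpha> x)
     (\<lambda>x. (h2 x * q x + q' x * h1 x) + (q'' x * cubic_bump \<alpha> x + h1 x * q' x))"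
    unfolding C2_test_def
  proof (intro conjI allI)
    fix x show "((\<lambda>x. cubic_bump \<alpha> x * q x) has_real_derivative h1 x * q x + q' x * cubic_bump \<alpha> x) (at x)"
      by (rule DERIV_mult[OF p1 q'(2)])
    show "((\<lambda>x. h1 x * q x + q' x * cubic_bump \<alpha> x) has_real_derivative
       (h2 x * q x + q' x * h1 x) + (q'' x * cubic_bump \<alpha> x + h1 x * q' x)) (at x)"
      by (rule DERIV_add[OF DERIV_mult[OF p2 q'(2)] DERIV_mult[OF q''(2) p1]])
  next
    show "continuous_on UNIV (\<lambda>x. (h2 x * q x + q' x * h1 x) + (q'' x * cubic_bump \<alpha> x + h1 x * q' x))"
      by (intro continuous_intros ch cont_q'' cq)
    have "cubic_bump \<alpha> x = 0" if "x \<notin> {\<alpha>..1 - \<alpha>}" for x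
    proof -
      have "(x - \<alpha>) * (1 - \<alpha> - x) \<le> 0"
        using that assms by (auto simp: mult_le_0_iff)
      then show ?thesis by (simp add: cubic_bump_def max_def)
    qed
    then show "\<exists>\<alpha>'>0. \<exists>\<beta><1. \<forall>x. x \<notin> {\<alpha>'..\<beta>} \<longrightarrow> cubic_bump \<alpha> x * q x = 0"
      using assms(1) by (intro exI[of _ \<alpha>] conjI exI[of _ "1 - \<alpha>"]) auto
  qed
  then show ?thesis by blast
qed


lemma AE_lebesgue_on_if_AE:
  assumes "AE x in lebesgue. P x" shows "AE x in I01. P x"
proof -
  have "AE x in lebesgue. x \<in> {0..1} \<longrightarrow> P x" using assms by eventually_elim simp
  then show ?thesis by (subst AE_restrict_space_iff) auto
qed

lemma L2_dominated_convergence: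
  assumes D: "in_L2 D" and meas: "\<And>n. f n \<in> borel_measurable I01"
    and bd: "\<And>n x. x \<in> {0..1} \<Longrightarrow> \<bar>f n x\<bar> \<le> D x"
    and lim: "AE x in I01. (\<lambda>n. f n x) \<longlonglongrightarrow> 0"
  shows "(\<lambda>n. L2norm (f n)) \<longlonglongrightarrow> 0"
proof -
  have "(\<lambda>n. int01 (\<lambda>x. (f n x)\<^sup>2)) \<longlonglongrightarrow> int01 (\<lambda>x. 0)" unfolding int01_def
  proof (rule integral_dominated_convergence[where w="\<lambda>x. (D x)\<^sup>2"])
    show "integrable I01 (\<lambda>x. (D x)\<^sup>2)" using D by (simp add: in_L2_def)
    show "\<And>n. (\<lambda>x. (f n x)\<^sup>2) \<in> borel_measurable I01" using meas by measurable
    show "AE x in I01. (\<lambda>n. (f n x)\<^sup>2) \<longlonglongrightarrow> 0"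
      using lim by eventually_elim (auto intro!: tendsto_eq_intros)
    show "AE x in I01. norm ((f n x)\<^sup>2) \<le> (D x)\<^sup>2" for n
    proof (rule AE_I2)
      fix x assume "x \<in> space I01"
      then show "norm ((f n x)\<^sup>2) \<le> (D x)\<^sup>2" using power_mono[OF bd[of x n], of 2] by simp
    qed
  qed simp
  then have "(\<lambda>n. sqrt (int01 (\<lambda>x. (f n x)\<^sup>2))) \<longlonglongrightarrow> sqrt 0"
    by (intro tendsto_real_sqrt) (simp add: int01_def)
  then show ?thesis by (simp add: L2norm_def)
qed

definition L2_approx :: "(real \<Rightarrow> real) \<Rightarrow> bool" where
  "L2_approx w \<longleftrightarrow> (\<forall>e>0. \<exists>\<psi> \<psi>' \<psi>''. C2_test \<psi> \<psi>' \<psi>'' \<and> L2norm (\<lambda>x. w x - \<psi> x) < e)"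

lemma L2_approx_closed:
  assumes w: "in_L2 w" and f: "\<And>n. in_L2 (f n)" "\<And>n. L2_approx (f n)"
    and lim: "(\<lambda>n. L2norm (\<lambda>x. f n x - w x)) \<longlonglongrightarrow> 0"
  shows "L2_approx w"
  unfolding L2_approx_def
proof (intro allI impI)
  fix e :: real assume e: "e > 0"
  obtain n where n: "L2norm (\<lambda>x. f n x - w x) < e/2"
    using order_tendstoD(2)[OF lim, of "e/2"] e by (auto simp: eventually_sequentially)
  obtain \<psi> \<psi>' \<psi>'' where \<psi>: "C2_test \<psi> \<psi>' \<psi>''" "L2norm (\<lambda>x. f n x - \<psi> x) < e/2"
    using f(2)[of n] e unfolding L2_approx_def by (meson half_gt_zero)
  have L: "in_L2 \<psi>" using C2_test_continuous(1)[OF \<psi>(1)] by (rule in_L2_continuous)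
  have "L2norm (\<lambda>x. w x - \<psi> x) = L2norm (\<lambda>x. - (f n x - w x) + (f n x - \<psi> x))" by simp
  also have "\<dots> \<le> L2norm (\<lambda>x. - (f n x - w x)) + L2norm (\<lambda>x. f n x - \<psi> x)"
    using w f L by (intro L2norm_triangle in_L2_intros)
  also have "L2norm (\<lambda>x. - (f n x - w x)) = L2norm (\<lambda>x. f n x - w x)" by (rule L2norm_minus)
  finally show "\<exists>\<psi> \<psi>' \<psi>''. C2_test \<psi> \<psi>' \<psi>'' \<and> L2norm (\<lambda>x. w x - \<psi> x) < e"
    using n \<psi> by (intro exI[of _ \<psi>] exI[of _ \<psi>'] exI[of _ \<psi>'']) auto
qed

lemma continuous_cubic_bump: "continuous_on S (cubic_bump \<alpha>)"
  unfolding cubic_bump_def by (intro continuous_intros)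

lemma L2_approx_cubic_bump_continuous:
  assumes \<alpha>: "0 < \<alpha>" "\<alpha> < 1/2" and g: "continuous_on {0..1} g"
  shows "L2_approx (\<lambda>x. cubic_bump \<alpha> x * g x)"
  unfolding L2_approx_def
proof (intro allI impI)
  fix e :: real assume e: "e > 0"
  obtain q where q: "real_polynomial_function q" "\<And>x. x \<in> {0..1} \<Longrightarrow> \<bar>g x - q x\<bar> < e/2"
    using Stone_Weierstrass_real_polynomial_function[OF _ g, of "e/2"] e by auto
  have cq: "continuous_on {0..1} q"
    using q(1) continuous_on_polymonial_function real_polynomial_function_eq by blast
  obtain \<psi>' \<psi>'' where t: "C2_test (\<lambda>x. cubic_bump \<alpha> x * q x) \<psi>' \<psi>''"
    using C2_test_cubic_bump_mult[OF \<alpha> q(1)] by blast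
  have "L2norm (\<lambda>x. cubic_bump \<alpha> x * g x - cubic_bump \<alpha> x * q x) \<le> L2norm (\<lambda>x. e/2)"
  proof (intro L2norm_mono in_L2_continuous continuous_intros g cq continuous_cubic_bump)
    fix x :: real assume "x \<in> {0..1}"
    then have "cubic_bump \<alpha> x * \<bar>g x - q x\<bar> \<le> 1 * (e/2)"
      using q(2)[of x] cubic_bump_le_one[OF \<alpha>] e by (intro mult_mono) auto
    then show "\<bar>cubic_bump \<alpha> x * g x - cubic_bump \<alpha> x * q x\<bar> \<le> \<bar>e/2\<bar>"
      using cubic_bump_nonneg[of \<alpha> x] e by (simp add: right_diff_distrib[symmetric] abs_mult)
  qed
  also have "\<dots> < e" using e by (simp add: L2norm_const)
  finally show "\<exists>\<psi> \<psi>' \<psi>''. C2_test \<psi> \<psi>' \<psi>'' \<and> L2norm (\<lambda>x. cubic_bump \<alpha> x * g x - \<psi> x) < e"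
    using t by blast
qed

lemma in_L2_bounded:
  assumes "f \<in> borel_measurable I01" "\<And>x. x \<in> {0..1} \<Longrightarrow> \<bar>f x\<bar> \<le> K"
  shows "in_L2 f"
  unfolding in_L2_def
proof
  have "integrable I01 (\<lambda>x. K\<^sup>2)" by (intro continuous_imp_integrable_real continuous_intros)
  then show "integrable I01 (\<lambda>x. (f x)\<^sup>2)"
  proof (rule Bochner_Integration.integrable_bound)
    show "AE x in I01. norm ((f x)\<^sup>2) \<le> norm (K\<^sup>2)"
    proof (rule AE_I2)
      fix x assume "x \<in> space I01"
      then have "\<bar>f x\<bar> \<le> \<bar>K\<bar>" using assms(2)[of x] by simp
      then show "norm ((f x)\<^sup>2) \<le> norm (K\<^sup>2)" by (simp add: abs_le_square_iff)
    qed
  qed (use assms in measurable)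
qed fact

text \<open>A measurable function is an almost everywhere limit of continuous functions; truncating these at the bound
\<open>K\<close> makes dominated convergence available.\<close>

lemma L2_approx_cubic_bump_bounded:
  assumes \<alpha>: "0 < \<alpha>" "\<alpha> < 1/2" and k: "k \<in> borel_measurable I01"
    and bd: "\<And>x. x \<in> {0..1} \<Longrightarrow> \<bar>k x\<bar> \<le> K"
  shows "L2_approx (\<lambda>x. cubic_bump \<alpha> x * k x)"
proof -
  have K: "K \<ge> 0" using bd[of 0] by auto
  have "(\<lambda>x. if x \<in> {0..1} then k x else 0) \<in> borel_measurable lebesgue"
    using k by (subst borel_measurable_if) auto
  then have "(\<lambda>x. if x \<in> {0..1} then k x else 0) measurable_on {0..1}"
    by (rule lebesgue_measurable_imp_measurable_on_real) auto
  then obtain N g where N: "negligible N" and g: "\<And>n::nat. continuous_on UNIV (g n)"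
      and lim: "\<And>x. x \<notin> N \<Longrightarrow> (\<lambda>n. g n x) \<longlonglongrightarrow> (if x \<in> {0..1} then k x else 0)"
    by (auto simp: measurable_on_def cong: if_cong)
  define c where "c = (\<lambda>n x. max (- K) (min K (g n x)))"
  have c: "continuous_on S (c n)" for n S
    unfolding c_def by (intro continuous_intros continuous_on_subset[OF g]) auto
  have cK: "\<bar>c n x\<bar> \<le> K" for n x using K by (auto simp: c_def)
  have L: "in_L2 (\<lambda>x. cubic_bump \<alpha> x * k x)"
  proof (rule in_L2_bounded)
    show "(\<lambda>x. cubic_bump \<alpha> x * k x) \<in> borel_measurable I01"
      using k continuous_imp_measurable_on_sets_lebesgue[OF continuous_cubic_bump, of "{0..1}" \<alpha>] by auto
    fix x :: real assume "x \<in> {0..1}"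
    then show "\<bar>cubic_bump \<alpha> x * k x\<bar> \<le> 1 * K" unfolding abs_mult
      using bd cubic_bump_le_one[OF \<alpha>] cubic_bump_nonneg by (intro mult_mono) auto
  qed
  show ?thesis
  proof (rule L2_approx_closed[OF L])
    show "in_L2 (\<lambda>x. cubic_bump \<alpha> x * c n x)" "L2_approx (\<lambda>x. cubic_bump \<alpha> x * c n x)" for n
      by (intro in_L2_continuous continuous_intros continuous_cubic_bump c,
          intro L2_approx_cubic_bump_continuous \<alpha> c)
    show "(\<lambda>n. L2norm (\<lambda>x. cubic_bump \<alpha> x * c n x - cubic_bump \<alpha> x * k x)) \<longlonglongrightarrow> 0"
    proof (rule L2_dominated_convergence[OF in_L2_const[of "2 * K"]])
      show "(\<lambda>x. cubic_bump \<alpha> x * c n x - cubic_bump \<alpha> x * k x) \<in> borel_measurable I01" for n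
        using k continuous_imp_measurable_on_sets_lebesgue[OF continuous_cubic_bump, of "{0..1}" \<alpha>]
         continuous_imp_measurable_on_sets_lebesgue[OF c, of "{0..1}" n] by auto
      fix n x assume x: "x \<in> {0..1::real}"
      have "\<bar>cubic_bump \<alpha> x * c n x - cubic_bump \<alpha> x * k x\<bar> = cubic_bump \<alpha> x * \<bar>c n x - k x\<bar>"
        using cubic_bump_nonneg[of \<alpha> x] by (simp add: right_diff_distrib[symmetric] abs_mult)
      also have "\<dots> \<le> 1 * (2 * K)"
        using cK[of n x] bd[OF x] cubic_bump_le_one[OF \<alpha>, of x] cubic_bump_nonneg[of \<alpha> x] by (intro mult_mono) auto
      finally show "\<bar>cubic_bump \<alpha> x * c n x - cubic_bump \<alpha> x * k x\<bar> \<le> 2 * K" by simp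
    next
      have "AE x in lebesgue. x \<notin> N" using N by (simp add: AE_not_in negligible_iff_null_sets)
      then have "AE x in I01. x \<notin> N" by (rule AE_lebesgue_on_if_AE)
      then show "AE x in I01. (\<lambda>n. cubic_bump \<alpha> x * c n x - cubic_bump \<alpha> x * k x) \<longlonglongrightarrow> 0"
      proof (rule AE_mp, intro AE_I2 impI)
        fix x assume x: "x \<in> space I01" "x \<notin> N"
        then have "(\<lambda>n. g n x) \<longlonglongrightarrow> k x" using lim[of x] by auto
        then have "(\<lambda>n. c n x) \<longlonglongrightarrow> max (- K) (min K (k x))" unfolding c_def by (intro tendsto_intros)
        also have "max (- K) (min K (k x)) = k x" using bd[of x] x by auto
        finally show "(\<lambda>n. cubic_bump \<alpha> x * c n x - cubic_bump \<alpha> x * k x) \<longlonglongrightarrow> 0"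
          by (auto intro!: tendsto_eq_intros)
      qed
    qed
  qed
qed

text \<open>The part of \<open>w\<close> lying below \<open>n\<close> times the \<open>n\<close>-th weight is that weight times a bounded function, and
these parts converge to \<open>w\<close> because the weights have a positive limit at every interior point.\<close>

lemma C2_tests_dense:
  assumes w: "in_L2 w"
  shows "L2_approx w"
proof -
  \<comment> \<open>the shift keeps all values below 1/2\<close>
  define \<alpha> where "\<alpha> n = inverse (real (Suc (n + 2)))" for n
  have \<alpha>: "0 < \<alpha> n" "\<alpha> n < 1/2" for n by (auto simp: \<alpha>_def field_simps)
  have \<alpha>0: "\<alpha> \<longlonglongrightarrow> 0"
    unfolding \<alpha>_def by (rule LIMSEQ_ignore_initial_segment[OF LIMSEQ_inverse_real_of_nat])
  have wm[measurable]: "w \<in> borel_measurable I01" using w by (simp add: in_L2_def)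
  have hm[measurable]: "cubic_bump a \<in> borel_measurable I01" for a
    by (intro continuous_imp_measurable_on_sets_lebesgue continuous_cubic_bump) auto
  define k where "k n x = (if \<bar>w x\<bar> \<le> real n * cubic_bump (\<alpha> n) x then w x / cubic_bump (\<alpha> n) x else 0)" for n x
  have km[measurable]: "k n \<in> borel_measurable I01" for n unfolding k_def by measurable
  have kb: "\<bar>k n x\<bar> \<le> real n" for n x
    using cubic_bump_nonneg[of "\<alpha> n" x] by (auto simp: k_def abs_div divide_le_eq)
  have hk: "cubic_bump (\<alpha> n) x * k n x = (if \<bar>w x\<bar> \<le> real n * cubic_bump (\<alpha> n) x then w x else 0)" for n x
    by (auto simp: k_def)
  show ?thesis
  proof (rule L2_approx_closed[OF w])
    show "L2_approx (\<lambda>x. cubic_bump (\<alpha> n) x * k n x)" for n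
      by (rule L2_approx_cubic_bump_bounded[OF \<alpha> km kb])
    show "in_L2 (\<lambda>x. cubic_bump (\<alpha> n) x * k n x)" for n
    proof (rule in_L2_bounded)
      show "\<bar>cubic_bump (\<alpha> n) x * k n x\<bar> \<le> 1 * real n" for x unfolding abs_mult
        using kb cubic_bump_le_one[OF \<alpha>] cubic_bump_nonneg by (intro mult_mono) auto
    qed measurable
    have aw: "in_L2 (\<lambda>x. \<bar>w x\<bar>)" using w by (simp add: in_L2_def)
    show "(\<lambda>n. L2norm (\<lambda>x. cubic_bump (\<alpha> n) x * k n x - w x)) \<longlonglongrightarrow> 0"
    proof (rule L2_dominated_convergence[OF aw])
      show "(\<lambda>x. cubic_bump (\<alpha> n) x * k n x - w x) \<in> borel_measurable I01" for n by measurable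
      show "\<bar>cubic_bump (\<alpha> n) x * k n x - w x\<bar> \<le> \<bar>w x\<bar>" for n x by (simp add: hk)
      have "AE x in lebesgue. x \<notin> {0, 1::real}"
        by (intro AE_not_in) (simp flip: negligible_iff_null_sets)
      then have "AE x in I01. x \<notin> {0, 1}" by (rule AE_lebesgue_on_if_AE)
      then show "AE x in I01. (\<lambda>n. cubic_bump (\<alpha> n) x * k n x - w x) \<longlonglongrightarrow> 0"
      proof (rule AE_mp, intro AE_I2 impI)
        fix x assume "x \<in> space I01" "x \<notin> {0, 1}"
        then have x: "0 < x" "x < 1" by auto
        have "(\<lambda>n. cubic_bump (\<alpha> n) x) \<longlonglongrightarrow> (max 0 ((x - 0) * (1 - 0 - x)))^3"
          unfolding cubic_bump_def by (intro tendsto_intros \<alpha>0)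
        also have "(max 0 ((x - 0) * (1 - 0 - x)))^3 = (x * (1 - x))^3" using x by simp
        finally have "(\<lambda>n. cubic_bump (\<alpha> n) x) \<longlonglongrightarrow> (x * (1 - x))^3" .
        moreover have "(x * (1 - x))^3 > 0" using x by simp
        ultimately have "filterlim (\<lambda>n. cubic_bump (\<alpha> n) x * real n) at_top sequentially"
          by (intro filterlim_tendsto_pos_mult_at_top filterlim_real_sequentially)
        then have "eventually (\<lambda>n. \<bar>w x\<bar> \<le> cubic_bump (\<alpha> n) x * real n) sequentially"
          by (simp add: filterlim_at_top)
        then have "eventually (\<lambda>n. cubic_bump (\<alpha> n) x * k n x - w x = 0) sequentially"
          by eventually_elim (simp add: hk mult.commute[of "real _"])
        then show "(\<lambda>n. cubic_bump (\<alpha> n) x * k n x - w x) \<longlonglongrightarrow> 0"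
          by (rule tendsto_eventually)
      qed
    qed
  qed
qed

text \<open>Testing with \<open>\<psi>\<close> close to \<open>w\<close> itself gives \<open>\<parallel>w\<parallel>\<^sup>2 \<le> C \<parallel>w\<parallel>\<close> in the limit. All bounds on weak solutions
below go through this lemma.\<close>

lemma L2norm_le_by_duality:
  assumes w: "in_L2 w" and C: "C \<ge> 0"
    and dual: "\<And>\<psi> \<psi>' \<psi>''. C2_test \<psi> \<psi>' \<psi>'' \<Longrightarrow> \<bar>int01 (\<lambda>x. w x * \<psi> x)\<bar> \<le> C * L2norm \<psi>"
  shows "L2norm w \<le> C"
proof -
  define A where "A = L2norm w"
  have A: "A \<ge> 0" by (simp add: A_def)
  have main: "A\<^sup>2 \<le> C * A + (C + A) * e" if e: "e > 0" for e
  proof -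
    obtain \<psi> \<psi>' \<psi>'' where \<psi>: "C2_test \<psi> \<psi>' \<psi>''" "L2norm (\<lambda>x. w x - \<psi> x) < e"
      using C2_tests_dense[OF w] e unfolding L2_approx_def by blast
    have L: "in_L2 \<psi>" using C2_test_continuous(1)[OF \<psi>(1)] by (rule in_L2_continuous)
    have "A\<^sup>2 = int01 (\<lambda>x. w x * \<psi> x + w x * (w x - \<psi> x))"
      unfolding A_def L2norm_sq by (simp add: power2_eq_square algebra_simps)
    also have "\<dots> = int01 (\<lambda>x. w x * \<psi> x) + int01 (\<lambda>x. w x * (w x - \<psi> x))"
      using w L by (intro int01_add in_L2_mult in_L2_intros)
    also have "\<dots> \<le> C * L2norm \<psi> + A * L2norm (\<lambda>x. w x - \<psi> x)"
      using dual[OF \<psi>(1)] int01_Cauchy_Schwarz[OF w in_L2_diff[OF w L]] by (simp add: A_def)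
    also have "\<dots> \<le> C * (A + e) + A * e"
      using L2norm_triangle_diff[OF w L] \<psi>(2) C A by (intro add_mono mult_left_mono) (auto simp: A_def)
    finally show ?thesis by (simp add: algebra_simps)
  qed
  have "A\<^sup>2 \<le> C * A"
  proof (rule field_le_epsilon)
    fix e :: real assume "e > 0"
    then have "A\<^sup>2 \<le> C * A + (C + A) * (e / (C + A + 1))"
      using C A by (intro main divide_pos_pos) auto
    also have "(C + A) * (e / (C + A + 1)) \<le> e" using C A \<open>e > 0\<close> by (simp add: field_simps)
    finally show "A\<^sup>2 \<le> C * A + e" by simp
  qed
  then show ?thesis using A C by (cases "A = 0") (auto simp: power2_eq_square A_def[symmetric])
qed

section \<open>Weak solutions along characteristics\<close>

lemma integral_from_0_DERIV:
  fixes c :: "real \<Rightarrow> real"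
  assumes "continuous_on {0..} c" "0 \<le> t"
  shows "((\<lambda>t. integral {0..t} c) has_real_derivative c t) (at t within {0..})"
proof -
  have "((\<lambda>t. integral {0..t} c) has_real_derivative c t) (at t within {0..t + 1})"
    using assms by (intro integral_has_real_derivative continuous_on_subset[OF assms(1)]) auto
  moreover have "at t within {0..t + 1} = at t within {0..}"
    by (rule at_within_nhd[of _ "{..<t + 1}"]) auto
  ultimately show ?thesis by simp
qed

text \<open>With \<open>\<phi>(x,t) = \<psi>(x + B(T) - B(t))\<close> the term \<open>\<phi>_t - c \<phi>_x\<close> vanishes on \<open>[0,T]\<close>, so only the sources,
the inflow and the initial state remain. A test function must however vanish at \<open>x = 1\<close> for all times,
also after \<open>T\<close>, when the carried profile would reach that end. The speed is therefore damped exponentially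
after \<open>T\<close>, fast enough that the profile moves by less than the distance \<open>1 - \<beta>\<close> from its support
to \<open>1\<close>.\<close>

lemma transport_duhamel:
  assumes sol: "transport_solution c f g w0 w"
    and cont: "continuous_on {0..} c" and neg: "\<And>t. 0 \<le> t \<Longrightarrow> c t \<le> 0"
    and \<psi>: "\<And>x. (\<psi> has_real_derivative \<psi>' x) (at x)" "continuous_on UNIV \<psi>'"
    and \<beta>: "\<beta> < 1" "\<And>x. x > \<beta> \<Longrightarrow> \<psi> x = 0"
    and T: "0 \<le> T"
  defines "B \<equiv> \<lambda>t. - integral {0..t} c"
  shows "((\<lambda>t. int01 (\<lambda>x. f x t * \<psi> (x + (B T - B t))) - c t * g t * \<psi> (B T - B t)) has_integral
     int01 (\<lambda>x. w x T * \<psi> x) - int01 (\<lambda>x. w0 x * \<psi> (x + B T))) {0..T}"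
proof -
  \<comment> \<open>after \<open>T\<close> the damped speed covers the distance \<open>|c T| / k < 1 - \<beta>\<close>\<close>
  define k where "k = (\<bar>c T\<bar> + 1) / (1 - \<beta>)"
  have k: "k > 0" using \<beta> by (auto simp: k_def intro!: divide_pos_pos)
  define c' where "c' t = c (min t T) * exp (- k * max 0 (t - T))" for t
  have cont': "continuous_on {0..} c'"
    unfolding c'_def using T
    by (intro continuous_intros continuous_on_compose2[OF cont]) auto
  define B' where "B' t = - integral {0..t} c'" for t
  have int': "c' integrable_on {s..t}" if "0 \<le> s" for s t
    using that by (intro integrable_continuous_real continuous_on_subset[OF cont']) auto
  have c'_eq: "c' t = c t" if "t \<le> T" for t using that by (simp add: c'_def)
  have c'_neg: "c' t \<le> 0" if "t \<ge> 0" for t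
    using that T neg[of "min t T"] by (auto simp: c'_def mult_le_0_iff)
  have B'_eq: "B' t = B t" if "t \<le> T" for t
    using that unfolding B_def B'_def by (intro arg_cong[where f=uminus] integral_cong) (auto simp: c'_eq)
  have B'_deriv: "(B' has_real_derivative - c' t) (at t within {0..})" if "0 \<le> t" for t
    unfolding B'_def by (intro DERIV_minus integral_from_0_DERIV cont' that)
  have B'_cont: "continuous_on {0..} B'"
    using B'_deriv by (auto simp: continuous_on_eq_continuous_within intro: DERIV_continuous)
  have B'_bound: "B' t - B T < 1 - \<beta>" if t: "0 \<le> t" for t
  proof (cases "t \<le> T")
    case True
    have "integral {0..T} c' = integral {0..t} c' + integral {t..T} c'"
      using True t int' by (simp add: Henstock_Kurzweil_Integration.integral_combine)
    moreover have "integral {t..T} c' \<le> integral {t..T} (\<lambda>_. 0)"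
      using t c'_neg by (intro integral_le int') auto
    ultimately have "B' t \<le> B' T" unfolding B'_def by simp
    then show ?thesis using B'_eq[of T] \<beta> by simp
  next
    case False
    have "integral {0..t} c' = integral {0..T} c' + integral {T..t} c'"
      using False T int' by (simp add: Henstock_Kurzweil_Integration.integral_combine)
    moreover have "integral {T..t} c' = c T * ((1 - exp (- k * (t - T))) / k)"
    proof (rule integral_unique)
      have "((\<lambda>s. c T * exp (- k * (s - T))) has_integral
           (- c T / k * exp (- k * (t - T)) - (- c T / k * exp (- k * (T - T))))) {T..t}"
        using False k
        by (intro fundamental_theorem_of_calculus)
          (auto intro!: derivative_eq_intros simp flip: has_real_derivative_iff_has_vector_derivative)
      moreover have "(- c T / k * exp (- k * (t - T)) - (- c T / k * exp (- k * (T - T)))) =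
         c T * ((1 - exp (- k * (t - T))) / k)" using k by (simp add: field_simps)
      ultimately have "((\<lambda>s. c T * exp (- k * (s - T))) has_integral
          c T * ((1 - exp (- k * (t - T))) / k)) {T..t}" by simp
      then show "(c' has_integral c T * ((1 - exp (- k * (t - T))) / k)) {T..t}"
        by (rule has_integral_eq[rotated]) (auto simp: c'_def min_def max_def)
    qed
    ultimately have "B' t - B T = - c T * ((1 - exp (- k * (t - T))) / k)"
      using B'_eq[of T] unfolding B'_def by simp
    also have "\<dots> \<le> \<bar>c T\<bar> * (1 / k)"
      using neg[OF T] k False by (intro mult_mono divide_right_mono) auto
    also have "\<dots> < 1 - \<beta>" using \<beta> by (simp add: k_def field_simps)
    finally show ?thesis .
  qed
  define \<phi> where "\<phi> x t = \<psi> (x + (B T - B' t))" for x t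
  define \<phi>x where "\<phi>x x t = \<psi>' (x + (B T - B' t))" for x t
  define \<phi>t where "\<phi>t x t = \<psi>' (x + (B T - B' t)) * c' t" for x t
  have c\<psi>: "continuous_on UNIV \<psi>" using \<psi>(1) by (meson DERIV_isCont continuous_at_imp_continuous_on)
  have "transport_test \<phi> \<phi>x \<phi>t"
    unfolding transport_test_def
  proof (intro conjI ballI allI impI)
    fix x t :: real assume x: "x \<in> {0..1}" and t: "t \<in> {0..}"
    show "((\<lambda>y. \<phi> y t) has_real_derivative \<phi>x x t) (at x within {0..1})"
      unfolding \<phi>_def \<phi>x_def
      by (rule has_field_derivative_at_within, rule DERIV_chain2[OF \<psi>(1), where Db=1, simplified])
        (auto intro!: derivative_eq_intros)
    have "((\<lambda>s. x + (B T - B' s)) has_real_derivative c' t) (at t within {0..})"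
      using t by (auto intro!: derivative_eq_intros B'_deriv)
    then show "((\<lambda>s. \<phi> x s) has_real_derivative \<phi>t x t) (at t within {0..})"
      unfolding \<phi>_def \<phi>t_def by (rule DERIV_chain2[OF \<psi>(1)])
  next
    have arg: "continuous_on ({0..1} \<times> {0..}) (\<lambda>z. fst z + (B T - B' (snd z)))"
      by (intro continuous_intros continuous_on_compose2[OF B'_cont]) auto
    show "continuous_on ({0..1} \<times> {0..}) (\<lambda>(x, t). \<phi> x t)"
      unfolding \<phi>_def split_beta by (intro continuous_on_compose2[OF c\<psi> arg]) auto
    show "continuous_on ({0..1} \<times> {0..}) (\<lambda>(x, t). \<phi>x x t)"
      unfolding \<phi>x_def split_beta by (intro continuous_on_compose2[OF \<psi>(2) arg]) auto
    show "continuous_on ({0..1} \<times> {0..}) (\<lambda>(x, t). \<phi>t x t)"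
      unfolding \<phi>t_def split_beta
      by (intro continuous_intros continuous_on_compose2[OF \<psi>(2) arg] continuous_on_compose2[OF cont']) auto
  next
    fix t :: real assume "0 \<le> t"
    then show "\<phi> 1 t = 0" unfolding \<phi>_def using B'_bound[of t] by (intro \<beta>(2)) simp
  qed
  then have "((\<lambda>t. int01 (\<lambda>x. w x t * (\<phi>t x t - c t * \<phi>x x t)) + int01 (\<lambda>x. f x t * \<phi> x t)
        - c t * g t * \<phi> 0 t) has_integral
        (int01 (\<lambda>x. w x T * \<phi> x T) - int01 (\<lambda>x. w0 x * \<phi> x 0))) {0..T}"
    using sol T unfolding transport_solution_def by blast
  moreover have "\<phi> x T = \<psi> x" "\<phi> x 0 = \<psi> (x + B T)" for x
    using T by (simp_all add: \<phi>_def B'_eq) (simp add: B_def)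
  ultimately have "((\<lambda>t. int01 (\<lambda>x. w x t * (\<phi>t x t - c t * \<phi>x x t)) + int01 (\<lambda>x. f x t * \<phi> x t)
        - c t * g t * \<phi> 0 t) has_integral
        (int01 (\<lambda>x. w x T * \<psi> x) - int01 (\<lambda>x. w0 x * \<psi> (x + B T)))) {0..T}"
    by simp
  then show ?thesis
  proof (rule has_integral_eq[rotated])
    fix t assume "t \<in> {0..T}"
    then show "int01 (\<lambda>x. w x t * (\<phi>t x t - c t * \<phi>x x t)) + int01 (\<lambda>x. f x t * \<phi> x t) - c t * g t * \<phi> 0 t
      = int01 (\<lambda>x. f x t * \<psi> (x + (B T - B t))) - c t * g t * \<psi> (B T - B t)"
      by (simp add: \<phi>_def \<phi>t_def \<phi>x_def c'_eq B'_eq) (simp add: int01_def)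
  qed
qed

lemma integral_vanishing_beyond_1:
  fixes k :: "real \<Rightarrow> real"
  assumes k: "continuous_on UNIV k" "\<And>x. 0 \<le> k x" "\<And>x. 1 \<le> x \<Longrightarrow> k x = 0" and d: "0 \<le> d"
  shows "integral {d..Y} k \<le> integral {0..1} k"
proof -
  have int: "k integrable_on {s..t}" for s t
    by (intro integrable_continuous_real continuous_on_subset[OF k(1)]) auto
  have "integral {d..Y} k \<le> integral {0..max 1 Y} k"
    using d k by (intro integral_subset_le int) auto
  also have "\<dots> = integral {0..1} k + integral {1..max 1 Y} k"
    using int by (simp add: Henstock_Kurzweil_Integration.integral_combine)
  also have "integral {1..max 1 Y} k = integral {1..max 1 Y} (\<lambda>_. 0)"
    by (intro integral_cong) (auto simp: k)
  finally show ?thesis by simp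
qed

lemma L2norm_shift_le:
  assumes \<psi>: "continuous_on UNIV \<psi>" "\<And>x. 1 \<le> x \<Longrightarrow> \<psi> x = 0" and d: "0 \<le> d"
  shows "L2norm (\<lambda>x. \<psi> (x + d)) \<le> L2norm \<psi>"
proof -
  have c: "continuous_on S \<psi>" for S using \<psi>(1) by (rule continuous_on_subset) simp
  have "int01 (\<lambda>x. (\<psi> (x + d))\<^sup>2) = integral {0..1} (\<lambda>x. (\<psi> (x + d))\<^sup>2)"
    by (intro int01_continuous continuous_intros continuous_on_compose2[OF \<psi>(1)]) auto
  also have "\<dots> = integral {d..1 + d} (\<lambda>x. (\<psi> x)\<^sup>2)"
    using integral_shift_real_ivl[where a=d and b="1 + d" and c=d and f="\<lambda>x. (\<psi> x)\<^sup>2"] by simp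
  also have "\<dots> \<le> integral {0..1} (\<lambda>x. (\<psi> x)\<^sup>2)"
    using \<psi> d by (intro integral_vanishing_beyond_1 continuous_intros) auto
  also have "\<dots> = int01 (\<lambda>x. (\<psi> x)\<^sup>2)"
    by (intro int01_continuous[symmetric] continuous_intros c)
  finally show ?thesis unfolding L2norm_def by simp
qed

text \<open>This is the substitution \<open>y = B(T) - B(t)\<close>: what enters through the boundary up to time \<open>T\<close> is distributed
over the distance travelled, and only \<open>[0,1]\<close> counts.\<close>

lemma inflow_integral_le:
  fixes c k :: "real \<Rightarrow> real"
  assumes cont: "continuous_on {0..} c" and neg: "\<And>t. 0 \<le> t \<Longrightarrow> c t \<le> 0"
    and k: "continuous_on UNIV k" "\<And>x. 0 \<le> k x" "\<And>x. 1 \<le> x \<Longrightarrow> k x = 0" and T: "0 \<le> T"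
  defines "B \<equiv> \<lambda>t. - integral {0..t} c"
  shows "(\<lambda>t. - c t * k (B T - B t)) integrable_on {0..T}"
    "integral {0..T} (\<lambda>t. - c t * k (B T - B t)) \<le> integral {0..1} k"
proof -
  define K where "K y = integral {0..y} k" for y
  have B_deriv: "(B has_real_derivative - c t) (at t within {0..})" if "0 \<le> t" for t
    unfolding B_def by (intro DERIV_minus integral_from_0_DERIV cont that)
  have B_mono: "B t \<le> B T" if "0 \<le> t" "t \<le> T" for t
  proof -
    have int: "c integrable_on {s..t}" if "0 \<le> s" for s t
      using that by (intro integrable_continuous_real continuous_on_subset[OF cont]) auto
    have "integral {0..T} c = integral {0..t} c + integral {t..T} c"
      using that int by (simp add: Henstock_Kurzweil_Integration.integral_combine)
    moreover have "integral {t..T} c \<le> integral {t..T} (\<lambda>_. 0)"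
      using that neg by (intro integral_le int) auto
    ultimately show ?thesis unfolding B_def by simp
  qed
  have K_deriv: "(K has_real_derivative k y) (at y within {0..})" if "0 \<le> y" for y
    unfolding K_def by (intro integral_from_0_DERIV continuous_on_subset[OF k(1)] that) auto
  have "((\<lambda>t. - c t * k (B T - B t)) has_integral (- K (B T - B T) - (- K (B T - B 0)))) {0..T}"
  proof (rule fundamental_theorem_of_calculus[OF T])
    fix t assume t: "t \<in> {0..T}"
    have "((\<lambda>t. B T - B t) has_real_derivative c t) (at t within {0..T})"
      using t by (auto intro!: derivative_eq_intros has_field_derivative_subset[OF B_deriv])
    moreover have "(K has_real_derivative k (B T - B t)) (at (B T - B t) within (\<lambda>t. B T - B t) ` {0..T})"
      using t B_mono by (intro has_field_derivative_subset[OF K_deriv]) auto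
    ultimately have "((K \<circ> (\<lambda>t. B T - B t)) has_real_derivative k (B T - B t) * c t) (at t within {0..T})"
      by (intro DERIV_image_chain)
    then have "((\<lambda>t. - K (B T - B t)) has_real_derivative - c t * k (B T - B t)) (at t within {0..T})"
      by (auto dest!: DERIV_minus simp: o_def mult.commute)
    then show "((\<lambda>t. - K (B T - B t)) has_vector_derivative - c t * k (B T - B t)) (at t within {0..T})"
      by (simp add: has_real_derivative_iff_has_vector_derivative)
  qed
  then have *: "((\<lambda>t. - c t * k (B T - B t)) has_integral K (B T)) {0..T}"
    by (simp add: K_def B_def)
  then show "(\<lambda>t. - c t * k (B T - B t)) integrable_on {0..T}" by blast
  show "integral {0..T} (\<lambda>t. - c t * k (B T - B t)) \<le> integral {0..1} k"
    using integral_unique[OF *] integral_vanishing_beyond_1[OF k, of 0 "B T"] by (simp add: K_def)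
qed

lemma integral_abs_le_L2norm:
  assumes "continuous_on UNIV \<psi>"
  shows "integral {0..1} (\<lambda>x. \<bar>\<psi> x\<bar>) \<le> L2norm \<psi>"
proof -
  have c: "continuous_on S \<psi>" for S using assms by (rule continuous_on_subset) simp
  have "integral {0..1} (\<lambda>x. \<bar>\<psi> x\<bar>) = int01 (\<lambda>x. \<bar>\<psi> x\<bar> * 1)"
    by (subst int01_continuous) (auto intro!: continuous_intros c)
  also have "\<dots> \<le> L2norm (\<lambda>x. \<bar>\<psi> x\<bar>) * L2norm (\<lambda>_. 1)"
    by (intro order_trans[OF abs_ge_self int01_Cauchy_Schwarz] in_L2_continuous continuous_intros c)
  also have "\<dots> = L2norm \<psi>" by (simp add: L2norm_const) (simp add: L2norm_def)
  finally show ?thesis .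
qed

lemma in_L2_shift:
  assumes "continuous_on UNIV \<psi>" shows "in_L2 (\<lambda>x. \<psi> (x + d))"
  by (intro in_L2_continuous continuous_on_compose2[OF assms] continuous_intros) auto

text \<open>The bound is uniform in \<open>T\<close> because the interval is flushed in the time \<open>1/|m|\<close>: the factor of \<open>S\<close>
is the longest time during which a source can act on the present state. It is also independent of how large
\<open>|c|\<close> is, as the inflow term is estimated after the change of variables.\<close>

lemma transport_solution_bound:
  assumes sol: "transport_solution c f g w0 w" and w0: "in_L2 w0"
    and cont: "continuous_on {0..} c" and neg: "\<And>t. 0 \<le> t \<Longrightarrow> c t \<le> m" "m < 0"
    and S: "\<And>t. 0 \<le> t \<Longrightarrow> L2norm (\<lambda>x. f x t) \<le> S"
    and G: "\<And>t. 0 \<le> t \<Longrightarrow> \<bar>g t\<bar> \<le> G" and T: "0 \<le> T"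
  shows "L2norm (\<lambda>x. w x T) \<le> L2norm w0 + S / (- m) + G"
proof (rule L2norm_le_by_duality)
  show "in_L2 (\<lambda>x. w x T)" using sol T by (simp add: transport_solution_def)
  have S0: "S \<ge> 0" using S[of 0] L2norm_nonneg[of "\<lambda>x. f x 0"] by linarith
  have G0: "G \<ge> 0" using G[of 0] by linarith
  have "S / (- m) \<ge> 0" using S0 neg(2) by (intro divide_nonneg_pos) auto
  then show "0 \<le> L2norm w0 + S / (- m) + G" using G0 L2norm_nonneg[of w0] by linarith
  fix \<psi> \<psi>' \<psi>'' assume t: "C2_test \<psi> \<psi>' \<psi>''"
  obtain \<beta> where \<beta>: "\<beta> < 1" "\<And>x. x > \<beta> \<Longrightarrow> \<psi> x = 0" using t unfolding C2_test_def by force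
  have c: "continuous_on S \<psi>" for S using t C2_test_continuous by blast
  have z: "\<psi> x = 0" if "1 \<le> x" for x using \<beta> that by auto
  have neg0: "c t \<le> 0" if "0 \<le> t" for t using neg that by force
  define B where "B \<equiv> \<lambda>t. - integral {0..t} c"
  have B_ge: "- m * (t - s) \<le> B t - B s" if "0 \<le> s" "s \<le> t" for s t
  proof -
    have int: "c integrable_on {s..t}" if "0 \<le> s" for s t
      using that by (intro integrable_continuous_real continuous_on_subset[OF cont]) auto
    have "integral {0..t} c = integral {0..s} c + integral {s..t} c"
      using that int by (simp add: Henstock_Kurzweil_Integration.integral_combine)
    moreover have "integral {s..t} c \<le> integral {s..t} (\<lambda>_. m)"
      using that neg by (intro integral_le int) auto
    ultimately show ?thesis using that unfolding B_def by (simp add: algebra_simps)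
  qed
  have B0: "0 \<le> B T - B t" if "0 \<le> t" "t \<le> T" for t
    using B_ge[OF that] neg(2) that by (smt (verit) mult_nonneg_nonneg)
  define F where "F t = int01 (\<lambda>x. f x t * \<psi> (x + (B T - B t))) - c t * g t * \<psi> (B T - B t)" for t
  have F: "(F has_integral int01 (\<lambda>x. w x T * \<psi> x) - int01 (\<lambda>x. w0 x * \<psi> (x + B T))) {0..T}"
    unfolding F_def B_def
    using t by (intro transport_duhamel[OF sol cont neg0 _ _ \<beta> T, where \<psi>'=\<psi>'])
      (auto simp: C2_test_def C2_test_continuous(2)[OF t])
  define r where "r = 1 / (- m)"
  have r: "r > 0" using neg(2) by (simp add: r_def)
  \<comment> \<open>majorants of the source term, which is absent more than \<open>r\<close> before \<open>T\<close>, and (up to the factor \<open>G\<close>) of the inflow term\<close>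
  define H1 where "H1 t = (if t \<in> {T - r..T} then S * L2norm \<psi> else 0)" for t
  define H2 where "H2 t = - c t * \<bar>\<psi> (B T - B t)\<bar>" for t
  have H2: "H2 integrable_on {0..T}" "integral {0..T} H2 \<le> integral {0..1} (\<lambda>x. \<bar>\<psi> x\<bar>)"
    unfolding H2_def B_def using T
    by (intro inflow_integral_le cont neg0 continuous_intros c; simp add: z)+
  have H1: "(H1 has_integral (T - max 0 (T - r)) * (S * L2norm \<psi>)) {0..T}"
  proof -
    have "((\<lambda>_. S * L2norm \<psi>) has_integral (T - max 0 (T - r)) * (S * L2norm \<psi>)) {max 0 (T - r)..T}"
      using has_integral_const_real[of "S * L2norm \<psi>" "max 0 (T - r)" T] T r by auto
    moreover have "{max 0 (T - r)..T} = {T - r..T} \<inter> {0..T}" by auto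
    ultimately show ?thesis unfolding H1_def by (subst has_integral_restrict_Int) simp
  qed
  have bd: "norm (F t) \<le> H1 t + G * H2 t" if "t \<in> {0..T}" for t
  proof -
    have t: "0 \<le> t" "t \<le> T" using that by auto
    have fL: "in_L2 (\<lambda>x. f x t)" using sol t by (simp add: transport_solution_def)
    have "\<bar>int01 (\<lambda>x. f x t * \<psi> (x + (B T - B t)))\<bar> \<le> H1 t"
    proof (cases "t < T - r")
      case True
      then have "1 \<le> - m * (T - t)" using neg(2) by (simp add: r_def field_simps)
      also have "\<dots> \<le> B T - B t" by (rule B_ge[OF t])
      finally have ge1: "1 \<le> B T - B t" .
      have "int01 (\<lambda>x. f x t * \<psi> (x + (B T - B t))) = 0"
        unfolding int01_def
      proof (rule integral_eq_zero_AE, rule AE_I2)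
        fix x assume "x \<in> space I01"
        then show "f x t * \<psi> (x + (B T - B t)) = 0" using ge1 by (simp add: z)
      qed
      then show ?thesis using S0 by (simp add: H1_def)
    next
      case False
      have "\<bar>int01 (\<lambda>x. f x t * \<psi> (x + (B T - B t)))\<bar> \<le> L2norm (\<lambda>x. f x t) * L2norm (\<lambda>x. \<psi> (x + (B T - B t)))"
        by (rule int01_Cauchy_Schwarz[OF fL in_L2_shift[OF c]])
      also have "\<dots> \<le> S * L2norm \<psi>"
        using S0 by (intro mult_mono S t L2norm_shift_le c z B0) auto
      finally show ?thesis using False t by (simp add: H1_def)
    qed
    moreover have "\<bar>c t * g t * \<psi> (B T - B t)\<bar> \<le> G * H2 t"
    proof -
      have "\<bar>c t * g t * \<psi> (B T - B t)\<bar> = \<bar>g t\<bar> * H2 t"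
        using neg0[OF t(1)] by (simp add: H2_def abs_mult)
      also have "\<dots> \<le> G * H2 t" using G[OF t(1)] neg0[OF t(1)]
        by (intro mult_right_mono) (auto simp: H2_def mult_le_0_iff)
      finally show ?thesis .
    qed
    ultimately show ?thesis unfolding F_def real_norm_def by linarith
  qed
  have "\<bar>integral {0..T} F\<bar> \<le> integral {0..T} (\<lambda>t. H1 t + G * H2 t)"
    unfolding real_norm_def[symmetric]
  proof (rule integral_norm_bound_integral)
    show "F integrable_on {0..T}" using F by blast
    show "(\<lambda>t. H1 t + G * H2 t) integrable_on {0..T}"
      using H1 H2(1) by (intro integrable_add integrable_on_mult_right) blast+
  qed (use bd in auto)
  also have "\<dots> = integral {0..T} H1 + G * integral {0..T} H2"
    using H1 H2 by (subst Henstock_Kurzweil_Integration.integral_add)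
      (auto intro!: integrable_on_mult_right has_integral_integrable[OF H1])
  also have "\<dots> \<le> r * (S * L2norm \<psi>) + G * L2norm \<psi>"
  proof (intro add_mono mult_left_mono G0)
    show "integral {0..T} H1 \<le> r * (S * L2norm \<psi>)"
      unfolding integral_unique[OF H1] using S0 by (intro mult_right_mono) auto
    show "integral {0..T} H2 \<le> L2norm \<psi>" using H2 integral_abs_le_L2norm[OF c] by linarith
  qed
  finally have "\<bar>int01 (\<lambda>x. w x T * \<psi> x) - int01 (\<lambda>x. w0 x * \<psi> (x + B T))\<bar> \<le> r * (S * L2norm \<psi>) + G * L2norm \<psi>"
    by (simp add: integral_unique[OF F])
  moreover have "\<bar>int01 (\<lambda>x. w0 x * \<psi> (x + B T))\<bar> \<le> L2norm w0 * L2norm \<psi>"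
  proof -
    have "\<bar>int01 (\<lambda>x. w0 x * \<psi> (x + B T))\<bar> \<le> L2norm w0 * L2norm (\<lambda>x. \<psi> (x + B T))"
      by (rule int01_Cauchy_Schwarz[OF w0 in_L2_shift[OF c]])
    also have "\<dots> \<le> L2norm w0 * L2norm \<psi>"
      using B0[of 0] T by (intro mult_left_mono L2norm_shift_le c z) (auto simp: B_def)
    finally show ?thesis .
  qed
  ultimately show "\<bar>int01 (\<lambda>x. w x T * \<psi> x)\<bar> \<le> (L2norm w0 + S / (- m) + G) * L2norm \<psi>"
    unfolding r_def by (simp add: algebra_simps)
qed

section \<open>Integration by parts with a boundary value\<close>

lemma approximate_identity:
  fixes k :: "real \<Rightarrow> real" and \<rho> :: "nat \<Rightarrow> real \<Rightarrow> real"
  assumes k: "continuous_on {0..1} k" and p: "p \<in> {0..1}"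
    and \<rho>: "\<And>n. N \<le> n \<Longrightarrow> continuous_on {0..1} (\<rho> n)" "\<And>n x. N \<le> n \<Longrightarrow> x \<in> {0..1} \<Longrightarrow> 0 \<le> \<rho> n x"
      "\<And>n. N \<le> n \<Longrightarrow> (\<rho> n has_integral 1) {0..1}"
      "\<And>n x. N \<le> n \<Longrightarrow> x \<in> {0..1} \<Longrightarrow> real n * \<bar>x - p\<bar> \<ge> 3 \<Longrightarrow> \<rho> n x = 0"
  shows "(\<lambda>n. integral {0..1} (\<lambda>x. k x * \<rho> n x)) \<longlonglongrightarrow> k p"
proof (rule LIMSEQ_I)
  fix e :: real assume e: "e > 0"
  obtain d where d: "d > 0" "\<And>x. x \<in> {0..1} \<Longrightarrow> \<bar>x - p\<bar> < d \<Longrightarrow> \<bar>k x - k p\<bar> < e/2"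
    using k p e unfolding continuous_on_iff dist_real_def by (meson half_gt_zero)
  \<comment> \<open>from here on the kernels live within the distance \<open>d\<close> of \<open>p\<close>\<close>
  obtain n0 :: nat where n0: "3 / d < real n0" using reals_Archimedean2 by blast
  have "norm (integral {0..1} (\<lambda>x. k x * \<rho> n x) - k p) < e" if n: "n \<ge> max N n0" for n
  proof -
    have nN: "N \<le> n" using n by simp
    have "3 / d < real n" using n n0 by simp
    then have nd: "3 < real n * d" using d by (simp add: field_simps)
    have int: "(\<lambda>x. k x * \<rho> n x) integrable_on {0..1}"
      by (intro integrable_continuous_real continuous_intros k \<rho> nN)
    have "integral {0..1} (\<lambda>x. k x * \<rho> n x) - k p = integral {0..1} (\<lambda>x. k x * \<rho> n x) - integral {0..1} (\<lambda>x. k p * \<rho> n x)"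
      using integral_unique[OF \<rho>(3)[OF nN]] by simp
    also have "\<dots> = integral {0..1} (\<lambda>x. k x * \<rho> n x - k p * \<rho> n x)"
      by (intro Henstock_Kurzweil_Integration.integral_diff[symmetric] integrable_continuous_real
          continuous_intros k \<rho> nN)
    also have "norm \<dots> \<le> integral {0..1} (\<lambda>x. e/2 * \<rho> n x)"
    proof (rule integral_norm_bound_integral)
      show "(\<lambda>x. k x * \<rho> n x - k p * \<rho> n x) integrable_on {0..1}" "(\<lambda>x. e/2 * \<rho> n x) integrable_on {0..1}"
        by (intro integrable_continuous_real continuous_intros k \<rho> nN)+
      fix x :: real assume x: "x \<in> {0..1}"
      show "norm (k x * \<rho> n x - k p * \<rho> n x) \<le> e/2 * \<rho> n x"
      proof (cases "\<bar>x - p\<bar> < d")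
        case True
        then show ?thesis using d(2)[OF x] \<rho>(2)[OF nN x]
          using mult_right_mono[of "\<bar>k x - k p\<bar>" "e/2" "\<rho> n x"]
          by (simp add: left_diff_distrib[symmetric] abs_mult)
      next
        case False
        then have "real n * d \<le> real n * \<bar>x - p\<bar>" by (intro mult_left_mono) auto
        then show ?thesis using \<rho>(4)[OF nN x] nd by simp
      qed
    qed
    also have "\<dots> = e/2" using integral_unique[OF \<rho>(3)[OF nN]] by simp
    finally show ?thesis using e by simp
  qed
  then show "\<exists>no. \<forall>n\<ge>no. norm (integral {0..1} (\<lambda>x. k x * \<rho> n x) - k p) < e" by blast
qed

text \<open>A continuously differentiable step from 0 (for \<open>s \<le> 1\<close>) to 1 (for \<open>s \<ge> 3\<close>), the primitive of the hat
function on \<open>[1,3]\<close>; written with positive parts it has its derivative without case distinctions.\<close>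

definition ramp :: "real \<Rightarrow> real" where
  "ramp s = ((max 0 (s - 1))\<^sup>2 - 2 * (max 0 (s - 2))\<^sup>2 + (max 0 (s - 3))\<^sup>2) / 2"

definition ramp' :: "real \<Rightarrow> real" where
  "ramp' s = max 0 (s - 1) - 2 * max 0 (s - 2) + max 0 (s - 3)"

lemma ramp_deriv: "(ramp has_real_derivative ramp' s) (at s)"
proof -
  have sh: "((\<lambda>s. (max 0 (s - a))\<^sup>2) has_real_derivative 2 * max 0 (s - a)) (at s)" for a s :: real
  proof -
    have "((\<lambda>s. s - a) has_real_derivative 1) (at s)" by (auto intro!: derivative_eq_intros)
    from DERIV_chain2[where f="\<lambda>x. (max 0 x)\<^sup>2", OF DERIV_max_0_powers(3) this] show ?thesis by simp
  qed
  show ?thesis unfolding ramp_def[abs_def] ramp'_def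
    using DERIV_cdivide[OF DERIV_add[OF DERIV_diff[OF sh[of 1 s] DERIV_cmult[OF sh[of 2 s], of 2]] sh[of 3 s]], of 2]
    by (simp add: diff_divide_distrib add_divide_distrib)
qed

lemma ramp'_nonneg: "0 \<le> ramp' s"
  and ramp'_0: "s \<le> 1 \<or> 3 \<le> s \<Longrightarrow> ramp' s = 0"
  and ramp_0: "s \<le> 1 \<Longrightarrow> ramp s = 0" and ramp_1: "3 \<le> s \<Longrightarrow> ramp s = 1"
  by (auto simp: ramp_def ramp'_def max_def power2_eq_square algebra_simps)

lemma ramp_bounds: "0 \<le> ramp s" "ramp s \<le> 1"
proof -
  have mono: "ramp s \<le> ramp t" if "s \<le> t" for s t
    using that by (intro DERIV_nonneg_imp_nondecreasing[OF that]) (use ramp_deriv ramp'_nonneg in blast)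
  show "0 \<le> ramp s" using mono[of "min s 1" s] ramp_0[of "min s 1"] by simp
  show "ramp s \<le> 1" using mono[of s "max s 3"] ramp_1[of "max s 3"] by simp
qed

lemma continuous_ramp: "continuous_on S ramp" "continuous_on S ramp'"
  unfolding ramp_def ramp'_def by (intro continuous_intros; simp)+

text \<open>The weak derivative is defined through test functions supported in \<open>]0,1[\<close>. Multiplying \<open>\<phi>\<close> by
cutoffs makes it admissible, and the derivatives of the cutoffs are approximate identities at 0 and 1, which
produce the boundary values of the continuous function \<open>w \<phi>\<close>.\<close>

lemma weak_deriv_by_parts:
  assumes w: "continuous_on {0..1} w" and w': "in_L2 w'" and wd: "has_weak_deriv w w'"
    and \<phi>: "\<And>x. x \<in> {0..1} \<Longrightarrow> (\<phi> has_real_derivative \<phi>' x) (at x within {0..1})"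
      "continuous_on {0..1} \<phi>'" and \<phi>1: "\<phi> 1 = 0"
  shows "int01 (\<lambda>x. w x * \<phi>' x) = - w 0 * \<phi> 0 - int01 (\<lambda>x. w' x * \<phi> x)"
proof -
  have c\<phi>: "continuous_on {0..1} \<phi>"
    unfolding continuous_on_eq_continuous_within using \<phi>(1) DERIV_continuous by blast
  define \<kappa> where "\<kappa> n x = ramp (real n * x) + ramp (real n * (1 - x)) - 1" for n x
  define l where "l n x = real n * ramp' (real n * x)" for n x
  define r where "r n x = real n * ramp' (real n * (1 - x))" for n x
  have c\<kappa>: "continuous_on S (\<kappa> n)" "continuous_on S (l n)" "continuous_on S (r n)" for n S
    unfolding \<kappa>_def l_def r_def
    by (intro continuous_intros continuous_on_compose2[OF continuous_ramp(1)[of UNIV]]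
        continuous_on_compose2[OF continuous_ramp(2)[of UNIV]]; simp)+
  have \<kappa>_le: "\<bar>\<kappa> n x\<bar> \<le> 1" for n x
    using ramp_bounds[of "real n * x"] ramp_bounds[of "real n * (1 - x)"] by (auto simp: \<kappa>_def)
  have dl: "((\<lambda>x. ramp (real n * x)) has_real_derivative l n x) (at x)" for n x
  proof -
    have "((\<lambda>x. real n * x) has_real_derivative real n) (at x)" by (auto intro!: derivative_eq_intros)
    from DERIV_chain2[OF ramp_deriv this] show ?thesis by (simp add: l_def mult.commute)
  qed
  have dr: "((\<lambda>x. ramp (real n * (1 - x))) has_real_derivative - r n x) (at x)" for n x
  proof -
    have "((\<lambda>x. real n * (1 - x)) has_real_derivative - real n) (at x)" by (auto intro!: derivative_eq_intros)
    from DERIV_chain2[OF ramp_deriv this] show ?thesis by (simp add: r_def mult.commute)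
  qed
  have d\<kappa>: "(\<kappa> n has_real_derivative l n x - r n x) (at x)" for n x
    unfolding \<kappa>_def using DERIV_diff[OF DERIV_add[OF dl dr] DERIV_const[of 1]] by simp
  have \<kappa>0: "\<kappa> n x = 0" "l n x = 0" "r n x = 0" if n: "4 \<le> n" and x: "x \<le> 1 / real n \<or> x \<ge> 1 - 1 / real n" for n x
  proof -
    have n': "real n \<ge> 4" using n by simp
    have "real n * x \<le> 1 \<or> real n * (1 - x) \<le> 1" using x n' by (auto simp: field_simps)
    then have "(real n * x \<le> 1 \<and> 3 \<le> real n * (1 - x)) \<or> (3 \<le> real n * x \<and> real n * (1 - x) \<le> 1)"
      using n' by (auto simp: algebra_simps)
    then show "\<kappa> n x = 0" "l n x = 0" "r n x = 0"
      by (auto simp: \<kappa>_def l_def r_def ramp_0 ramp_1 ramp'_0)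
  qed
  have eq: "int01 (\<lambda>x. w x * (\<kappa> n x * \<phi>' x)) + integral {0..1} (\<lambda>x. (w x * \<phi> x) * l n x)
      - integral {0..1} (\<lambda>x. (w x * \<phi> x) * r n x) = - int01 (\<lambda>x. w' x * (\<kappa> n x * \<phi> x))"
    if n: "4 \<le> n" for n
  proof -
    define \<Phi> where "\<Phi> x = (if x \<in> {0..1} then \<kappa> n x * \<phi> x else 0)" for x
    define \<Phi>' where "\<Phi>' x = (if x \<in> {0..1} then (l n x - r n x) * \<phi> x + \<phi>' x * \<kappa> n x else 0)" for x
    have n': "real n \<ge> 4" using n by simp
    have sm: "0 < 1 / real n" "1 / real n < 1/2" using n' by (auto simp: field_simps)
    have z: "\<Phi> x = 0" "\<Phi>' x = 0" if "x \<le> 1 / real n \<or> x \<ge> 1 - 1 / real n" for x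
      using \<kappa>0[OF n that] by (auto simp: \<Phi>_def \<Phi>'_def)
    have d: "(\<Phi> has_real_derivative \<Phi>' x) (at x)" for x
    proof (cases "x \<in> {0<..<1}")
      case True
      have "(\<phi> has_real_derivative \<phi>' x) (at x)"
        using \<phi>(1)[of x] True at_within_Icc_at[of 0 x 1] by simp
      then have "((\<lambda>x. \<kappa> n x * \<phi> x) has_real_derivative (l n x - r n x) * \<phi> x + \<phi>' x * \<kappa> n x) (at x)"
        by (rule DERIV_mult[OF d\<kappa>])
      then have "(\<Phi> has_real_derivative (l n x - r n x) * \<phi> x + \<phi>' x * \<kappa> n x) (at x)"
        by (rule has_field_derivative_transform_within_open[where S="{0<..<1}"]) (use True in \<open>auto simp: \<Phi>_def\<close>)
      then show ?thesis using True by (simp add: \<Phi>'_def)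
    next
      case False
      define W where "W = (if x \<le> 0 then {..<1 / real n} else {1 - 1 / real n<..})"
      have W: "open W" "x \<in> W" "\<And>y. y \<in> W \<Longrightarrow> \<Phi> y = 0"
        using False sm(1) order_le_less_trans[OF _ sm(1), of x] z(1)
        by (auto simp: W_def split: if_splits simp del: zero_less_divide_iff zero_less_divide_1_iff)
      have "((\<lambda>_. 0) has_real_derivative 0) (at x)" by simp
      then have "(\<Phi> has_real_derivative 0) (at x)"
        by (rule has_field_derivative_transform_within_open[OF _ W(1,2)]) (use W(3) in auto)
      moreover have "x \<le> 1 / real n \<or> 1 - 1 / real n \<le> x"
        using False sm(1) unfolding greaterThanLessThan_iff by linarith
      then have "\<Phi>' x = 0" by (rule z(2))
      ultimately show ?thesis by simp
    qed
    have c: "continuous_on UNIV \<Phi>'"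
    proof -
      have "continuous_on ({0..1} \<union> ({..0} \<union> {1..})) \<Phi>'" unfolding \<Phi>'_def
      proof (rule continuous_on_If)
        show "closed ({..0} \<union> {1..} :: real set)" by (intro closed_Un closed_atMost closed_atLeast)
        show "continuous_on {0..1} (\<lambda>x. (l n x - r n x) * \<phi> x + \<phi>' x * \<kappa> n x)"
          by (intro continuous_intros c\<kappa> c\<phi> \<phi>)
        fix x :: real assume "x \<in> {..0} \<union> {1..}" "x \<in> {0..1}"
        then have "x \<le> 1 / real n \<or> 1 - 1 / real n \<le> x" "x \<in> {0..1}" using sm(1) by auto
        then have "\<Phi>' x = 0" "x \<in> {0..1}" using z by auto
        then show "(l n x - r n x) * \<phi> x + \<phi>' x * \<kappa> n x = 0" by (simp add: \<Phi>'_def)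
      qed auto
      moreover have "{0..1} \<union> ({..0} \<union> {1..}) = (UNIV :: real set)" by auto
      ultimately show ?thesis by simp
    qed
    have "int01 (\<lambda>x. w x * \<Phi>' x) = - int01 (\<lambda>x. w' x * \<Phi> x)"
      using wd[unfolded has_weak_deriv_def, rule_format, of "1 / real n" "1 - 1 / real n" \<Phi> \<Phi>'] sm z d c
      by (auto simp: not_le)
    also have "int01 (\<lambda>x. w' x * \<Phi> x) = int01 (\<lambda>x. w' x * (\<kappa> n x * \<phi> x))"
      unfolding int01_def by (intro Bochner_Integration.integral_cong) (auto simp: \<Phi>_def)
    also have "int01 (\<lambda>x. w x * \<Phi>' x) = int01 (\<lambda>x. w x * (\<kappa> n x * \<phi>' x) + (w x * \<phi> x * l n x - w x * \<phi> x * r n x))"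
      unfolding int01_def by (intro Bochner_Integration.integral_cong) (auto simp: \<Phi>'_def algebra_simps)
    also have "\<dots> = int01 (\<lambda>x. w x * (\<kappa> n x * \<phi>' x)) + (int01 (\<lambda>x. w x * \<phi> x * l n x) - int01 (\<lambda>x. w x * \<phi> x * r n x))"
    proof -
      have i: "integrable I01 (\<lambda>x. w x * (\<kappa> n x * \<phi>' x))" "integrable I01 (\<lambda>x. w x * \<phi> x * l n x)"
        "integrable I01 (\<lambda>x. w x * \<phi> x * r n x)"
        by (intro continuous_imp_integrable_real continuous_intros w c\<phi> c\<kappa> \<phi>)+
      show ?thesis
        using int01_add[OF i(1) Bochner_Integration.integrable_diff[OF i(2,3)]] int01_diff[OF i(2,3)] by simp
    qed
    also have "int01 (\<lambda>x. w x * \<phi> x * l n x) = integral {0..1} (\<lambda>x. w x * \<phi> x * l n x)"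
      by (intro int01_continuous continuous_intros w c\<phi> c\<kappa>)
    also have "int01 (\<lambda>x. w x * \<phi> x * r n x) = integral {0..1} (\<lambda>x. w x * \<phi> x * r n x)"
      by (intro int01_continuous continuous_intros w c\<phi> c\<kappa>)
    finally show ?thesis by simp
  qed
  have lim\<kappa>: "(\<lambda>n. \<kappa> n x) \<longlonglongrightarrow> 1" if x: "0 < x" "x < 1" for x
  proof -
    obtain n0 :: nat where n0: "3 / x < real n0" using reals_Archimedean2 by blast
    obtain n1 :: nat where n1: "3 / (1 - x) < real n1" using reals_Archimedean2 by blast
    have "\<kappa> n x = 1" if "n \<ge> max n0 n1" for n
    proof -
      have "3 / x < real n" "3 / (1 - x) < real n" using that n0 n1 by auto
      then have "3 \<le> real n * x" "3 \<le> real n * (1 - x)" using x by (auto simp: field_simps)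
      then show ?thesis by (simp add: \<kappa>_def ramp_1)
    qed
    then show ?thesis by (rule tendsto_eventually[OF eventually_sequentiallyI])
  qed
  have dom: "(\<lambda>n. int01 (\<lambda>x. f x * (\<kappa> n x * g x))) \<longlonglongrightarrow> int01 (\<lambda>x. f x * g x)"
    if f: "in_L2 f" and g: "in_L2 g" for f g
    unfolding int01_def
  proof (rule integral_dominated_convergence)
    have [measurable]: "f \<in> borel_measurable I01" "g \<in> borel_measurable I01" "\<kappa> n \<in> borel_measurable I01" for n
      using f g continuous_imp_measurable_on_sets_lebesgue[OF c\<kappa>(1)[of "{0..1}"]] by (auto simp: in_L2_def)
    show "(\<lambda>x. f x * g x) \<in> borel_measurable I01" "\<And>n. (\<lambda>x. f x * (\<kappa> n x * g x)) \<in> borel_measurable I01"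
      by measurable
    show "integrable I01 (\<lambda>x. \<bar>f x * g x\<bar>)" using in_L2_mult[OF f g] by simp
    show "AE x in I01. norm (f x * (\<kappa> n x * g x)) \<le> \<bar>f x * g x\<bar>" for n
    proof (rule AE_I2)
      fix x
      have "\<bar>\<kappa> n x\<bar> * \<bar>f x * g x\<bar> \<le> 1 * \<bar>f x * g x\<bar>" by (intro mult_right_mono \<kappa>_le) auto
      then show "norm (f x * (\<kappa> n x * g x)) \<le> \<bar>f x * g x\<bar>" by (simp add: abs_mult mult_ac)
    qed
    have "AE x in lebesgue. x \<notin> {0, 1::real}" by (intro AE_not_in) (simp flip: negligible_iff_null_sets)
    then have "AE x in I01. x \<notin> {0, 1}" by (rule AE_lebesgue_on_if_AE)
    then show "AE x in I01. (\<lambda>n. f x * (\<kappa> n x * g x)) \<longlonglongrightarrow> f x * g x"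
    proof (rule AE_mp, intro AE_I2 impI)
      fix x assume "x \<in> space I01" "x \<notin> {0, 1}"
      then have "(\<lambda>n. \<kappa> n x) \<longlonglongrightarrow> 1" by (intro lim\<kappa>) auto
      then show "(\<lambda>n. f x * (\<kappa> n x * g x)) \<longlonglongrightarrow> f x * g x" by (auto intro!: tendsto_eq_intros)
    qed
  qed
  have L: "in_L2 w" "in_L2 \<phi>" "in_L2 \<phi>'" using w c\<phi> \<phi>(2) by (auto intro: in_L2_continuous)
  have k: "continuous_on {0..1} (\<lambda>x. w x * \<phi> x)" by (intro continuous_intros w c\<phi>)
  have liml: "(\<lambda>n. integral {0..1} (\<lambda>x. (w x * \<phi> x) * l n x)) \<longlonglongrightarrow> w 0 * \<phi> 0"
  proof (rule approximate_identity[OF k, where N=4 and \<rho>=l])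
    fix n :: nat assume n: "4 \<le> n"
    have "(l n has_integral ramp (real n * 1) - ramp (real n * 0)) {0..1}"
      by (rule fundamental_theorem_of_calculus)
        (auto intro: has_vector_derivative_at_within[OF dl[unfolded has_real_derivative_iff_has_vector_derivative]])
    then show "(l n has_integral 1) {0..1}" using n by (simp add: ramp_0 ramp_1)
  qed (auto simp: c\<kappa>(2)[unfolded l_def[abs_def]] l_def ramp'_nonneg intro!: mult_nonneg_nonneg ramp'_0)
  have limr: "(\<lambda>n. integral {0..1} (\<lambda>x. (w x * \<phi> x) * r n x)) \<longlonglongrightarrow> w 1 * \<phi> 1"
  proof (rule approximate_identity[OF k, where N=4 and \<rho>=r])
    fix n :: nat assume n: "4 \<le> n"
    have "(r n has_integral - ramp (real n * (1 - 1)) - (- ramp (real n * (1 - 0)))) {0..1}"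
      by (rule fundamental_theorem_of_calculus)
        (auto intro: has_vector_derivative_at_within[OF DERIV_minus[OF dr, simplified, unfolded has_real_derivative_iff_has_vector_derivative]])
    then show "(r n has_integral 1) {0..1}" using n by (simp add: ramp_0 ramp_1)
  qed (auto simp: c\<kappa>(3)[unfolded r_def[abs_def]] r_def ramp'_nonneg intro!: mult_nonneg_nonneg ramp'_0)
  have "(\<lambda>n. int01 (\<lambda>x. w x * (\<kappa> n x * \<phi>' x)) + integral {0..1} (\<lambda>x. (w x * \<phi> x) * l n x)
      - integral {0..1} (\<lambda>x. (w x * \<phi> x) * r n x)) \<longlonglongrightarrow> int01 (\<lambda>x. w x * \<phi>' x) + w 0 * \<phi> 0 - w 1 * \<phi> 1"
    by (intro tendsto_intros dom liml limr L)
  moreover have "(\<lambda>n. int01 (\<lambda>x. w x * (\<kappa> n x * \<phi>' x)) + integral {0..1} (\<lambda>x. (w x * \<phi> x) * l n x)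
      - integral {0..1} (\<lambda>x. (w x * \<phi> x) * r n x)) \<longlonglongrightarrow> - int01 (\<lambda>x. w' x * \<phi> x)"
  proof (rule Lim_transform_eventually)
    show "(\<lambda>n. - int01 (\<lambda>x. w' x * (\<kappa> n x * \<phi> x))) \<longlonglongrightarrow> - int01 (\<lambda>x. w' x * \<phi> x)"
      by (intro tendsto_intros dom w' L)
    show "\<forall>\<^sub>F n in sequentially. - int01 (\<lambda>x. w' x * (\<kappa> n x * \<phi> x)) = int01 (\<lambda>x. w x * (\<kappa> n x * \<phi>' x))
       + integral {0..1} (\<lambda>x. (w x * \<phi> x) * l n x) - integral {0..1} (\<lambda>x. (w x * \<phi> x) * r n x)"
      using eventually_ge_at_top[of 4] by eventually_elim (simp add: eq)
  qed
  ultimately have "int01 (\<lambda>x. w x * \<phi>' x) + w 0 * \<phi> 0 - w 1 * \<phi> 1 = - int01 (\<lambda>x. w' x * \<phi> x)"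
    by (rule LIMSEQ_unique)
  then show ?thesis using \<phi>1 by simp
qed

text \<open>A Lipschitz function need not be differentiable, but in
\<open>\<integral>\<^sub>0\<^sup>s g h' - g(s) h(s)\<close> the contributions of the increments of \<open>h\<close> cancel to first order and the increments
of \<open>g\<close> contribute at most \<open>M |h|\<close> to the upper right derivative.\<close>

lemma Lipschitz_by_parts_le:
  fixes g h h' :: "real \<Rightarrow> real"
  assumes T: "0 \<le> T" and lip: "\<And>s t. 0 \<le> s \<Longrightarrow> s \<le> t \<Longrightarrow> t \<le> T \<Longrightarrow> \<bar>g t - g s\<bar> \<le> M * (t - s)"
    and h: "\<And>t. (h has_real_derivative h' t) (at t)" "continuous_on UNIV h'" and g: "continuous_on {0..T} g"
  shows "integral {0..T} (\<lambda>t. g t * h' t) - (g T * h T - g 0 * h 0) \<le> M * integral {0..T} (\<lambda>t. \<bar>h t\<bar>)"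
proof -
  have ch: "continuous_on S h" for S using h(1) by (meson DERIV_isCont continuous_at_imp_continuous_on)
  have ch': "continuous_on S h'" for S using h(2) by (rule continuous_on_subset) simp
  define q where "q t = g t * h' t - M * \<bar>h t\<bar>" for t
  have q: "continuous_on {0..T} q" unfolding q_def by (intro continuous_intros g ch ch')
  define Q where "Q s = integral {0..s} q" for s
  have Q: "(Q has_real_derivative q s) (at s within {0..T})" if "s \<in> {0..T}" for s
    unfolding Q_def by (intro integral_has_real_derivative q that)
  have cQ: "continuous_on {0..T} Q"
    unfolding continuous_on_eq_continuous_within using Q DERIV_continuous by blast
  define F where "F s = Q s - g s * h s" for s
  have "F T \<le> F 0"
  proof (rule nonincreasing_if_Dini_nonpos[OF T])
    show "continuous_on {0..T} F" unfolding F_def by (intro continuous_intros cQ g ch)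
    fix x e :: real assume x: "0 \<le> x" "x < T" and e: "0 < e"
    have le: "at_right x \<le> at x within {0..T}"
    proof -
      have "at_right x = at x within {x<..<T}" using x
        by (intro at_within_nhd[of _ "{..<T}"]) auto
      also have "\<dots> \<le> at x within {0..T}" using x by (intro at_le) auto
      finally show ?thesis .
    qed
    have l1: "((\<lambda>y. (Q y - Q x) / (y - x)) \<longlongrightarrow> q x) (at_right x)"
      using Q[of x] x le by (auto simp: has_field_derivative_iff intro: tendsto_mono)
    have l2: "((\<lambda>y. (h y - h x) / (y - x)) \<longlongrightarrow> h' x) (at_right x)"
      using has_field_derivative_at_within[OF h(1)[of x], of "{x<..}"] by (simp add: has_field_derivative_iff)
    have l3: "(g \<longlongrightarrow> g x) (at_right x)"
      using g x le by (auto simp: continuous_on_def intro: tendsto_mono)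
    have "((\<lambda>y. (Q y - Q x) / (y - x) - g y * ((h y - h x) / (y - x)) + M * \<bar>h x\<bar>) \<longlongrightarrow>
       q x - g x * h' x + M * \<bar>h x\<bar>) (at_right x)"
      by (intro tendsto_intros l1 l2 l3)
    then have "((\<lambda>y. (Q y - Q x) / (y - x) - g y * ((h y - h x) / (y - x)) + M * \<bar>h x\<bar>) \<longlongrightarrow> 0) (at_right x)"
      by (simp add: q_def)
    then have "\<forall>\<^sub>F y in at_right x. (Q y - Q x) / (y - x) - g y * ((h y - h x) / (y - x)) + M * \<bar>h x\<bar> < e"
      using e by (rule order_tendstoD(2))
    then show "\<forall>\<^sub>F y in at_right x. F y - F x \<le> e * (y - x)"
      using eventually_at_right_real[OF x(2)]
    proof eventually_elim
      case (elim y)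
      then have y: "x < y" "y < T" by auto
      have "- (g y - g x) * h x \<le> \<bar>g y - g x\<bar> * \<bar>h x\<bar>"
        by (metis abs_ge_self abs_minus_cancel abs_mult)
      also have "\<dots> \<le> M * (y - x) * \<bar>h x\<bar>" using lip[of x y] x y by (intro mult_right_mono) auto
      finally have "F y - F x \<le> (Q y - Q x) - g y * (h y - h x) + M * (y - x) * \<bar>h x\<bar>"
        by (simp add: F_def algebra_simps)
      also have "\<dots> = (y - x) * ((Q y - Q x) / (y - x) - g y * ((h y - h x) / (y - x)) + M * \<bar>h x\<bar>)"
      proof -
        have "d * (a / d - p * (b / d) + q) = a - p * b + q * d" if "d \<noteq> 0" for a b d p q :: real
          using that by (simp add: field_simps)
        from this[of "y - x" "Q y - Q x" "g y" "h y - h x" "M * \<bar>h x\<bar>"] show ?thesis using y by simp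
      qed
      also have "\<dots> \<le> (y - x) * e" using elim y by (intro mult_left_mono) auto
      finally show ?case by (simp add: mult.commute)
    qed
  qed
  moreover have "Q T = integral {0..T} (\<lambda>t. g t * h' t) - M * integral {0..T} (\<lambda>t. \<bar>h t\<bar>)"
    unfolding Q_def q_def
    by (subst Henstock_Kurzweil_Integration.integral_diff)
      (auto intro!: integrable_continuous_real continuous_intros g ch ch')
  ultimately show ?thesis by (simp add: F_def) (simp add: Q_def)
qed

lemma Lipschitz_by_parts:
  fixes g h h' :: "real \<Rightarrow> real"
  assumes T: "0 \<le> T" and lip: "\<And>s t. 0 \<le> s \<Longrightarrow> s \<le> t \<Longrightarrow> t \<le> T \<Longrightarrow> \<bar>g t - g s\<bar> \<le> M * (t - s)"
    and h: "\<And>t. (h has_real_derivative h' t) (at t)" "continuous_on UNIV h'" and g: "continuous_on {0..T} g"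
  shows "\<bar>integral {0..T} (\<lambda>t. g t * h' t) - (g T * h T - g 0 * h 0)\<bar> \<le> M * integral {0..T} (\<lambda>t. \<bar>h t\<bar>)"
proof -
  have "integral {0..T} (\<lambda>t. g t * - h' t) - (g T * - h T - g 0 * - h 0) \<le> M * integral {0..T} (\<lambda>t. \<bar>- h t\<bar>)"
    by (rule Lipschitz_by_parts_le[OF T _ DERIV_minus[OF h(1)] _ g]) (auto intro!: lip continuous_intros h)
  then show ?thesis using Lipschitz_by_parts_le[OF T lip h g] by simp
qed

section \<open>Combining and comparing weak solutions\<close>

lemma transport_test_slice:
  assumes "transport_test \<phi> \<phi>x \<phi>t" "0 \<le> t"
  shows "continuous_on {0..1} (\<lambda>x. \<phi> x t)" "continuous_on {0..1} (\<lambda>x. \<phi>x x t)" "continuous_on {0..1} (\<lambda>x. \<phi>t x t)"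
proof -
  have p: "continuous_on {0..1} (\<lambda>x::real. (x, t))" by (intro continuous_intros)
  have "(\<lambda>x. (x, t)) ` {0..1} \<subseteq> {0..1::real} \<times> {0..}" using assms(2) by auto
  note slice = continuous_on_compose2[OF _ p this]
  have "continuous_on ({0..1} \<times> {0..}) (\<lambda>(x, t). \<phi> x t)" "continuous_on ({0..1} \<times> {0..}) (\<lambda>(x, t). \<phi>x x t)"
    "continuous_on ({0..1} \<times> {0..}) (\<lambda>(x, t). \<phi>t x t)"
    using assms(1) unfolding transport_test_def by blast+
  from this[THEN slice] show "continuous_on {0..1} (\<lambda>x. \<phi> x t)" "continuous_on {0..1} (\<lambda>x. \<phi>x x t)"
    "continuous_on {0..1} (\<lambda>x. \<phi>t x t)" by simp_all
qed

lemma transport_solutionD: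
  assumes "transport_solution c f g w0 w"
  shows "0 \<le> t \<Longrightarrow> in_L2 (\<lambda>x. w x t)" "0 \<le> t \<Longrightarrow> in_L2 (\<lambda>x. f x t)"
    "0 \<le> t \<Longrightarrow> ((\<lambda>s. L2norm (\<lambda>x. w x s - w x t)) \<longlongrightarrow> 0) (at t within {0..})"
    "transport_test \<phi> \<phi>x \<phi>t \<Longrightarrow> 0 \<le> T \<Longrightarrow>
      ((\<lambda>t. int01 (\<lambda>x. w x t * (\<phi>t x t - c t * \<phi>x x t)) + int01 (\<lambda>x. f x t * \<phi> x t) - c t * g t * \<phi> 0 t)
      has_integral (int01 (\<lambda>x. w x T * \<phi> x T) - int01 (\<lambda>x. w0 x * \<phi> x 0))) {0..T}"
  using assms unfolding transport_solution_def by blast+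

text \<open>The term \<open>(b - c) w_x\<close> may be moved from the transport to the source when \<open>w_x\<close> exists; the boundary term
of the integration by parts turns the inflow term \<open>b g \<phi>(0)\<close> into \<open>c g \<phi>(0)\<close>, which is why \<open>w\<close> has to attain
its inflow data at \<open>x = 0\<close>.\<close>

lemma transport_change_speed:
  assumes sol: "transport_solution (\<lambda>t. b) f g w0 w"
    and w: "\<And>t. 0 \<le> t \<Longrightarrow> continuous_on {0..1} (\<lambda>x. w x t)"
    and wx: "\<And>t. 0 \<le> t \<Longrightarrow> in_L2 (\<lambda>x. wx x t) \<and> has_weak_deriv (\<lambda>x. w x t) (\<lambda>x. wx x t)"
    and bdry: "\<And>t. 0 \<le> t \<Longrightarrow> w 0 t = g t"
  shows "transport_solution c (\<lambda>x t. f x t + (b - c t) * wx x t) g w0 w"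
  unfolding transport_solution_def
proof (intro conjI allI impI)
  fix t :: real assume t: "0 \<le> t"
  show "in_L2 (\<lambda>x. w x t)" "in_L2 (\<lambda>x. f x t + (b - c t) * wx x t)"
    "((\<lambda>s. L2norm (\<lambda>x. w x s - w x t)) \<longlongrightarrow> 0) (at t within {0..})"
    using transport_solutionD(1-3)[OF sol t] wx[OF t] by (auto intro!: in_L2_add in_L2_cmult)
next
  fix \<phi> \<phi>x \<phi>t and T :: real assume test: "transport_test \<phi> \<phi>x \<phi>t" and T: "0 \<le> T"
  have "((\<lambda>t. int01 (\<lambda>x. w x t * (\<phi>t x t - b * \<phi>x x t)) + int01 (\<lambda>x. f x t * \<phi> x t) - b * g t * \<phi> 0 t)
      has_integral (int01 (\<lambda>x. w x T * \<phi> x T) - int01 (\<lambda>x. w0 x * \<phi> x 0))) {0..T}"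
    by (rule transport_solutionD(4)[OF sol test T])
  then show "((\<lambda>t. int01 (\<lambda>x. w x t * (\<phi>t x t - c t * \<phi>x x t)) + int01 (\<lambda>x. (f x t + (b - c t) * wx x t) * \<phi> x t) - c t * g t * \<phi> 0 t)
      has_integral (int01 (\<lambda>x. w x T * \<phi> x T) - int01 (\<lambda>x. w0 x * \<phi> x 0))) {0..T}"
  proof (rule has_integral_eq[rotated])
    fix t assume "t \<in> {0..T}"
    then have t: "0 \<le> t" by simp
    note sl = transport_test_slice[OF test t]
    have L: "in_L2 (\<lambda>x. w x t)" "in_L2 (\<lambda>x. f x t)" "in_L2 (\<lambda>x. wx x t)"
      "in_L2 (\<lambda>x. \<phi> x t)" "in_L2 (\<lambda>x. \<phi>x x t)" "in_L2 (\<lambda>x. \<phi>t x t)"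
      using transport_solutionD(1,2)[OF sol t] wx[OF t] sl in_L2_continuous by blast+
    have parts: "int01 (\<lambda>x. w x t * \<phi>x x t) = - g t * \<phi> 0 t - int01 (\<lambda>x. wx x t * \<phi> x t)"
      unfolding bdry[OF t, symmetric]
    proof (rule weak_deriv_by_parts[OF w[OF t] _ _ _ sl(2)])
      show "((\<lambda>x. \<phi> x t) has_real_derivative \<phi>x x t) (at x within {0..1})" if "x \<in> {0..1}" for x
        using test t that unfolding transport_test_def by simp
      show "\<phi> 1 t = 0" using test t unfolding transport_test_def by simp
    qed (use wx[OF t] in auto)
    have s: "int01 (\<lambda>x. w x t * (\<phi>t x t - d * \<phi>x x t)) = int01 (\<lambda>x. w x t * \<phi>t x t) - d * int01 (\<lambda>x. w x t * \<phi>x x t)" for d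
    proof -
      have "int01 (\<lambda>x. w x t * (\<phi>t x t - d * \<phi>x x t)) = int01 (\<lambda>x. w x t * \<phi>t x t - d * (w x t * \<phi>x x t))"
        by (simp add: algebra_simps)
      also have "\<dots> = int01 (\<lambda>x. w x t * \<phi>t x t) - d * int01 (\<lambda>x. w x t * \<phi>x x t)"
        by (subst int01_diff) (auto intro!: in_L2_mult L simp: int01_cmult)
      finally show ?thesis .
    qed
    have f: "int01 (\<lambda>x. (f x t + (b - c t) * wx x t) * \<phi> x t) = int01 (\<lambda>x. f x t * \<phi> x t) + (b - c t) * int01 (\<lambda>x. wx x t * \<phi> x t)"
    proof -
      have "int01 (\<lambda>x. (f x t + (b - c t) * wx x t) * \<phi> x t) = int01 (\<lambda>x. f x t * \<phi> x t + (b - c t) * (wx x t * \<phi> x t))"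
        by (simp add: algebra_simps)
      also have "\<dots> = int01 (\<lambda>x. f x t * \<phi> x t) + (b - c t) * int01 (\<lambda>x. wx x t * \<phi> x t)"
        by (subst int01_add) (auto intro!: in_L2_mult L simp: int01_cmult)
      finally show ?thesis .
    qed
    show "int01 (\<lambda>x. w x t * (\<phi>t x t - b * \<phi>x x t)) + int01 (\<lambda>x. f x t * \<phi> x t) - b * g t * \<phi> 0 t =
      int01 (\<lambda>x. w x t * (\<phi>t x t - c t * \<phi>x x t)) + int01 (\<lambda>x. (f x t + (b - c t) * wx x t) * \<phi> x t) - c t * g t * \<phi> 0 t"
      unfolding s f parts by (simp add: algebra_simps)
  qed
qed

definition L2_cont :: "(real \<Rightarrow> real \<Rightarrow> real) \<Rightarrow> bool" where
  "L2_cont w \<longleftrightarrow> (\<forall>t\<ge>0. in_L2 (\<lambda>x. w x t)) \<and>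
     (\<forall>t\<ge>0. ((\<lambda>s. L2norm (\<lambda>x. w x s - w x t)) \<longlongrightarrow> 0) (at t within {0..}))"

lemma transport_solution_L2_cont: "transport_solution c f g w0 w \<Longrightarrow> L2_cont w"
  by (simp add: transport_solution_def L2_cont_def)

lemma L2_cont_add:
  assumes w: "L2_cont w" and z: "L2_cont z" shows "L2_cont (\<lambda>x t. w x t + z x t)"
  unfolding L2_cont_def
proof (intro conjI allI impI)
  fix t :: real assume t: "0 \<le> t"
  show "in_L2 (\<lambda>x. w x t + z x t)" using w z t by (auto simp: L2_cont_def intro!: in_L2_intros)
  show "((\<lambda>s. L2norm (\<lambda>x. w x s + z x s - (w x t + z x t))) \<longlongrightarrow> 0) (at t within {0..})"
  proof (rule tendsto_sandwich[OF _ _ tendsto_const])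
    have "((\<lambda>s. L2norm (\<lambda>x. w x s - w x t) + L2norm (\<lambda>x. z x s - z x t)) \<longlongrightarrow> 0 + 0) (at t within {0..})"
      using w z t by (intro tendsto_add) (auto simp: L2_cont_def)
    then show "((\<lambda>s. L2norm (\<lambda>x. w x s - w x t) + L2norm (\<lambda>x. z x s - z x t)) \<longlongrightarrow> 0) (at t within {0..})" by simp
    show "\<forall>\<^sub>F s in at t within {0..}. L2norm (\<lambda>x. w x s + z x s - (w x t + z x t)) \<le> L2norm (\<lambda>x. w x s - w x t) + L2norm (\<lambda>x. z x s - z x t)"
      unfolding eventually_at_filter
    proof (rule always_eventually, intro allI impI)
      fix s :: real assume "s \<in> {0..}"
      then have s: "0 \<le> s" by simp
      have "L2norm (\<lambda>x. w x s + z x s - (w x t + z x t)) = L2norm (\<lambda>x. (w x s - w x t) + (z x s - z x t))"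
        by (simp add: algebra_simps)
      also have "\<dots> \<le> L2norm (\<lambda>x. w x s - w x t) + L2norm (\<lambda>x. z x s - z x t)"
        using w z s t by (intro L2norm_triangle in_L2_intros) (auto simp: L2_cont_def)
      finally show "L2norm (\<lambda>x. w x s + z x s - (w x t + z x t)) \<le> L2norm (\<lambda>x. w x s - w x t) + L2norm (\<lambda>x. z x s - z x t)" .
    qed
  qed (simp add: always_eventually)
qed

lemma L2_cont_norm:
  assumes w: "L2_cont w" shows "continuous_on {0..} (\<lambda>t. L2norm (\<lambda>x. w x t))"
  unfolding continuous_on_def
proof
  fix t :: real assume "t \<in> {0..}"
  then have t: "0 \<le> t" by simp
  show "((\<lambda>t. L2norm (\<lambda>x. w x t)) \<longlongrightarrow> L2norm (\<lambda>x. w x t)) (at t within {0..})"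
  proof (rule LIM_zero_cancel, rule Lim_null_comparison)
    show "((\<lambda>s. L2norm (\<lambda>x. w x s - w x t)) \<longlongrightarrow> 0) (at t within {0..})"
      using w t by (auto simp: L2_cont_def)
    show "\<forall>\<^sub>F s in at t within {0..}. norm (L2norm (\<lambda>x. w x s) - L2norm (\<lambda>x. w x t)) \<le> L2norm (\<lambda>x. w x s - w x t)"
      unfolding eventually_at_filter using w t
      by (intro always_eventually allI impI) (auto simp: L2_cont_def intro!: L2norm_triangle_diff)
  qed
qed

lemma L2_cont_scale:
  assumes w: "L2_cont w" and k: "continuous_on {0..} k" shows "L2_cont (\<lambda>x t. k t * w x t)"
  unfolding L2_cont_def
proof (intro conjI allI impI)
  fix t :: real assume t: "0 \<le> t"
  show "in_L2 (\<lambda>x. k t * w x t)" using w t by (auto simp: L2_cont_def intro!: in_L2_intros)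
  show "((\<lambda>s. L2norm (\<lambda>x. k s * w x s - k t * w x t)) \<longlongrightarrow> 0) (at t within {0..})"
  proof (rule tendsto_sandwich[OF _ _ tendsto_const])
    have "(k \<longlongrightarrow> k t) (at t within {0..})" using k t by (auto simp: continuous_on_def)
    moreover have "((\<lambda>s. L2norm (\<lambda>x. w x s - w x t)) \<longlongrightarrow> 0) (at t within {0..})" using w t by (auto simp: L2_cont_def)
    ultimately show "((\<lambda>s. \<bar>k s\<bar> * L2norm (\<lambda>x. w x s - w x t) + \<bar>k s - k t\<bar> * L2norm (\<lambda>x. w x t)) \<longlongrightarrow> 0) (at t within {0..})"
      by (auto intro!: tendsto_eq_intros)
    show "\<forall>\<^sub>F s in at t within {0..}. L2norm (\<lambda>x. k s * w x s - k t * w x t) \<le> \<bar>k s\<bar> * L2norm (\<lambda>x. w x s - w x t) + \<bar>k s - k t\<bar> * L2norm (\<lambda>x. w x t)"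
      unfolding eventually_at_filter
    proof (rule always_eventually, intro allI impI)
      fix s :: real assume "s \<in> {0..}"
      then have s: "0 \<le> s" by simp
      have "L2norm (\<lambda>x. k s * w x s - k t * w x t) = L2norm (\<lambda>x. k s * (w x s - w x t) + (k s - k t) * w x t)"
        by (simp add: algebra_simps)
      also have "\<dots> \<le> L2norm (\<lambda>x. k s * (w x s - w x t)) + L2norm (\<lambda>x. (k s - k t) * w x t)"
        using w s t by (intro L2norm_triangle in_L2_intros) (auto simp: L2_cont_def)
      finally show "L2norm (\<lambda>x. k s * w x s - k t * w x t) \<le> \<bar>k s\<bar> * L2norm (\<lambda>x. w x s - w x t) + \<bar>k s - k t\<bar> * L2norm (\<lambda>x. w x t)"
        by (simp add: L2norm_cmult)
    qed
  qed (simp add: always_eventually)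
qed

text \<open>By polarisation, continuity of inner products reduces to that of norms.\<close>

lemma L2_cont_inner:
  assumes w: "L2_cont w" and z: "L2_cont z" shows "continuous_on {0..} (\<lambda>t. int01 (\<lambda>x. w x t * z x t))"
proof -
  have "continuous_on {0..} (\<lambda>t. ((L2norm (\<lambda>x. w x t + z x t))\<^sup>2 - (L2norm (\<lambda>x. w x t))\<^sup>2 - (L2norm (\<lambda>x. z x t))\<^sup>2) / 2)"
    by (intro continuous_intros L2_cont_norm[OF w] L2_cont_norm[OF z] L2_cont_norm[OF L2_cont_add[OF w z]]) auto
  then show ?thesis
  proof (rule continuous_on_eq)
    fix t :: real assume "t \<in> {0..}"
    then show "((L2norm (\<lambda>x. w x t + z x t))\<^sup>2 - (L2norm (\<lambda>x. w x t))\<^sup>2 - (L2norm (\<lambda>x. z x t))\<^sup>2) / 2 = int01 (\<lambda>x. w x t * z x t)"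
      using L2norm_sq_add[of "\<lambda>x. w x t" "\<lambda>x. z x t"] w z by (simp add: L2_cont_def)
  qed
qed

lemma transport_solution_add:
  assumes w: "transport_solution c f1 g1 w1 w" and z: "transport_solution c f2 g2 z1 z"
    and L0: "in_L2 w1" "in_L2 z1"
  shows "transport_solution c (\<lambda>x t. f1 x t + f2 x t) (\<lambda>t. g1 t + g2 t) (\<lambda>x. w1 x + z1 x) (\<lambda>x t. w x t + z x t)"
proof -
  have L: "L2_cont (\<lambda>x t. w x t + z x t)"
    using w z by (intro L2_cont_add transport_solution_L2_cont)
  show ?thesis
    unfolding transport_solution_def
  proof (intro conjI allI impI)
    fix t :: real assume t: "0 \<le> t"
    show "in_L2 (\<lambda>x. w x t + z x t)" "in_L2 (\<lambda>x. f1 x t + f2 x t)"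
      "((\<lambda>s. L2norm (\<lambda>x. w x s + z x s - (w x t + z x t))) \<longlongrightarrow> 0) (at t within {0..})"
      using transport_solutionD(1,2)[OF w t] transport_solutionD(1,2)[OF z t] L t
      by (auto simp: L2_cont_def intro!: in_L2_intros)
  next
    fix \<phi> \<phi>x \<phi>t and T :: real assume test: "transport_test \<phi> \<phi>x \<phi>t" and T: "0 \<le> T"
    have add: "int01 (\<lambda>x. (p x + q x) * r x) = int01 (\<lambda>x. p x * r x) + int01 (\<lambda>x. q x * r x)"
      if "in_L2 p" "in_L2 q" "in_L2 r" for p q r
      unfolding distrib_right using that by (intro int01_add in_L2_mult)
    have 1: "((\<lambda>t. int01 (\<lambda>x. w x t * (\<phi>t x t - c t * \<phi>x x t)) + int01 (\<lambda>x. f1 x t * \<phi> x t) - c t * g1 t * \<phi> 0 t)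
      has_integral (int01 (\<lambda>x. w x T * \<phi> x T) - int01 (\<lambda>x. w1 x * \<phi> x 0))) {0..T}"
      by (rule transport_solutionD(4)[OF w test T])
    have 2: "((\<lambda>t. int01 (\<lambda>x. z x t * (\<phi>t x t - c t * \<phi>x x t)) + int01 (\<lambda>x. f2 x t * \<phi> x t) - c t * g2 t * \<phi> 0 t)
      has_integral (int01 (\<lambda>x. z x T * \<phi> x T) - int01 (\<lambda>x. z1 x * \<phi> x 0))) {0..T}"
      by (rule transport_solutionD(4)[OF z test T])
    have L\<phi>: "in_L2 (\<lambda>x. \<phi> x t)" "in_L2 (\<lambda>x. \<phi>t x t - c t * \<phi>x x t)" if "0 \<le> t" for t
      using transport_test_slice[OF test that] by (auto intro!: in_L2_intros intro: in_L2_continuous)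
    have Lw: "in_L2 (\<lambda>x. w x t)" "in_L2 (\<lambda>x. z x t)" "in_L2 (\<lambda>x. f1 x t)" "in_L2 (\<lambda>x. f2 x t)" if "0 \<le> t" for t
      using transport_solutionD(1,2)[OF w that] transport_solutionD(1,2)[OF z that] by blast+
    have "int01 (\<lambda>x. (w x T + z x T) * \<phi> x T) - int01 (\<lambda>x. (w1 x + z1 x) * \<phi> x 0)
       = int01 (\<lambda>x. w x T * \<phi> x T) - int01 (\<lambda>x. w1 x * \<phi> x 0) + (int01 (\<lambda>x. z x T * \<phi> x T) - int01 (\<lambda>x. z1 x * \<phi> x 0))"
      using T by (simp add: add L0 L\<phi> Lw)
    note ends = this
    show "((\<lambda>t. int01 (\<lambda>x. (w x t + z x t) * (\<phi>t x t - c t * \<phi>x x t)) + int01 (\<lambda>x. (f1 x t + f2 x t) * \<phi> x t)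
          - c t * (g1 t + g2 t) * \<phi> 0 t)
      has_integral (int01 (\<lambda>x. (w x T + z x T) * \<phi> x T) - int01 (\<lambda>x. (w1 x + z1 x) * \<phi> x 0))) {0..T}"
      unfolding ends
    proof (rule has_integral_eq[OF _ has_integral_add[OF 1 2]])
      fix t assume "t \<in> {0..T}"
      then have t: "0 \<le> t" by simp
      show "int01 (\<lambda>x. w x t * (\<phi>t x t - c t * \<phi>x x t)) + int01 (\<lambda>x. f1 x t * \<phi> x t) - c t * g1 t * \<phi> 0 t +
          (int01 (\<lambda>x. z x t * (\<phi>t x t - c t * \<phi>x x t)) + int01 (\<lambda>x. f2 x t * \<phi> x t) - c t * g2 t * \<phi> 0 t) =
          int01 (\<lambda>x. (w x t + z x t) * (\<phi>t x t - c t * \<phi>x x t)) + int01 (\<lambda>x. (f1 x t + f2 x t) * \<phi> x t) - c t * (g1 t + g2 t) * \<phi> 0 t"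
        unfolding add[OF Lw(1,2)[OF t] L\<phi>(2)[OF t]] add[OF Lw(3,4)[OF t] L\<phi>(1)[OF t]]
        by (simp add: distrib_left distrib_right)
    qed
  qed
qed

lemma transport_solution_cmult:
  assumes w: "transport_solution c f g w0 w"
  shows "transport_solution c (\<lambda>x t. k * f x t) (\<lambda>t. k * g t) (\<lambda>x. k * w0 x) (\<lambda>x t. k * w x t)"
proof -
  have L: "L2_cont (\<lambda>x t. k * w x t)"
    using w by (intro L2_cont_scale transport_solution_L2_cont continuous_intros)
  show ?thesis
    unfolding transport_solution_def
  proof (intro conjI allI impI)
    fix t :: real assume t: "0 \<le> t"
    show "in_L2 (\<lambda>x. k * w x t)" "in_L2 (\<lambda>x. k * f x t)"
      "((\<lambda>s. L2norm (\<lambda>x. k * w x s - k * w x t)) \<longlongrightarrow> 0) (at t within {0..})"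
      using transport_solutionD(1,2)[OF w t] L t by (auto simp: L2_cont_def intro!: in_L2_intros)
  next
    fix \<phi> \<phi>x \<phi>t and T :: real assume test: "transport_test \<phi> \<phi>x \<phi>t" and T: "0 \<le> T"
    have "((\<lambda>t. int01 (\<lambda>x. w x t * (\<phi>t x t - c t * \<phi>x x t)) + int01 (\<lambda>x. f x t * \<phi> x t) - c t * g t * \<phi> 0 t)
      has_integral (int01 (\<lambda>x. w x T * \<phi> x T) - int01 (\<lambda>x. w0 x * \<phi> x 0))) {0..T}"
      by (rule transport_solutionD(4)[OF w test T])
    from has_integral_mult_right[OF this, of k]
    show "((\<lambda>t. int01 (\<lambda>x. k * w x t * (\<phi>t x t - c t * \<phi>x x t)) + int01 (\<lambda>x. k * f x t * \<phi> x t) - c t * (k * g t) * \<phi> 0 t)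
      has_integral (int01 (\<lambda>x. k * w x T * \<phi> x T) - int01 (\<lambda>x. k * w0 x * \<phi> x 0))) {0..T}"
      by (simp add: mult.assoc int01_cmult) (simp add: algebra_simps)
  qed
qed

text \<open>For \<open>T \<ge> 1/|m|\<close> the profile, traced back from \<open>T\<close> to the initial time, lies entirely in \<open>x < 0\<close>, so
that it does not see the initial state.\<close>

lemma homogeneous_transport_vanishes:
  assumes sol: "transport_solution c (\<lambda>x t. 0) (\<lambda>t. 0) w0 w"
    and cont: "continuous_on {0..} c" and neg: "\<And>t. 0 \<le> t \<Longrightarrow> c t \<le> m" "m < 0" and T: "1 / (- m) \<le> T"
  shows "L2norm (\<lambda>x. w x T) = 0"
proof -
  have "0 < 1 / (- m)" using neg(2) by simp
  then have T0: "0 \<le> T" using T by linarith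
  have "L2norm (\<lambda>x. w x T) \<le> 0"
  proof (rule L2norm_le_by_duality)
    show "in_L2 (\<lambda>x. w x T)" using sol T0 by (simp add: transport_solution_def)
    fix \<psi> \<psi>' \<psi>'' assume t: "C2_test \<psi> \<psi>' \<psi>''"
    obtain \<beta> where \<beta>: "\<beta> < 1" "\<And>x. x > \<beta> \<Longrightarrow> \<psi> x = 0" using t unfolding C2_test_def by force
    have neg0: "c t \<le> 0" if "0 \<le> t" for t using neg that by force
    have "integral {0..T} c \<le> integral {0..T} (\<lambda>_. m)"
      using neg by (intro integral_le integrable_continuous_real continuous_on_subset[OF cont] continuous_intros) auto
    also have "\<dots> \<le> -1" using T T0 neg(2) by (simp add: field_simps)
    finally have B: "integral {0..T} c \<le> -1" .
    have "((\<lambda>t. 0) has_integral int01 (\<lambda>x. w x T * \<psi> x) - int01 (\<lambda>x. w0 x * \<psi> (x + - integral {0..T} c))) {0..T}"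
      using transport_duhamel[OF sol cont neg0 _ _ \<beta> T0, where \<psi>'=\<psi>'] t
      by (auto simp: C2_test_def C2_test_continuous(2)[OF t] int01_def)
    moreover have "int01 (\<lambda>x. w0 x * \<psi> (x + - integral {0..T} c)) = 0"
      unfolding int01_def
    proof (rule integral_eq_zero_AE, rule AE_I2)
      fix x assume "x \<in> space I01"
      then show "w0 x * \<psi> (x + - integral {0..T} c) = 0" using B \<beta> by simp
    qed
    ultimately show "\<bar>int01 (\<lambda>x. w x T * \<psi> x)\<bar> \<le> 0 * L2norm \<psi>"
      using has_integral_unique[OF has_integral_0] by fastforce
  qed simp
  then show ?thesis using L2norm_nonneg[of "\<lambda>x. w x T"] by linarith
qed

section \<open>The spatial derivative of a solution\<close>

text \<open>Since \<open>\<integral> w_x \<psi> = - \<integral> w \<psi>'\<close>, the Duhamel formula is applied to \<open>\<psi>'\<close>. Along the characteristics \<open>\<psi>'\<close> is a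
time derivative of \<open>h(t) = \<psi>(-b (T - t))\<close>, which is moved to the Lipschitz inflow; the boundary term at
\<open>t = 0\<close> cancels against the one of the initial state, because the latter attains the value
\<open>g(0)\<close> at \<open>x = 0\<close>.\<close>

lemma transport_solution_derivative_bound:
  assumes sol: "transport_solution (\<lambda>t. b) (\<lambda>x t. q t) g w0 w" and b: "b < 0"
    and w: "\<And>t. 0 \<le> t \<Longrightarrow> continuous_on {0..1} (\<lambda>x. w x t)"
    and wx: "\<And>t. 0 \<le> t \<Longrightarrow> in_L2 (\<lambda>x. wx x t) \<and> has_weak_deriv (\<lambda>x. w x t) (\<lambda>x. wx x t)"
    and bdry: "\<And>t. 0 \<le> t \<Longrightarrow> w 0 t = g t"
    and q: "\<And>t. 0 \<le> t \<Longrightarrow> \<bar>q t\<bar> \<le> Q"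
    and g: "\<And>s t. 0 \<le> s \<Longrightarrow> s \<le> t \<Longrightarrow> \<bar>g t - g s\<bar> \<le> M * (t - s)" and T: "0 \<le> T"
  shows "L2norm (\<lambda>x. wx x T) \<le> L2norm (\<lambda>x. wx x 0) + (Q + M) / (- b)"
proof (rule L2norm_le_by_duality)
  show "in_L2 (\<lambda>x. wx x T)" using wx[OF T] by simp
  have Q0: "Q \<ge> 0" using q[of 0] by linarith
  have M0: "M \<ge> 0" using g[of 0 1] by simp
  have "(Q + M) / (- b) \<ge> 0" using Q0 M0 b by (intro divide_nonneg_pos) auto
  then show "0 \<le> L2norm (\<lambda>x. wx x 0) + (Q + M) / (- b)" using L2norm_nonneg[of "\<lambda>x. wx x 0"] by linarith
  fix \<psi> \<psi>' \<psi>'' assume t: "C2_test \<psi> \<psi>' \<psi>''"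
  obtain \<alpha> \<beta> where \<alpha>: "0 < \<alpha>" and \<beta>: "\<beta> < 1" and \<alpha>\<beta>: "\<And>x. x \<notin> {\<alpha>..\<beta>} \<Longrightarrow> \<psi> x = 0"
    using t unfolding C2_test_def by blast
  have z: "\<psi> x = 0" if "x > \<beta>" for x using that \<alpha>\<beta> by auto
  have \<psi>0: "\<psi> 0 = 0" using \<alpha> \<alpha>\<beta> by auto
  have d\<psi>: "(\<psi> has_real_derivative \<psi>' x) (at x)" "(\<psi>' has_real_derivative \<psi>'' x) (at x)" for x
    using t by (auto simp: C2_test_def)
  have c: "continuous_on S \<psi>" "continuous_on S \<psi>'" "continuous_on S \<psi>''" for S using C2_test_continuous[OF t] by auto
  have z': "\<psi>' x = 0" if "x > \<beta>" for x
  proof -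
    have "((\<lambda>_. 0) has_real_derivative 0) (at x)" by simp
    then have "(\<psi> has_real_derivative 0) (at x)"
      by (rule has_field_derivative_transform_within_open[where S="{\<beta><..}"]) (use that z in auto)
    then show ?thesis using d\<psi>(1) DERIV_unique by blast
  qed
  have shift: "((\<lambda>x. \<psi> (x + d)) has_real_derivative \<psi>' (x + d)) (at x within S)"
    "((\<lambda>x. \<psi>' (x + d)) has_real_derivative \<psi>'' (x + d)) (at x within S)" for x d S
    using DERIV_shift[of \<psi> "\<psi>' (x + d)" x d] DERIV_shift[of \<psi>' "\<psi>'' (x + d)" x d] d\<psi>
    by (auto intro: has_field_derivative_at_within)
  have cs: "continuous_on S (\<lambda>x. \<psi> (x + d))" "continuous_on S (\<lambda>x. \<psi>' (x + d))" "continuous_on S (\<lambda>x. \<psi>'' (x + d))" for S d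
    by (auto intro!: continuous_on_compose2[OF c(1)[of UNIV]] continuous_on_compose2[OF c(2)[of UNIV]]
        continuous_on_compose2[OF c(3)[of UNIV]] continuous_intros)
  define d where "d = - b * T"
  have d0: "d \<ge> 0" using T b by (simp add: d_def mult_nonpos_nonneg)
  define h where "h t = \<psi> (- b * (T - t))" for t
  define h' where "h' t = b * \<psi>' (- b * (T - t))" for t
  have dh: "(h has_real_derivative h' t) (at t)" for t
  proof -
    have "((\<lambda>t. - b * (T - t)) has_real_derivative b) (at t)" by (auto intro!: derivative_eq_intros)
    from DERIV_chain2[OF d\<psi>(1) this] show ?thesis unfolding h_def h'_def by (simp add: mult.commute)
  qed
  have ch: "continuous_on S h" "continuous_on S h'" for S
    unfolding h_def h'_def
    by (intro continuous_intros continuous_on_compose2[OF c(1)[of UNIV]] continuous_on_compose2[OF c(2)[of UNIV]]; simp)+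
  have cg: "continuous_on {0..T} g"
  proof (rule lipschitz_on_continuous_on)
    show "M-lipschitz_on {0..T} g"
    proof (rule lipschitz_onI)
      fix x y assume "x \<in> {0..T}" "y \<in> {0..T}"
      then show "dist (g x) (g y) \<le> M * dist x y"
        using g[of x y] g[of y x] by (cases "x \<le> y") (auto simp: dist_real_def abs_minus_commute)
    qed (rule M0)
  qed
  have int\<psi>': "int01 (\<lambda>x. \<psi>' (x + e)) = - \<psi> e" if "e \<ge> 0" for e
  proof -
    have "((\<lambda>x. \<psi>' (x + e)) has_integral \<psi> (1 + e) - \<psi> (0 + e)) {0..1}"
      by (rule fundamental_theorem_of_calculus)
        (auto intro!: shift simp flip: has_real_derivative_iff_has_vector_derivative)
    moreover have "\<psi> (1 + e) = 0" using that \<beta> by (intro z) auto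
    ultimately show ?thesis by (subst int01_continuous[OF cs(2)]) (auto dest: integral_unique)
  qed
  have duh: "((\<lambda>t. - (q t * h t + g t * h' t)) has_integral
      int01 (\<lambda>x. w x T * \<psi>' x) - int01 (\<lambda>x. w0 x * \<psi>' (x + d))) {0..T}"
  proof -
    have "((\<lambda>t. int01 (\<lambda>x. q t * \<psi>' (x + (- integral {0..T} (\<lambda>t. b) - - integral {0..t} (\<lambda>t. b))))
       - b * g t * \<psi>' (- integral {0..T} (\<lambda>t. b) - - integral {0..t} (\<lambda>t. b))) has_integral
      int01 (\<lambda>x. w x T * \<psi>' x) - int01 (\<lambda>x. w0 x * \<psi>' (x + - integral {0..T} (\<lambda>t. b)))) {0..T}"
      using b by (intro transport_duhamel[OF sol _ _ d\<psi>(2) c(3) \<beta> z' T]) auto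
    then have "((\<lambda>t. int01 (\<lambda>x. q t * \<psi>' (x + (- integral {0..T} (\<lambda>t. b) - - integral {0..t} (\<lambda>t. b))))
       - b * g t * \<psi>' (- integral {0..T} (\<lambda>t. b) - - integral {0..t} (\<lambda>t. b))) has_integral
      int01 (\<lambda>x. w x T * \<psi>' x) - int01 (\<lambda>x. w0 x * \<psi>' (x + d))) {0..T}"
      using T by (simp add: d_def mult.commute)
    then show ?thesis
    proof (rule has_integral_eq[rotated])
      fix t assume t: "t \<in> {0..T}"
      have e: "- integral {0..T} (\<lambda>t. b) - - integral {0..t} (\<lambda>t. b) = - b * (T - t)"
        using t by (simp add: algebra_simps)
      have "- b * (T - t) \<ge> 0" using t b by (intro mult_nonneg_nonneg) auto
      then show "int01 (\<lambda>x. q t * \<psi>' (x + (- integral {0..T} (\<lambda>t. b) - - integral {0..t} (\<lambda>t. b))))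
       - b * g t * \<psi>' (- integral {0..T} (\<lambda>t. b) - - integral {0..t} (\<lambda>t. b)) = - (q t * h t + g t * h' t)"
        unfolding e using int\<psi>'[of "- b * (T - t)"] by (simp add: int01_cmult h_def h'_def)
    qed
  qed
  \<comment> \<open>the formula at time 0 replaces \<open>w0\<close> by the continuous representative \<open>w(.,0)\<close>\<close>
  have init: "int01 (\<lambda>x. w0 x * \<psi>' (x + d)) = int01 (\<lambda>x. w x 0 * \<psi>' (x + d))"
  proof -
    have "((\<lambda>t. int01 (\<lambda>x. q t * \<psi>' (x + (- integral {0..0::real} (\<lambda>t. b) - - integral {0..t} (\<lambda>t. b)) + d))
       - b * g t * \<psi>' (- integral {0..0::real} (\<lambda>t. b) - - integral {0..t} (\<lambda>t. b) + d)) has_integral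
      int01 (\<lambda>x. w x 0 * \<psi>' (x + d)) - int01 (\<lambda>x. w0 x * \<psi>' (x + - integral {0..0::real} (\<lambda>t. b) + d))) {0..0::real}"
    proof (rule transport_duhamel[OF sol, where \<psi>="\<lambda>x. \<psi>' (x + d)" and \<psi>'="\<lambda>x. \<psi>'' (x + d)" and \<beta>=\<beta> and T=0])
      show "\<psi>' (x + d) = 0" if "\<beta> < x" for x using that d0 by (intro z') auto
    qed (use b \<beta> in \<open>auto intro: shift cs\<close>)
    from has_integral_unique[OF this[unfolded atLeastAtMost_singleton] has_integral_refl(2)]
    show ?thesis by simp
  qed
  have parts: "int01 (\<lambda>x. w x 0 * \<psi>' (x + d)) = - g 0 * h 0 - int01 (\<lambda>x. wx x 0 * \<psi> (x + d))"
  proof -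
    have "int01 (\<lambda>x. w x 0 * \<psi>' (x + d)) = - w 0 0 * \<psi> (0 + d) - int01 (\<lambda>x. wx x 0 * \<psi> (x + d))"
      using wx[of 0] d0 \<beta> by (intro weak_deriv_by_parts w shift cs) (auto intro!: z)
    then show ?thesis using bdry[of 0] by (simp add: h_def d_def)
  qed
  have "int01 (\<lambda>x. w x T * \<psi>' x) = - int01 (\<lambda>x. wx x T * \<psi> x)"
    using wx[OF T] \<alpha> \<beta> \<alpha>\<beta> d\<psi>(1) c(2)[of UNIV] unfolding has_weak_deriv_def by blast
  then have "int01 (\<lambda>x. wx x T * \<psi> x) = - (int01 (\<lambda>x. w x T * \<psi>' x) - int01 (\<lambda>x. w0 x * \<psi>' (x + d))) + g 0 * h 0 + int01 (\<lambda>x. wx x 0 * \<psi> (x + d))"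
    using init parts by simp
  also have "int01 (\<lambda>x. w x T * \<psi>' x) - int01 (\<lambda>x. w0 x * \<psi>' (x + d)) = integral {0..T} (\<lambda>t. - (q t * h t + g t * h' t))"
    using integral_unique[OF duh] by simp
  finally have main: "int01 (\<lambda>x. wx x T * \<psi> x) = - integral {0..T} (\<lambda>t. - (q t * h t + g t * h' t)) + g 0 * h 0 + int01 (\<lambda>x. wx x 0 * \<psi> (x + d))" .
  have gh: "(\<lambda>t. g t * h' t) integrable_on {0..T}"
    by (intro integrable_continuous_real continuous_intros cg ch)
  have qh: "(\<lambda>t. - (q t * h t + g t * h' t) + g t * h' t) integrable_on {0..T}"
    using has_integral_integrable[OF duh] gh by (rule integrable_add)
  have ah: "(\<lambda>t. \<bar>h t\<bar>) integrable_on {0..T}"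
    by (intro integrable_continuous_real continuous_intros ch)
  have "norm (integral {0..T} (\<lambda>t. - (q t * h t + g t * h' t) + g t * h' t)) \<le> integral {0..T} (\<lambda>t. Q * \<bar>h t\<bar>)"
  proof (rule integral_norm_bound_integral[OF qh])
    show "(\<lambda>t. Q * \<bar>h t\<bar>) integrable_on {0..T}" using ah by (rule integrable_on_mult_right)
    fix t assume "t \<in> {0..T}"
    then show "norm (- (q t * h t + g t * h' t) + g t * h' t) \<le> Q * \<bar>h t\<bar>"
      using q[of t] by (simp add: abs_mult mult_right_mono)
  qed
  moreover have "integral {0..T} (\<lambda>t. - (q t * h t + g t * h' t) + g t * h' t) = integral {0..T} (\<lambda>t. - (q t * h t + g t * h' t)) + integral {0..T} (\<lambda>t. g t * h' t)"
    by (intro Henstock_Kurzweil_Integration.integral_add has_integral_integrable[OF duh] gh)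
  ultimately have e1: "\<bar>integral {0..T} (\<lambda>t. - (q t * h t + g t * h' t)) + integral {0..T} (\<lambda>t. g t * h' t)\<bar> \<le> Q * integral {0..T} (\<lambda>t. \<bar>h t\<bar>)"
    by simp
  have "\<bar>integral {0..T} (\<lambda>t. g t * h' t) - (g T * h T - g 0 * h 0)\<bar> \<le> M * integral {0..T} (\<lambda>t. \<bar>h t\<bar>)"
    by (rule Lipschitz_by_parts[OF T g dh ch(2) cg])
  moreover have "h T = 0" by (simp add: h_def \<psi>0)
  ultimately have e2: "\<bar>integral {0..T} (\<lambda>t. g t * h' t) + g 0 * h 0\<bar> \<le> M * integral {0..T} (\<lambda>t. \<bar>h t\<bar>)" by simp
  have e3: "\<bar>int01 (\<lambda>x. wx x 0 * \<psi> (x + d))\<bar> \<le> L2norm (\<lambda>x. wx x 0) * L2norm \<psi>"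
  proof -
    have "\<bar>int01 (\<lambda>x. wx x 0 * \<psi> (x + d))\<bar> \<le> L2norm (\<lambda>x. wx x 0) * L2norm (\<lambda>x. \<psi> (x + d))"
      using wx[of 0] by (intro int01_Cauchy_Schwarz in_L2_shift c) auto
    also have "\<dots> \<le> L2norm (\<lambda>x. wx x 0) * L2norm \<psi>"
      using d0 \<beta> by (intro mult_left_mono L2norm_shift_le c z) auto
    finally show ?thesis .
  qed
  have e4: "integral {0..T} (\<lambda>t. \<bar>h t\<bar>) \<le> L2norm \<psi> / (- b)"
  proof -
    have "integral {0..T} (\<lambda>t. - b * \<bar>\<psi> (- integral {0..T} (\<lambda>t. b) - - integral {0..t} (\<lambda>t. b))\<bar>) \<le> integral {0..1} (\<lambda>x. \<bar>\<psi> x\<bar>)"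
      using b \<beta> z T by (intro inflow_integral_le(2)) (auto intro!: continuous_intros c)
    also have "integral {0..T} (\<lambda>t. - b * \<bar>\<psi> (- integral {0..T} (\<lambda>t. b) - - integral {0..t} (\<lambda>t. b))\<bar>) = integral {0..T} (\<lambda>t. - b * \<bar>h t\<bar>)"
      using T by (intro integral_cong) (simp add: h_def algebra_simps)
    also have "\<dots> = - b * integral {0..T} (\<lambda>t. \<bar>h t\<bar>)" by simp
    finally have "- b * integral {0..T} (\<lambda>t. \<bar>h t\<bar>) \<le> L2norm \<psi>"
      using integral_abs_le_L2norm[OF c(1)] by linarith
    then show ?thesis using b by (simp add: field_simps)
  qed
  have "\<bar>int01 (\<lambda>x. wx x T * \<psi> x)\<bar> \<le> (Q + M) * integral {0..T} (\<lambda>t. \<bar>h t\<bar>) + L2norm (\<lambda>x. wx x 0) * L2norm \<psi>"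
    using main e1 e2 e3 unfolding distrib_right by linarith
  also have "\<dots> \<le> (Q + M) * (L2norm \<psi> / (- b)) + L2norm (\<lambda>x. wx x 0) * L2norm \<psi>"
    using e4 Q0 M0 by (intro add_mono mult_left_mono) auto
  finally show "\<bar>int01 (\<lambda>x. wx x T * \<psi> x)\<bar> \<le> (L2norm (\<lambda>x. wx x 0) + (Q + M) / (- b)) * L2norm \<psi>"
    by (simp add: algebra_simps)
qed

section \<open>Functions of time\<close>

lemma halfline_DERIV_continuous_on:
  fixes f :: "real \<Rightarrow> real"
  assumes "\<And>t. 0 \<le> t \<Longrightarrow> (f has_real_derivative f' t) (at t within {0..})"
  shows "continuous_on {0..} f"
  unfolding continuous_on_eq_continuous_within using assms DERIV_continuous by (metis atLeast_iff)

text \<open>Once \<open>|r| < m e\<close>, the function \<open>exp (m t) (y\<^sup>2 - e\<^sup>2)\<close> is nonincreasing, so that \<open>y\<^sup>2\<close> exceeds \<open>e\<^sup>2\<close> only by an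
exponentially small amount.\<close>

lemma stable_linear_ode_tendsto_0:
  fixes y k r :: "real \<Rightarrow> real"
  assumes der: "\<And>t. 0 \<le> t \<Longrightarrow> (y has_real_derivative - k t * y t + r t) (at t within {0..})"
    and k: "eventually (\<lambda>t. m \<le> k t) at_top" "0 < m" and r: "(r \<longlongrightarrow> 0) at_top"
  shows "(y \<longlongrightarrow> 0) at_top"
proof -
  have "\<forall>\<^sub>F t in at_top. (y t)\<^sup>2 < 2 * e\<^sup>2" if e: "e > 0" for e
  proof -
    have "\<forall>\<^sub>F t in at_top. \<bar>r t\<bar> < m * e"
      using r k(2) e by (auto simp: tendsto_iff dist_real_def)
    from eventually_conj[OF k(1) this]
    obtain t1 where t1': "\<And>t. t \<ge> t1 \<Longrightarrow> m \<le> k t \<and> \<bar>r t\<bar> < m * e"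
      unfolding eventually_at_top_linorder by blast
    define t0 where "t0 = max 0 t1"
    have t0: "0 \<le> t0" "\<And>t. t \<ge> t0 \<Longrightarrow> m \<le> k t \<and> \<bar>r t\<bar> < m * e"
      using t1' by (auto simp: t0_def)
    define z where "z t = exp (m * t) * ((y t)\<^sup>2 - e\<^sup>2)" for t
    define z' where "z' t = exp (m * t) * (m * ((y t)\<^sup>2 - e\<^sup>2) + 2 * y t * (- k t * y t + r t))" for t
    have dz: "(z has_real_derivative z' t) (at t within {0..})" if "0 \<le> t" for t
      unfolding z_def z'_def using der[OF that]
      by (auto intro!: derivative_eq_intros simp: algebra_simps)
    have z'_le: "z' t \<le> 0" if t: "t0 \<le> t" for t
    proof -
      have "2 * y t * r t \<le> 2 * \<bar>y t\<bar> * \<bar>r t\<bar>" by (metis abs_ge_self abs_mult abs_numeral)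
      also have "\<dots> \<le> 2 * \<bar>y t\<bar> * (m * e)" using t0(2)[OF t] by (intro mult_left_mono) auto
      also have "\<dots> = m * (2 * \<bar>y t\<bar> * e)" by simp
      also have "\<dots> \<le> m * ((y t)\<^sup>2 + e\<^sup>2)"
        using sum_squares_bound[of "\<bar>y t\<bar>" e] k(2) by (intro mult_left_mono) auto
      finally have "2 * y t * r t \<le> m * ((y t)\<^sup>2 + e\<^sup>2)" .
      moreover have "m * (y t)\<^sup>2 \<le> k t * (y t)\<^sup>2" using t0(2)[OF t] by (intro mult_right_mono) auto
      ultimately have "m * ((y t)\<^sup>2 - e\<^sup>2) + 2 * y t * (- k t * y t + r t) \<le> 0"
        by (simp add: algebra_simps power2_eq_square)
      then show ?thesis unfolding z'_def by (simp add: mult_le_0_iff)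
    qed
    have z_le: "z t \<le> z t0" if t: "t0 \<le> t" for t
    proof (rule DERIV_nonpos_imp_decreasing_open[OF t])
      fix x assume x: "t0 < x" "x < t"
      have "at x within {0..} = at x" using x t0(1) by (intro at_within_interior) (simp add: interior_Ici[of "-1"])
      then show "\<exists>y. (z has_real_derivative y) (at x) \<and> y \<le> 0"
        using dz[of x] z'_le[of x] x t0(1) by (intro exI[of _ "z' x"]) auto
    next
      show "continuous_on {t0..t} z"
        using t0(1) by (intro continuous_on_subset[OF halfline_DERIV_continuous_on[OF dz]]) auto
    qed
    have "((\<lambda>t. z t0 * exp (- m * t)) \<longlongrightarrow> 0) at_top"
    proof -
      have "filterlim (\<lambda>t. - m * t) at_bot at_top"
        using k(2) filterlim_tendsto_neg_mult_at_bot[OF tendsto_const, of "- m" "\<lambda>t. t" at_top] filterlim_ident by auto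
      then have "((\<lambda>t. exp (- m * t)) \<longlongrightarrow> 0) at_top" by (rule filterlim_compose[OF exp_at_bot])
      then show ?thesis by (rule tendsto_mult_right_zero)
    qed
    then have "\<forall>\<^sub>F t in at_top. z t0 * exp (- m * t) < e\<^sup>2" using e by (intro order_tendstoD(2)) auto
    then show ?thesis using eventually_ge_at_top[of t0]
    proof eventually_elim
      case (elim t)
      have "(y t)\<^sup>2 - e\<^sup>2 = z t * exp (- m * t)" by (simp add: z_def mult.assoc exp_minus field_simps)
      also have "\<dots> \<le> z t0 * exp (- m * t)" using z_le[OF elim(2)] by (intro mult_right_mono) auto
      finally show ?case using elim by simp
    qed
  qed
  note * = this
  show ?thesis
  proof (rule tendstoI)
    fix e :: real assume e: "e > 0"
    have "\<forall>\<^sub>F t in at_top. (y t)\<^sup>2 < 2 * (e / 2)\<^sup>2" using e by (intro *) simp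
    then show "\<forall>\<^sub>F t in at_top. dist (y t) 0 < e"
    proof eventually_elim
      case (elim t)
      have "2 * (e / 2)\<^sup>2 \<le> e\<^sup>2" by (simp add: power2_eq_square)
      then have "\<bar>y t\<bar>\<^sup>2 < e\<^sup>2" using elim by simp
      then show ?case using power2_less_imp_less[of "\<bar>y t\<bar>" e] e by simp
    qed
  qed
qed

lemma in_Linf_timeI: "(\<And>t. 0 \<le> t \<Longrightarrow> \<bar>f t\<bar> \<le> C) \<Longrightarrow> in_Linf_time f"
  unfolding in_Linf_time_def by (intro boundedI[of _ C]) auto

lemma in_Linf_timeE:
  assumes "in_Linf_time f" obtains C where "0 \<le> C" "\<And>t. 0 \<le> t \<Longrightarrow> \<bar>f t\<bar> \<le> C"
  using assms unfolding in_Linf_time_def bounded_pos by (metis atLeast_iff imageI less_imp_le real_norm_def)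

lemma continuous_eventually_bounded:
  assumes c: "continuous_on {0..} f" and bd: "\<And>t. t0 \<le> t \<Longrightarrow> \<bar>f t\<bar> \<le> C"
  shows "in_Linf_time f"
proof -
  have "bounded (f ` {0..t0})"
    by (intro compact_imp_bounded compact_continuous_image continuous_on_subset[OF c]) auto
  then obtain C' where C': "\<And>t. t \<in> {0..t0} \<Longrightarrow> \<bar>f t\<bar> \<le> C'"
    by (metis bounded_iff imageI real_norm_def)
  show ?thesis
  proof (rule in_Linf_timeI)
    fix t :: real assume "0 \<le> t"
    then show "\<bar>f t\<bar> \<le> max C C'" using bd[of t] C'[of t] by (cases "t0 \<le> t") auto
  qed
qed

lemma convergent_in_Linf_time:
  assumes c: "continuous_on {0..} f" and lim: "(f \<longlongrightarrow> l) at_top"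
  shows "in_Linf_time f"
proof -
  have "\<forall>\<^sub>F t in at_top. dist (f t) l < 1" using lim by (rule tendstoD) simp
  then obtain t0 where t0: "\<And>t. t \<ge> t0 \<Longrightarrow> dist (f t) l < 1" by (auto simp: eventually_at_top_linorder)
  show ?thesis
  proof (rule continuous_eventually_bounded[OF c])
    show "\<bar>f t\<bar> \<le> \<bar>l\<bar> + 1" if "t0 \<le> t" for t using t0[OF that] by (auto simp: dist_real_def)
  qed
qed

lemma halfline_sets_lebesgue: "{0::real..} \<in> sets lebesgue"
  by (metis borel_closed closed_atLeast sets_completionI_sets sets_lborel)

text \<open>The bound is required only on \<open>[t0, \<infinity>[\<close> since the dissipation inequality of the estimator starts to hold
only when the initial error has left the interval.\<close>

lemma nonneg_integrable_halfline:
  fixes f :: "real \<Rightarrow> real"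
  assumes c: "continuous_on {0..} f" and nn: "\<And>t. 0 \<le> t \<Longrightarrow> 0 \<le> f t"
    and bd: "\<And>T. t0 \<le> T \<Longrightarrow> integral {t0..T} f \<le> C" and t0: "0 \<le> t0"
  shows "integrable (lebesgue_on {0..}) f"
proof -
  have int: "f integrable_on {s..t}" if "0 \<le> s" for s t
    using that by (intro integrable_continuous_real continuous_on_subset[OF c]) auto
  define F where "F n t = (if t \<in> {0..real n} then f t else 0)" for n t
  have Fint: "(F n has_integral integral {0..real n} f) {0..}" for n
  proof -
    have "(f has_integral integral {0..real n} f) ({0..real n} \<inter> {0..})"
      using int[of 0 "real n"] by (simp add: Int_absorb2 integrable_integral)
    then show ?thesis unfolding F_def has_integral_restrict_Int .
  qed
  have Fbd: "integral {0..real n} f \<le> integral {0..t0} f + C" for n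
  proof -
    have "integral {0..real n} f \<le> integral {0..max t0 (real n)} f"
      using nn by (intro integral_subset_le int) auto
    also have "\<dots> = integral {0..t0} f + integral {t0..max t0 (real n)} f"
      using int t0 by (simp add: Henstock_Kurzweil_Integration.integral_combine)
    also have "\<dots> \<le> integral {0..t0} f + C" using bd[of "max t0 (real n)"] by simp
    finally show ?thesis .
  qed
  have "f integrable_on {0..} \<and> (\<lambda>n. integral {0..} (F n)) \<longlonglongrightarrow> integral {0..} f"
  proof (rule monotone_convergence_increasing)
    show "F n integrable_on {0..}" for n using Fint by blast
    show "F n t \<le> F (Suc n) t" if "t \<in> {0..}" for n t using nn that by (auto simp: F_def)
    show "(\<lambda>n. F n t) \<longlonglongrightarrow> f t" if "t \<in> {0..}" for t
    proof (rule tendsto_eventually)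
      obtain n0 :: nat where n0: "t < real n0" using reals_Archimedean2 by blast
      show "\<forall>\<^sub>F n in sequentially. F n t = f t"
        using eventually_ge_at_top[of n0] by eventually_elim (use that n0 in \<open>auto simp: F_def\<close>)
    qed
    have "0 \<le> integral {0..real n} f" for n using nn by (intro integral_nonneg int) auto
    then show "bounded (range (\<lambda>n. integral {0..} (F n)))"
      using Fbd integral_unique[OF Fint] by (intro boundedI[of _ "integral {0..t0} f + C"]) auto
  qed
  then have "f absolutely_integrable_on {0..}" using nn by (intro nonnegative_absolutely_integrable_1) auto
  then show ?thesis by (rule absolutely_integrable_imp_integrable) (rule halfline_sets_lebesgue)
qed

lemma continuous_halfline_measurable:
  fixes f :: "real \<Rightarrow> real"
  assumes "continuous_on {0..} f" shows "f \<in> borel_measurable (lebesgue_on {0..})"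
  by (intro continuous_imp_measurable_on_sets_lebesgue assms halfline_sets_lebesgue)

lemma in_L2_time_dominated:
  assumes f: "in_L2_time f" and g: "g \<in> borel_measurable (lebesgue_on {0..})"
    and le: "\<And>t. 0 \<le> t \<Longrightarrow> \<bar>g t\<bar> \<le> K * \<bar>f t\<bar>"
  shows "in_L2_time g"
  unfolding in_L2_time_def
proof
  have "integrable (lebesgue_on {0..}) (\<lambda>t. K\<^sup>2 * (f t)\<^sup>2)" using f by (simp add: in_L2_time_def)
  then show "integrable (lebesgue_on {0..}) (\<lambda>t. (g t)\<^sup>2)"
  proof (rule Bochner_Integration.integrable_bound)
    show "AE t in lebesgue_on {0..}. norm ((g t)\<^sup>2) \<le> norm (K\<^sup>2 * (f t)\<^sup>2)"
    proof (rule AE_I2)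
      fix t assume "t \<in> space (lebesgue_on {0::real..})"
      then have "\<bar>g t\<bar>\<^sup>2 \<le> (K * \<bar>f t\<bar>)\<^sup>2" by (intro power_mono le) auto
      then show "norm ((g t)\<^sup>2) \<le> norm (K\<^sup>2 * (f t)\<^sup>2)" by (simp add: power_mult_distrib)
    qed
  qed (use g in measurable)
qed fact

lemma DERIV_weighted_square:
  fixes f :: "real \<Rightarrow> real"
  assumes "(f has_real_derivative d) (at t within S)"
  shows "((\<lambda>t. (f t)\<^sup>2 / (2 * g)) has_real_derivative f t * d / g) (at t within S)"
  using DERIV_cdivide[OF DERIV_power[OF assms, of 2], of "2 * g"] by (simp add: mult.commute)

lemma right_deriv_of_halfline:
  assumes "(f has_real_derivative d) (at t within {0..})" "0 \<le> t"
  shows "(f has_real_derivative d) (at_right t)"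
  using assms by (auto intro: has_field_derivative_subset)

text \<open>A nonnegative function that loses at least \<open>k h\<^sup>2\<close> per unit of time has only a finite amount to lose.
Right derivatives are used because a projected law need not have others.\<close>

lemma in_L2_time_if_dissipated:
  fixes W h :: "real \<Rightarrow> real"
  assumes c: "continuous_on {0..} h" and t0: "0 \<le> t0"
    and W: "continuous_on {t0..} W" "\<And>t. t0 \<le> t \<Longrightarrow> 0 \<le> W t"
    and der: "\<And>t. t0 \<le> t \<Longrightarrow> (W has_real_derivative W' t) (at_right t)"
    and le: "\<And>t. t0 \<le> t \<Longrightarrow> W' t \<le> - k * (h t)\<^sup>2" and k: "0 < k"
  shows "in_L2_time h" "\<And>t. t0 \<le> t \<Longrightarrow> W t \<le> W t0"
proof -
  have c2: "continuous_on {0..} (\<lambda>t. (h t)\<^sup>2)" by (intro continuous_intros c)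
  have *: "W T + k * integral {t0..T} (\<lambda>t. (h t)\<^sup>2) \<le> W t0" if T: "t0 \<le> T" for T
  proof -
    define E where "E t = W t + k * integral {t0..t} (\<lambda>t. (h t)\<^sup>2)" for t
    have ch: "continuous_on {t0..T} (\<lambda>t. (h t)\<^sup>2)"
      using t0 by (intro continuous_on_subset[OF c2]) auto
    have dI: "((\<lambda>t. integral {t0..t} (\<lambda>t. (h t)\<^sup>2)) has_real_derivative (h x)\<^sup>2) (at x within {t0..T})" if "x \<in> {t0..T}" for x
      by (rule integral_has_real_derivative[OF ch that])
    have "E T \<le> E t0"
    proof (rule nonincreasing_if_right_deriv_nonpos[OF T])
      have "continuous_on {t0..T} (\<lambda>t. integral {t0..t} (\<lambda>t. (h t)\<^sup>2))"
        unfolding continuous_on_eq_continuous_within using dI DERIV_continuous by blast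
      then show "continuous_on {t0..T} E" unfolding E_def
        by (intro continuous_intros continuous_on_subset[OF W(1)]) auto
      fix x assume x: "t0 \<le> x" "x < T"
      have "at_right x = at x within {x<..<T}" using x by (intro at_within_nhd[of _ "{..<T}"]) auto
      moreover have "((\<lambda>t. integral {t0..t} (\<lambda>t. (h t)\<^sup>2)) has_real_derivative (h x)\<^sup>2) (at x within {x<..<T})"
        using x by (intro has_field_derivative_subset[OF dI]) auto
      ultimately have "((\<lambda>t. integral {t0..t} (\<lambda>t. (h t)\<^sup>2)) has_real_derivative (h x)\<^sup>2) (at_right x)"
        by simp
      then show "(E has_real_derivative W' x + k * (h x)\<^sup>2) (at_right x)"
        unfolding E_def by (intro DERIV_add der[OF x(1)] DERIV_cmult)
      show "W' x + k * (h x)\<^sup>2 \<le> 0" using le[OF x(1)] by simp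
    qed
    then show ?thesis by (simp add: E_def)
  qed
  have int: "(\<lambda>t. (h t)\<^sup>2) integrable_on {t0..T}" for T
    using t0 by (intro integrable_continuous_real continuous_on_subset[OF c2]) auto
  show "W t \<le> W t0" if "t0 \<le> t" for t
  proof -
    have "0 \<le> k * integral {t0..t} (\<lambda>t. (h t)\<^sup>2)" using k int by (intro mult_nonneg_nonneg integral_nonneg) auto
    then show ?thesis using *[OF that] by linarith
  qed
  have "integrable (lebesgue_on {0..}) (\<lambda>t. (h t)\<^sup>2)"
  proof (rule nonneg_integrable_halfline[OF c2 _ _ t0])
    show "integral {t0..T} (\<lambda>t. (h t)\<^sup>2) \<le> W t0 / k" if "t0 \<le> T" for T
      using *[OF that] W(2)[OF that] k by (simp add: field_simps)
  qed simp
  then show "in_L2_time h" unfolding in_L2_time_def using continuous_halfline_measurable[OF c] by simp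
qed

section \<open>Boundedness of the identifier and convergence\<close>

theorem theorem1:
  fixes a b bX Ue bbar \<gamma>1 \<gamma>2 \<gamma>3 Abar :: real
    and u ux v p \<eta> ehat :: "real \<Rightarrow> real \<Rightarrow> real"
    and u0 v0 p0 \<eta>0 :: "real \<Rightarrow> real"
    and U dU X V \<Omega> \<Omega>0 epshat bhat bXhat ahat dbhat dbXhat dahat :: "real \<Rightarrow> real"
  assumes a: "a > 0" and b: "b < 0" and bX: "bX > 0"
    and bbar: "bbar < 0" "b < bbar"
    and gains: "\<gamma>1 > 0" "\<gamma>2 > 0" "\<gamma>3 > 0" and Abar: "Abar < 0"
    \<comment> \<open>input: locally absolutely continuous with bounded derivative \<open>dU\<close>\<close>
    and U: "in_Linf_time U" "in_Linf_time dU"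
      "\<And>t. t \<ge> 0 \<Longrightarrow> (dU has_integral (U t - U 0)) {0..t}"
    and init: "in_H1 u0" "in_L2 v0" "in_L2 p0" "in_L2 \<eta>0"
    \<comment> \<open>plant; \<open>u(.,t)\<close> is the continuous representative of an $H_1$ function\<close>
    and u_H1: "\<And>t. t \<ge> 0 \<Longrightarrow> in_H1 (\<lambda>x. u x t)"
      "\<And>t. t \<ge> 0 \<Longrightarrow> continuous_on {0..1} (\<lambda>x. u x t)"
    and ux: "\<And>t. t \<ge> 0 \<Longrightarrow> in_L2 (\<lambda>x. ux x t) \<and> has_weak_deriv (\<lambda>x. u x t) (\<lambda>x. ux x t)"
    and u_bdry: "\<And>t. t \<ge> 0 \<Longrightarrow> u 0 t = 2 * Ue - U t"
    and u_pde: "transport_solution (\<lambda>t. b) (\<lambda>x t. bX * X t) (\<lambda>t. 2 * Ue - U t) u0 u"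
    and X_ode: "\<And>t. t \<ge> 0 \<Longrightarrow> (X has_real_derivative (- a * X t + V t)) (at t within {0..})"
    and V_ode: "\<And>t. t \<ge> 0 \<Longrightarrow> (V has_real_derivative 0) (at t within {0..})"
    \<comment> \<open>filters\<close>
    and v_pde: "transport_solution bhat (\<lambda>x t. ux x t) (\<lambda>t. 0) v0 v"
    and p_pde: "transport_solution bhat (\<lambda>x t. X t) (\<lambda>t. 0) p0 p"
    and \<eta>_pde: "transport_solution bhat (\<lambda>x t. - bhat t * ux x t) (\<lambda>t. - U t + 2 * Ue) \<eta>0 \<eta>"
    and \<Omega>0_ode: "\<And>t. t \<ge> 0 \<Longrightarrow>
      (\<Omega>0 has_real_derivative (Abar * (\<Omega>0 t - X t) + V t)) (at t within {0..})"
    and \<Omega>_ode: "\<And>t. t \<ge> 0 \<Longrightarrow> (\<Omega> has_real_derivative (Abar * \<Omega> t - X t)) (at t within {0..})"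
    \<comment> \<open>prediction errors\<close>
    and ehat: "ehat = (\<lambda>x t. u x t - bhat t * v x t - bXhat t * p x t - \<eta> x t)"
    and epshat: "epshat = (\<lambda>t. X t - \<Omega>0 t - \<Omega> t * ahat t)"
    \<comment> \<open>projected update law on the half-line up to \<open>bbar\<close>; the right-hand side jumps
        at \<open>bbar\<close>, so the dot is the right derivative\<close>
    and bhat_range: "\<And>t. t \<ge> 0 \<Longrightarrow> bhat t \<le> bbar"
    and bhat_cont: "continuous_on {0..} bhat"
    and bhat_ode: "\<And>t. t \<ge> 0 \<Longrightarrow> (bhat has_real_derivative dbhat t) (at_right t)"
      "\<And>t. t \<ge> 0 \<Longrightarrow> dbhat t = - \<gamma>1 * bhat t *
         Proj bbar (bhat t)
           (int01 (\<lambda>x. ehat x t * v x t) /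
            (1 + int01 (\<lambda>x. (v x t)\<^sup>2) + int01 (\<lambda>x. (p x t)\<^sup>2)))"
    and bXhat_ode: "\<And>t. t \<ge> 0 \<Longrightarrow> (bXhat has_real_derivative dbXhat t) (at t within {0..})"
      "\<And>t. t \<ge> 0 \<Longrightarrow> dbXhat t = - \<gamma>2 * bhat t *
         (int01 (\<lambda>x. ehat x t * p x t) /
          (1 + int01 (\<lambda>x. (v x t)\<^sup>2) + int01 (\<lambda>x. (p x t)\<^sup>2)))"
    and ahat_ode: "\<And>t. t \<ge> 0 \<Longrightarrow> (ahat has_real_derivative dahat t) (at t within {0..})"
      "\<And>t. t \<ge> 0 \<Longrightarrow> dahat t = \<gamma>3 * (epshat t * \<Omega> t / (1 + (\<Omega> t)\<^sup>2))"
  shows "(in_Linf_time (\<lambda>t. L2norm (\<lambda>x. ux x t)) \<and>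
          in_Linf_time (\<lambda>t. L2norm (\<lambda>x. u x t)) \<and>
          in_Linf_time V \<and> in_Linf_time X \<and>
          in_Linf_time (\<lambda>t. L2norm (\<lambda>x. v x t)) \<and>
          in_Linf_time (\<lambda>t. L2norm (\<lambda>x. p x t)) \<and>
          in_Linf_time (\<lambda>t. L2norm (\<lambda>x. \<eta> x t)) \<and>
          in_Linf_time \<Omega> \<and> in_Linf_time \<Omega>0 \<and>
          in_Linf_time (\<lambda>t. b - bhat t) \<and>
          in_Linf_time (\<lambda>t. bX - bXhat t) \<and>
          in_Linf_time (\<lambda>t. a - ahat t)) \<and>
         (\<forall>f \<in> {dbhat, dbXhat, dahat,
                \<lambda>t. L2norm (\<lambda>x. ehat x t) /
                    sqrt (1 + (L2norm (\<lambda>x. v x t))\<^sup>2 + (L2norm (\<lambda>x. p x t))\<^sup>2),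
                \<lambda>t. \<bar>epshat t\<bar> / sqrt (1 + (\<Omega> t)\<^sup>2)}.
            in_L2_time f \<and> in_Linf_time f) \<and>
         (\<forall>c. c \<noteq> 0 \<longrightarrow> (V \<longlongrightarrow> c) at_top \<longrightarrow> (ahat \<longlongrightarrow> a) at_top)"
proof -
  have a0: "a \<noteq> 0" and Abar0: "Abar \<noteq> 0" using a Abar by auto
  note contI = halfline_DERIV_continuous_on

  have cX: "continuous_on {0..} X" and cV: "continuous_on {0..} V" and c\<Omega>: "continuous_on {0..} \<Omega>"
    and c\<Omega>0: "continuous_on {0..} \<Omega>0" and cah: "continuous_on {0..} ahat" and cbX: "continuous_on {0..} bXhat"
    using contI[OF X_ode] contI[OF V_ode] contI[OF \<Omega>_ode] contI[OF \<Omega>0_ode] contI[OF ahat_ode(1)] contI[OF bXhat_ode(1)]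
    by auto
  have V: "V t = V 0" if t: "0 \<le> t" for t
    using has_field_derivative_zero_constant[of "{0..}" V] V_ode t by auto
  have limV: "(V \<longlongrightarrow> V 0) at_top"
    by (rule tendsto_eventually[OF eventually_mono[OF eventually_ge_at_top[of 0] V]])
  have "((\<lambda>t. X t - V 0 / a) \<longlongrightarrow> 0) at_top"
  proof (rule stable_linear_ode_tendsto_0[where k="\<lambda>_. a" and r="\<lambda>_. 0" and m=a])
    fix t :: real assume t: "0 \<le> t"
    show "((\<lambda>t. X t - V 0 / a) has_real_derivative - a * (X t - V 0 / a) + 0) (at t within {0..})"
      using DERIV_diff[OF X_ode[OF t] DERIV_const[of "V 0 / a"]] V[OF t] a0 by (simp add: algebra_simps)
  qed (use a in auto)
  then have limX: "(X \<longlongrightarrow> V 0 / a) at_top" by (rule LIM_zero_cancel)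
  \<comment> \<open>the equilibrium of \<open>\<Omega>\<close> for the limit of \<open>X\<close>\<close>
  define \<Omega>' where "\<Omega>' = V 0 / a / Abar"
  have "((\<lambda>t. \<Omega> t - \<Omega>') \<longlongrightarrow> 0) at_top"
  proof (rule stable_linear_ode_tendsto_0[where k="\<lambda>_. - Abar" and r="\<lambda>t. V 0 / a - X t" and m="- Abar"])
    fix t :: real assume t: "0 \<le> t"
    show "((\<lambda>t. \<Omega> t - \<Omega>') has_real_derivative - (- Abar) * (\<Omega> t - \<Omega>') + (V 0 / a - X t)) (at t within {0..})"
      using DERIV_diff[OF \<Omega>_ode[OF t] DERIV_const[of \<Omega>']] Abar0 by (simp add: algebra_simps \<Omega>'_def)
  next
    have "((\<lambda>t. V 0 / a - X t) \<longlongrightarrow> V 0 / a - V 0 / a) at_top" by (intro tendsto_intros limX)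
    then show "((\<lambda>t. V 0 / a - X t) \<longlongrightarrow> 0) at_top" by simp
  qed (use Abar in auto)
  then have lim\<Omega>: "(\<Omega> \<longlongrightarrow> \<Omega>') at_top" by (rule LIM_zero_cancel)
  \<comment> \<open>the prediction error at the true parameter: the inputs \<open>X\<close> and \<open>V\<close> of the filters cancel in it\<close>
  define \<epsilon> where "\<epsilon> t = X t - \<Omega>0 t - a * \<Omega> t" for t
  have \<epsilon>_ode: "(\<epsilon> has_real_derivative Abar * \<epsilon> t) (at t within {0..})" if t: "0 \<le> t" for t
    using DERIV_diff[OF DERIV_diff[OF X_ode[OF t] \<Omega>0_ode[OF t]] DERIV_cmult[OF \<Omega>_ode[OF t], of a]]
    unfolding \<epsilon>_def by (simp add: algebra_simps)
  have lim\<epsilon>: "(\<epsilon> \<longlongrightarrow> 0) at_top"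
    by (rule stable_linear_ode_tendsto_0[where k="\<lambda>_. - Abar" and r="\<lambda>t. 0" and m="- Abar"])
      (use Abar \<epsilon>_ode in auto)
  have lim\<Omega>0: "(\<Omega>0 \<longlongrightarrow> V 0 / a - 0 - a * \<Omega>') at_top"
  proof -
    have "((\<lambda>t. X t - \<epsilon> t - a * \<Omega> t) \<longlongrightarrow> V 0 / a - 0 - a * \<Omega>') at_top"
      by (intro tendsto_intros limX lim\<epsilon> lim\<Omega>)
    then show ?thesis by (simp add: \<epsilon>_def)
  qed
  have BV: "in_Linf_time V" and BX: "in_Linf_time X" and B\<Omega>: "in_Linf_time \<Omega>" and B\<Omega>0: "in_Linf_time \<Omega>0"
    using convergent_in_Linf_time[OF cV limV] convergent_in_Linf_time[OF cX limX]
      convergent_in_Linf_time[OF c\<Omega> lim\<Omega>] convergent_in_Linf_time[OF c\<Omega>0 lim\<Omega>0] by auto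

  have eh: "epshat t = \<epsilon> t + (a - ahat t) * \<Omega> t" for t
    by (simp add: epshat \<epsilon>_def algebra_simps)
  have ceh: "continuous_on {0..} epshat" unfolding epshat by (intro continuous_intros cX c\<Omega> c\<Omega>0 cah)
  define n\<epsilon> where "n\<epsilon> t = \<bar>epshat t\<bar> / sqrt (1 + (\<Omega> t)\<^sup>2)" for t
  have pos: "1 + (\<Omega> t)\<^sup>2 > 0" for t by (simp add: add_pos_nonneg)
  have cn\<epsilon>: "continuous_on {0..} n\<epsilon>" unfolding n\<epsilon>_def
    using pos by (intro continuous_intros ceh c\<Omega>) (auto simp: less_imp_neq[symmetric])
  have n\<epsilon>2: "(n\<epsilon> t)\<^sup>2 = (epshat t)\<^sup>2 / (1 + (\<Omega> t)\<^sup>2)" for t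
    using pos[of t] by (simp add: n\<epsilon>_def power_divide)
  \<comment> \<open>the weight of \<open>\<epsilon>\<^sup>2\<close> is such that its decay pays for the cross term between \<open>\<epsilon>\<close> and \<open>epshat\<close>\<close>
  define Z where "Z t = (a - ahat t)\<^sup>2 / 2 + \<gamma>3 / (4 * (- Abar)) * (\<epsilon> t)\<^sup>2" for t
  define Z' where "Z' t = - (a - ahat t) * dahat t - \<gamma>3 / 2 * (\<epsilon> t)\<^sup>2" for t
  have dZ: "(Z has_real_derivative Z' t) (at t within {0..})" if t: "0 \<le> t" for t
  proof -
    have "(Z has_real_derivative (2 * (a - ahat t) * (0 - dahat t)) / 2 + \<gamma>3 / (4 * (- Abar)) * (2 * \<epsilon> t * (Abar * \<epsilon> t))) (at t within {0..})"
      unfolding Z_def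
      by (auto intro!: derivative_eq_intros ahat_ode(1)[OF t] \<epsilon>_ode[OF t])
    also have "(2 * (a - ahat t) * (0 - dahat t)) / 2 + \<gamma>3 / (4 * (- Abar)) * (2 * \<epsilon> t * (Abar * \<epsilon> t)) = Z' t"
      using Abar0 by (simp add: Z'_def field_simps power2_eq_square)
    finally show ?thesis .
  qed
  have Z'_le: "Z' t \<le> - (\<gamma>3 / 2) * (n\<epsilon> t)\<^sup>2" if t: "0 \<le> t" for t
  proof -
    define D where "D = 1 + (\<Omega> t)\<^sup>2"
    have D: "D \<ge> 1" by (simp add: D_def)
    have "- (a - ahat t) * dahat t = - \<gamma>3 * ((epshat t - \<epsilon> t) * epshat t / D)"
    proof -
      have "- y * (g * (E * w / d)) = - g * ((y * w) * E / d)" for y g E w d :: real by (simp add: mult_ac)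
      moreover have "epshat t - \<epsilon> t = (a - ahat t) * \<Omega> t" by (simp add: eh)
      ultimately show ?thesis unfolding ahat_ode(2)[OF t] D_def[symmetric] by metis
    qed
    also have "\<dots> \<le> - \<gamma>3 * (((epshat t)\<^sup>2 / 2 - (\<epsilon> t)\<^sup>2 / 2) / D)"
    proof -
      have "0 \<le> (epshat t - \<epsilon> t)\<^sup>2" by simp
      then have "(epshat t)\<^sup>2 / 2 - (\<epsilon> t)\<^sup>2 / 2 \<le> (epshat t - \<epsilon> t) * epshat t"
        by (simp add: power2_eq_square algebra_simps)
      then have "((epshat t)\<^sup>2 / 2 - (\<epsilon> t)\<^sup>2 / 2) / D \<le> (epshat t - \<epsilon> t) * epshat t / D"
        using D by (intro divide_right_mono) auto
      then have "\<gamma>3 * (((epshat t)\<^sup>2 / 2 - (\<epsilon> t)\<^sup>2 / 2) / D) \<le> \<gamma>3 * ((epshat t - \<epsilon> t) * epshat t / D)"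
        using gains(3) by (rule mult_left_mono[OF _ less_imp_le])
      then show ?thesis by (simp only: mult_minus_left neg_le_iff_le)
    qed
    also have "\<dots> = - (\<gamma>3 / 2) * ((epshat t)\<^sup>2 / D) + \<gamma>3 / 2 * ((\<epsilon> t)\<^sup>2 / D)" by (simp add: diff_divide_distrib algebra_simps)
    also have "\<gamma>3 / 2 * ((\<epsilon> t)\<^sup>2 / D) \<le> \<gamma>3 / 2 * (\<epsilon> t)\<^sup>2"
    proof (rule mult_left_mono)
      have "(\<epsilon> t)\<^sup>2 / D \<le> (\<epsilon> t)\<^sup>2 / 1" using D by (intro divide_left_mono) auto
      then show "(\<epsilon> t)\<^sup>2 / D \<le> (\<epsilon> t)\<^sup>2" by simp
    qed (use gains in auto)
    finally show ?thesis unfolding Z'_def n\<epsilon>2 D_def by simp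
  qed
  have \<epsilon>_term: "0 \<le> \<gamma>3 / (4 * (- Abar)) * (\<epsilon> t)\<^sup>2" for t
    using Abar gains(3) by (intro mult_nonneg_nonneg divide_nonneg_nonneg) auto
  then have Z0: "0 \<le> Z t" for t unfolding Z_def by (intro add_nonneg_nonneg) auto
  have L2n\<epsilon>: "in_L2_time n\<epsilon>" and Zle: "\<And>t. 0 \<le> t \<Longrightarrow> Z t \<le> Z 0"
    using in_L2_time_if_dissipated[OF cn\<epsilon> order_refl contI[OF dZ] Z0 right_deriv_of_halfline[OF dZ] Z'_le] gains(3)
    by auto
  have Bat: "in_Linf_time (\<lambda>t. a - ahat t)"
  proof (rule in_Linf_timeI)
    fix t :: real assume t: "0 \<le> t"
    have "(a - ahat t)\<^sup>2 \<le> 2 * Z 0" using Zle[OF t] \<epsilon>_term[of t] unfolding Z_def[of t] by linarith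
    then have "sqrt ((a - ahat t)\<^sup>2) \<le> sqrt (2 * Z 0)" by (rule real_sqrt_le_mono)
    then show "\<bar>a - ahat t\<bar> \<le> sqrt (2 * Z 0)" by simp
  qed
  have Bn\<epsilon>: "in_Linf_time n\<epsilon>"
  proof -
    obtain C1 where C1: "0 \<le> C1" "\<And>t. 0 \<le> t \<Longrightarrow> \<bar>\<epsilon> t\<bar> \<le> C1"
      using in_Linf_timeE[OF convergent_in_Linf_time[OF contI[OF \<epsilon>_ode] lim\<epsilon>]] by blast
    obtain C2 where C2: "0 \<le> C2" "\<And>t. 0 \<le> t \<Longrightarrow> \<bar>a - ahat t\<bar> \<le> C2" using in_Linf_timeE[OF Bat] by blast
    obtain C3 where C3: "0 \<le> C3" "\<And>t. 0 \<le> t \<Longrightarrow> \<bar>\<Omega> t\<bar> \<le> C3" using in_Linf_timeE[OF B\<Omega>] by blast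
    show ?thesis
    proof (rule in_Linf_timeI)
      fix t :: real assume t: "0 \<le> t"
      have "\<bar>n\<epsilon> t\<bar> \<le> \<bar>epshat t\<bar> / 1"
      proof -
        have "n\<epsilon> t \<le> \<bar>epshat t\<bar> / 1" unfolding n\<epsilon>_def using pos[of t] by (intro divide_left_mono) auto
        then show ?thesis by (simp add: n\<epsilon>_def)
      qed
      also have "\<dots> \<le> \<bar>\<epsilon> t\<bar> + \<bar>a - ahat t\<bar> * \<bar>\<Omega> t\<bar>"
        unfolding eh using abs_triangle_ineq[of "\<epsilon> t" "(a - ahat t) * \<Omega> t"] by (simp add: abs_mult)
      also have "\<dots> \<le> C1 + C2 * C3" using C1 C2 C3 t by (intro add_mono mult_mono) auto
      finally show "\<bar>n\<epsilon> t\<bar> \<le> C1 + C2 * C3" .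
    qed
  qed
  have dah_le: "\<bar>dahat t\<bar> \<le> \<gamma>3 * \<bar>n\<epsilon> t\<bar>" if t: "0 \<le> t" for t
  proof -
    define r where "r = sqrt (1 + (\<Omega> t)\<^sup>2)"
    have r: "r > 0" "r\<^sup>2 = 1 + (\<Omega> t)\<^sup>2" using pos[of t] by (auto simp: r_def)
    have "\<bar>\<Omega> t\<bar> \<le> r" unfolding r_def by (rule real_le_rsqrt) simp
    then have "\<bar>epshat t\<bar> / r * (\<bar>\<Omega> t\<bar> / r) \<le> \<bar>epshat t\<bar> / r * 1" using r by (intro mult_left_mono) auto
    moreover have "\<bar>dahat t\<bar> = \<gamma>3 * (\<bar>epshat t\<bar> / r * (\<bar>\<Omega> t\<bar> / r))"
      using ahat_ode(2)[OF t] gains(3) r by (simp add: abs_mult power2_eq_square flip: r(2))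
    ultimately have "\<bar>dahat t\<bar> \<le> \<gamma>3 * (\<bar>epshat t\<bar> / r * 1)"
      using mult_left_mono[OF _ less_imp_le[OF gains(3)]] by metis
    then show ?thesis using r(1) by (simp add: n\<epsilon>_def flip: r_def)
  qed
  have mdah: "dahat \<in> borel_measurable (lebesgue_on {0..})"
  proof (rule continuous_halfline_measurable, rule continuous_on_eq)
    show "continuous_on {0..} (\<lambda>t. \<gamma>3 * (epshat t * \<Omega> t / (1 + (\<Omega> t)\<^sup>2)))"
      using pos by (intro continuous_intros ceh c\<Omega>) (auto simp: less_imp_neq[symmetric])
  qed (simp add: ahat_ode(2))
  have L2dah: "in_L2_time dahat" by (rule in_L2_time_dominated[OF L2n\<epsilon> mdah dah_le])
  have Bdah: "in_Linf_time dahat"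
  proof -
    obtain C where C: "\<And>t. 0 \<le> t \<Longrightarrow> \<bar>n\<epsilon> t\<bar> \<le> C" using in_Linf_timeE[OF Bn\<epsilon>] by blast
    show ?thesis
      using dah_le C gains(3) by (intro in_Linf_timeI[of _ "\<gamma>3 * C"]) (meson less_imp_le mult_left_mono order_trans)
  qed
  have conv: "(ahat \<longlongrightarrow> a) at_top" if c: "c \<noteq> 0" "(V \<longlongrightarrow> c) at_top" for c
  proof -
    have "V 0 = c" using tendsto_unique[OF _ limV c(2)] by simp
    then have \<Omega>'0: "\<Omega>' \<noteq> 0" using c a0 Abar0 by (simp add: \<Omega>'_def)
    define k where "k t = \<gamma>3 * (\<Omega> t)\<^sup>2 / (1 + (\<Omega> t)\<^sup>2)" for t
    define r where "r t = - \<gamma>3 * (\<epsilon> t * \<Omega> t / (1 + (\<Omega> t)\<^sup>2))" for t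
    have pos': "1 + \<Omega>'\<^sup>2 \<noteq> 0" by (metis add_pos_nonneg less_irrefl zero_le_power2 zero_less_one)
    have k: "(k \<longlongrightarrow> \<gamma>3 * \<Omega>'\<^sup>2 / (1 + \<Omega>'\<^sup>2)) at_top"
      unfolding k_def by (intro tendsto_intros lim\<Omega> pos')
    have r: "(r \<longlongrightarrow> - \<gamma>3 * (0 * \<Omega>' / (1 + \<Omega>'\<^sup>2))) at_top"
      unfolding r_def by (intro tendsto_intros lim\<Omega> lim\<epsilon> pos')
    define k0 where "k0 = \<gamma>3 * \<Omega>'\<^sup>2 / (1 + \<Omega>'\<^sup>2) / 2"
    have "0 < \<gamma>3 * \<Omega>'\<^sup>2 / (1 + \<Omega>'\<^sup>2)"
      using \<Omega>'0 gains(3) by (intro divide_pos_pos mult_pos_pos) (auto simp: add_pos_nonneg)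
    moreover have "0 < L / 2 \<and> L / 2 < L" if "0 < L" for L :: real using that by simp
    ultimately have k0: "0 < k0" "k0 < \<gamma>3 * \<Omega>'\<^sup>2 / (1 + \<Omega>'\<^sup>2)"
      unfolding k0_def by blast+
    have "((\<lambda>t. a - ahat t) \<longlongrightarrow> 0) at_top"
    proof (rule stable_linear_ode_tendsto_0[where k=k and r=r and m=k0])
      show "(r \<longlongrightarrow> 0) at_top" using r by simp
      show "\<forall>\<^sub>F t in at_top. k0 \<le> k t" using order_tendstoD(1)[OF k k0(2)] by eventually_elim simp
      fix t :: real assume t: "0 \<le> t"
      have "- k t * (a - ahat t) + r t = 0 - dahat t"
        unfolding ahat_ode(2)[OF t] k_def r_def eh using pos[of t]
        by (simp add: divide_simps power2_eq_square) (simp add: algebra_simps)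
      then show "((\<lambda>t. a - ahat t) has_real_derivative - k t * (a - ahat t) + r t) (at t within {0..})"
        using DERIV_diff[OF DERIV_const ahat_ode(1)[OF t]] by simp
    qed (rule k0)
    then show ?thesis using tendsto_diff[OF tendsto_const[of a]] by fastforce
  qed

  obtain CU where CU: "\<And>t. 0 \<le> t \<Longrightarrow> \<bar>U t\<bar> \<le> CU" using in_Linf_timeE[OF U(1)] by blast
  obtain M where M: "0 \<le> M" "\<And>t. 0 \<le> t \<Longrightarrow> \<bar>dU t\<bar> \<le> M" using in_Linf_timeE[OF U(2)] by blast
  have Ulip: "\<bar>U t - U s\<bar> \<le> M * (t - s)" if st: "0 \<le> s" "s \<le> t" for s t
  proof -
    have i: "dU integrable_on {0..t}" using U(3)[of t] st by auto
    have "integral {0..s} dU + integral {s..t} dU = integral {0..t} dU"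
      using st i by (intro Henstock_Kurzweil_Integration.integral_combine) auto
    then have "integral {s..t} dU = U t - U s"
      using integral_unique[OF U(3)[of s]] integral_unique[OF U(3)[of t]] st by simp
    moreover have "dU integrable_on {s..t}" by (rule integrable_on_subinterval[OF i]) (use st in auto)
    ultimately have "(dU has_integral (U t - U s)) {s..t}" by (metis integrable_integral)
    from has_integral_bound_real[OF M(1) finite.emptyI this] show ?thesis using M(2) st by auto
  qed
  obtain CX where CX: "0 \<le> CX" "\<And>t. 0 \<le> t \<Longrightarrow> \<bar>X t\<bar> \<le> CX" using in_Linf_timeE[OF BX] by blast
  have CbX: "\<bar>bX * X t\<bar> \<le> bX * CX" if "0 \<le> t" for t
    using CX(2)[OF that] bX by (simp add: abs_mult)
  define G where "G = 2 * \<bar>Ue\<bar> + CU"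
  have G: "\<bar>2 * Ue - U t\<bar> \<le> G" "\<bar>- U t + 2 * Ue\<bar> \<le> G" if "0 \<le> t" for t
    using CU[OF that] by (auto simp: G_def)
  define Cux where "Cux = L2norm (\<lambda>x. ux x 0) + (bX * CX + M) / (- b)"
  have Cux: "L2norm (\<lambda>x. ux x t) \<le> Cux" if "0 \<le> t" for t
    unfolding Cux_def
  proof (rule transport_solution_derivative_bound[OF u_pde b u_H1(2) ux u_bdry CbX _ that])
    fix s t :: real assume "0 \<le> s" "s \<le> t"
    then show "\<bar>2 * Ue - U t - (2 * Ue - U s)\<bar> \<le> M * (t - s)" using Ulip[of s t] by (simp add: abs_minus_commute)
  qed
  have Cux0: "0 \<le> Cux" using Cux[of 0] L2norm_nonneg[of "\<lambda>x. ux x 0"] by linarith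
  have Bux: "in_Linf_time (\<lambda>t. L2norm (\<lambda>x. ux x t))" using Cux by (intro in_Linf_timeI[of _ Cux]) simp
  have Lu0: "in_L2 u0" using init(1) by (simp add: in_H1_def)
  have Bu: "in_Linf_time (\<lambda>t. L2norm (\<lambda>x. u x t))"
  proof (rule in_Linf_timeI)
    fix t :: real assume t: "0 \<le> t"
    have "L2norm (\<lambda>x. u x t) \<le> L2norm u0 + bX * CX / (- b) + G"
      by (rule transport_solution_bound[OF u_pde Lu0 _ _ b _ G(1) t]) (use CbX in \<open>auto simp: L2norm_const\<close>)
    then show "\<bar>L2norm (\<lambda>x. u x t)\<bar> \<le> L2norm u0 + bX * CX / (- b) + G" by simp
  qed
  have Bv: "in_Linf_time (\<lambda>t. L2norm (\<lambda>x. v x t))"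
  proof (rule in_Linf_timeI)
    fix t :: real assume t: "0 \<le> t"
    have "L2norm (\<lambda>x. v x t) \<le> L2norm v0 + Cux / (- bbar) + 0"
      by (rule transport_solution_bound[OF v_pde init(2) bhat_cont bhat_range bbar(1) Cux _ t]) auto
    then show "\<bar>L2norm (\<lambda>x. v x t)\<bar> \<le> L2norm v0 + Cux / (- bbar) + 0" by simp
  qed
  have Bp: "in_Linf_time (\<lambda>t. L2norm (\<lambda>x. p x t))"
  proof (rule in_Linf_timeI)
    fix t :: real assume t: "0 \<le> t"
    have "L2norm (\<lambda>x. p x t) \<le> L2norm p0 + CX / (- bbar) + 0"
      by (rule transport_solution_bound[OF p_pde init(3) bhat_cont bhat_range bbar(1) _ _ t])
        (use CX in \<open>auto simp: L2norm_const\<close>)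
    then show "\<bar>L2norm (\<lambda>x. p x t)\<bar> \<le> L2norm p0 + CX / (- bbar) + 0" by simp
  qed

  \<comment> \<open>the prediction error at the true parameters has no source and no inflow\<close>
  define e where "e x t = u x t - b * v x t - bX * p x t - \<eta> x t" for x t
  define e0 where "e0 x = u0 x + - b * v0 x + - bX * p0 x + - 1 * \<eta>0 x" for x
  have e_pde: "transport_solution bhat (\<lambda>x t. 0) (\<lambda>t. 0) e0 e"
  proof -
    note u' = transport_change_speed[OF u_pde u_H1(2) ux u_bdry, of bhat]
    note v' = transport_solution_cmult[OF v_pde, of "- b"]
    note p' = transport_solution_cmult[OF p_pde, of "- bX"]
    note \<eta>' = transport_solution_cmult[OF \<eta>_pde, of "- 1"]
    note L = in_L2_cmult[OF init(2), of "- b"] in_L2_cmult[OF init(3), of "- bX"] in_L2_cmult[OF init(4), of "- 1"]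
    note L12 = in_L2_add[OF Lu0 L(1)]
    note L123 = in_L2_add[OF L12 L(2)]
    have f: "(\<lambda>x t. bX * X t + (b - bhat t) * ux x t + - b * ux x t + - bX * X t + - 1 * (- bhat t * ux x t)) = (\<lambda>x t. 0)"
      by (intro ext) (simp add: algebra_simps)
    have g: "(\<lambda>t. 2 * Ue - U t + - b * 0 + - bX * 0 + - 1 * (- U t + 2 * Ue)) = (\<lambda>t. 0)" by (intro ext) simp
    have e: "(\<lambda>x t. u x t + - b * v x t + - bX * p x t + - 1 * \<eta> x t) = e" "(\<lambda>x. u0 x + - b * v0 x + - bX * p0 x + - 1 * \<eta>0 x) = e0"
      by (intro ext, simp add: e_def e0_def)+
    show ?thesis
      using transport_solution_add[OF transport_solution_add[OF transport_solution_add[OF u' v' Lu0 L(1)] p' L12 L(2)] \<eta>' L123 L(3)]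
      unfolding f g e .
  qed
  define t0 where "t0 = 1 / (- bbar)"
  have t0: "0 \<le> t0" using bbar(1) by (simp add: t0_def)
  have e_0: "L2norm (\<lambda>x. e x t) = 0" if "t0 \<le> t" for t
    by (rule homogeneous_transport_vanishes[OF e_pde bhat_cont bhat_range bbar(1) that[unfolded t0_def]])

  have Lc: "L2_cont u" "L2_cont v" "L2_cont p" "L2_cont \<eta>" "L2_cont e"
    using u_pde v_pde p_pde \<eta>_pde e_pde by (auto intro: transport_solution_L2_cont)
  have Lceh: "L2_cont ehat"
  proof -
    have "L2_cont (\<lambda>x t. u x t + (- bhat t) * v x t + (- bXhat t) * p x t + (- 1) * \<eta> x t)"
      by (intro L2_cont_add L2_cont_scale Lc continuous_intros bhat_cont cbX)
    moreover have "(\<lambda>x t. u x t + (- bhat t) * v x t + (- bXhat t) * p x t + (- 1) * \<eta> x t) = ehat"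
      unfolding ehat by (intro ext) simp
    ultimately show ?thesis by simp
  qed
  have Lt: "in_L2 (\<lambda>x. u x t)" "in_L2 (\<lambda>x. v x t)" "in_L2 (\<lambda>x. p x t)" "in_L2 (\<lambda>x. e x t)" "in_L2 (\<lambda>x. ehat x t)" if "0 \<le> t" for t
    using Lc Lceh that by (auto simp: L2_cont_def)
  have ehat_eq: "ehat x t = e x t + (b - bhat t) * v x t + (bX - bXhat t) * p x t" for x t
    by (simp add: ehat e_def algebra_simps)
  define D where "D t = 1 + int01 (\<lambda>x. (v x t)\<^sup>2) + int01 (\<lambda>x. (p x t)\<^sup>2)" for t
  have D_alt: "D t = 1 + (L2norm (\<lambda>x. v x t))\<^sup>2 + (L2norm (\<lambda>x. p x t))\<^sup>2" for t
    by (simp add: D_def L2norm_sq)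
  have D1: "1 \<le> D t" for t by (simp add: D_alt)
  have cD: "continuous_on {0..} D" unfolding D_alt[abs_def] by (intro continuous_intros L2_cont_norm Lc)
  define I1 where "I1 t = int01 (\<lambda>x. ehat x t * v x t)" for t
  define I2 where "I2 t = int01 (\<lambda>x. ehat x t * p x t)" for t
  have cI: "continuous_on {0..} I1" "continuous_on {0..} I2"
    unfolding I1_def I2_def by (intro L2_cont_inner Lc Lceh)+
  have dbh: "dbhat t = - \<gamma>1 * bhat t * Proj bbar (bhat t) (I1 t / D t)" if "0 \<le> t" for t
    using bhat_ode(2)[OF that] by (simp add: I1_def D_def)
  have dbX: "dbXhat t = - \<gamma>2 * bhat t * (I2 t / D t)" if "0 \<le> t" for t
    using bXhat_ode(2)[OF that] by (simp add: I2_def D_def)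
  define ne where "ne t = L2norm (\<lambda>x. ehat x t) / sqrt (D t)" for t
  have D_nz: "D t \<noteq> 0" for t using D1[of t] by simp
  have cne: "continuous_on {0..} ne" unfolding ne_def
    using D_nz by (intro continuous_intros L2_cont_norm Lceh cD) auto
  have ne0: "0 \<le> ne t" for t using D1[of t] by (simp add: ne_def)
  have ne2: "(ne t)\<^sup>2 = (L2norm (\<lambda>x. ehat x t))\<^sup>2 / D t" for t
    using D1[of t] by (simp add: ne_def power_divide)
  have v_le: "L2norm (\<lambda>x. v x t) \<le> sqrt (D t)" and p_le: "L2norm (\<lambda>x. p x t) \<le> sqrt (D t)" for t
    by (auto intro!: real_le_rsqrt simp: D_alt)
  have I_le: "\<bar>I1 t / D t\<bar> \<le> ne t" "\<bar>I2 t / D t\<bar> \<le> ne t" if t: "0 \<le> t" for t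
  proof -
    have *: "\<bar>I / D t\<bar> \<le> ne t" if "\<bar>I\<bar> \<le> L2norm (\<lambda>x. ehat x t) * sqrt (D t)" for I
    proof -
      have "\<bar>I\<bar> / D t \<le> L2norm (\<lambda>x. ehat x t) * sqrt (D t) / D t"
        using that D1[of t] by (intro divide_right_mono) auto
      also have "\<dots> = ne t"
        using D1[of t] real_div_sqrt[of "D t"] by (simp add: ne_def divide_simps)
      finally show ?thesis using D1[of t] by (simp add: abs_div)
    qed
    show "\<bar>I1 t / D t\<bar> \<le> ne t"
      unfolding I1_def by (intro * order_trans[OF int01_Cauchy_Schwarz[OF Lt(5)[OF t] Lt(2)[OF t]]] mult_left_mono v_le) simp
    show "\<bar>I2 t / D t\<bar> \<le> ne t"
      unfolding I2_def by (intro * order_trans[OF int01_Cauchy_Schwarz[OF Lt(5)[OF t] Lt(3)[OF t]]] mult_left_mono p_le) simp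
  qed
  define W where "W t = (b - bhat t)\<^sup>2 / (2 * \<gamma>1) + (bX - bXhat t)\<^sup>2 / (2 * \<gamma>2)" for t
  define W' where "W' t = - ((b - bhat t) * dbhat t / \<gamma>1) - (bX - bXhat t) * dbXhat t / \<gamma>2" for t
  have W0: "0 \<le> W t" for t using gains by (simp add: W_def)
  have cW: "continuous_on {0..} W" unfolding W_def
    using gains by (intro continuous_intros bhat_cont cbX) auto
  have dW: "(W has_real_derivative W' t) (at_right t)" if t: "0 \<le> t" for t
  proof -
    have "((\<lambda>t. b - bhat t) has_real_derivative 0 - dbhat t) (at_right t)"
      by (intro DERIV_diff DERIV_const bhat_ode(1)[OF t])
    moreover have "((\<lambda>t. bX - bXhat t) has_real_derivative 0 - dbXhat t) (at_right t)"
      by (intro DERIV_diff DERIV_const right_deriv_of_halfline[OF bXhat_ode(1)[OF t] t])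
    ultimately have "(W has_real_derivative (b - bhat t) * (0 - dbhat t) / \<gamma>1 + (bX - bXhat t) * (0 - dbXhat t) / \<gamma>2) (at_right t)"
      unfolding W_def by (intro DERIV_add DERIV_weighted_square)
    then show ?thesis by (simp add: W'_def)
  qed
  have W'_le: "W' t \<le> - (- bbar) * (ne t)\<^sup>2" if tt: "t0 \<le> t" for t
  proof -
    have t: "0 \<le> t" using tt t0 by simp
    have bh: "bhat t < 0" using bhat_range[OF t] bbar by simp
    \<comment> \<open>after \<open>t0\<close> the error \<open>ehat\<close> is the combination of \<open>v\<close> and \<open>p\<close> with the parameter errors\<close>
    have key: "(b - bhat t) * I1 t + (bX - bXhat t) * I2 t = (L2norm (\<lambda>x. ehat x t))\<^sup>2"
    proof -
      note L = Lt[OF t]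
      have "(L2norm (\<lambda>x. ehat x t))\<^sup>2 = int01 (\<lambda>x. ehat x t * e x t + ((b - bhat t) * (ehat x t * v x t) + (bX - bXhat t) * (ehat x t * p x t)))"
        unfolding L2norm_sq by (rule arg_cong[where f=int01]) (simp add: fun_eq_iff power2_eq_square, simp add: ehat_eq algebra_simps)
      also have "\<dots> = int01 (\<lambda>x. ehat x t * e x t) + ((b - bhat t) * I1 t + (bX - bXhat t) * I2 t)"
      proof -
        have i: "integrable I01 (\<lambda>x. ehat x t * e x t)" "integrable I01 (\<lambda>x. (b - bhat t) * (ehat x t * v x t))"
          "integrable I01 (\<lambda>x. (bX - bXhat t) * (ehat x t * p x t))"
          using in_L2_mult[OF L(5,4)] in_L2_mult[OF L(5,2)] in_L2_mult[OF L(5,3)] by auto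
        show ?thesis
          using int01_add[OF i(1) Bochner_Integration.integrable_add[OF i(2,3)]] int01_add[OF i(2,3)]
          by (simp add: int01_cmult I1_def I2_def)
      qed
      also have "int01 (\<lambda>x. ehat x t * e x t) = 0"
        using int01_Cauchy_Schwarz[OF L(5,4)] e_0[OF tt] by simp
      finally show ?thesis by simp
    qed
    have "- ((b - bhat t) * dbhat t / \<gamma>1) = bhat t * ((b - bhat t) * Proj bbar (bhat t) (I1 t / D t))"
      unfolding dbh[OF t] using gains by simp
    also have "\<dots> \<le> bhat t * ((b - bhat t) * (I1 t / D t))"
    \<comment> \<open>when the projection acts, \<open>b - bhat = b - bbar\<close> is negative and the removed term is nonnegative\<close>
    proof (cases "bhat t = bbar \<and> I1 t / D t > 0")
      case True
      then have "(b - bhat t) * (I1 t / D t) \<le> 0" using bbar by (intro mult_nonpos_nonneg) auto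
      then have "0 \<le> bhat t * ((b - bhat t) * (I1 t / D t))" using bh by (intro mult_nonpos_nonpos) auto
      then show ?thesis using True unfolding Proj_def by simp
    qed (auto simp: Proj_def)
    finally have first: "- ((b - bhat t) * dbhat t / \<gamma>1) \<le> bhat t * ((b - bhat t) * (I1 t / D t))" .
    have "(bX - bXhat t) * dbXhat t / \<gamma>2 = - (bhat t * ((bX - bXhat t) * (I2 t / D t)))"
      unfolding dbX[OF t] using gains by simp
    with first have "W' t \<le> bhat t * ((b - bhat t) * (I1 t / D t)) + bhat t * ((bX - bXhat t) * (I2 t / D t))"
      unfolding W'_def by linarith
    also have "\<dots> = bhat t * (((b - bhat t) * I1 t + (bX - bXhat t) * I2 t) / D t)"
      by (simp add: add_divide_distrib distrib_left)
    also have "\<dots> = bhat t * (ne t)\<^sup>2" by (simp add: key ne2)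
    also have "\<dots> \<le> bbar * (ne t)\<^sup>2" using bhat_range[OF t] by (intro mult_right_mono) auto
    finally show ?thesis by simp
  qed
  have cW_tail: "continuous_on {t0..} W" using t0 by (intro continuous_on_subset[OF cW]) auto
  have dW_tail: "(W has_real_derivative W' t) (at_right t)" if "t0 \<le> t" for t using dW that t0 by simp
  have mbbar: "0 < - bbar" using bbar by simp
  have L2ne: "in_L2_time ne"
    by (rule in_L2_time_if_dissipated(1)[OF cne t0 cW_tail W0 dW_tail W'_le mbbar])
  have W_le: "W t \<le> W t0" if "t0 \<le> t" for t
    by (rule in_L2_time_if_dissipated(2)[OF cne t0 cW_tail W0 dW_tail W'_le mbbar that])
  have Bbt: "in_Linf_time (\<lambda>t. b - bhat t)"
  proof (rule continuous_eventually_bounded)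
    show "continuous_on {0..} (\<lambda>t. b - bhat t)" by (intro continuous_intros bhat_cont)
    fix t assume "t0 \<le> t"
    then have "W t \<le> W t0" by (rule W_le)
    moreover have "0 \<le> (bX - bXhat t)\<^sup>2 / (2 * \<gamma>2)" using gains by simp
    ultimately have "(b - bhat t)\<^sup>2 / (2 * \<gamma>1) \<le> W t0" unfolding W_def[of t] by linarith
    then have "(b - bhat t)\<^sup>2 \<le> 2 * \<gamma>1 * W t0" using gains by (simp add: field_simps)
    then have "sqrt ((b - bhat t)\<^sup>2) \<le> sqrt (2 * \<gamma>1 * W t0)" by (rule real_sqrt_le_mono)
    then show "\<bar>b - bhat t\<bar> \<le> sqrt (2 * \<gamma>1 * W t0)" by simp
  qed
  have BbXt: "in_Linf_time (\<lambda>t. bX - bXhat t)"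
  proof (rule continuous_eventually_bounded)
    show "continuous_on {0..} (\<lambda>t. bX - bXhat t)" by (intro continuous_intros cbX)
    fix t assume "t0 \<le> t"
    then have "W t \<le> W t0" by (rule W_le)
    moreover have "0 \<le> (b - bhat t)\<^sup>2 / (2 * \<gamma>1)" using gains by simp
    ultimately have "(bX - bXhat t)\<^sup>2 / (2 * \<gamma>2) \<le> W t0" unfolding W_def[of t] by linarith
    then have "(bX - bXhat t)\<^sup>2 \<le> 2 * \<gamma>2 * W t0" using gains by (simp add: field_simps)
    then have "sqrt ((bX - bXhat t)\<^sup>2) \<le> sqrt (2 * \<gamma>2 * W t0)" by (rule real_sqrt_le_mono)
    then show "\<bar>bX - bXhat t\<bar> \<le> sqrt (2 * \<gamma>2 * W t0)" by simp
  qed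
  obtain C1 where C1: "0 \<le> C1" "\<And>t. 0 \<le> t \<Longrightarrow> \<bar>b - bhat t\<bar> \<le> C1" using in_Linf_timeE[OF Bbt] by blast
  obtain C2 where C2: "0 \<le> C2" "\<And>t. 0 \<le> t \<Longrightarrow> \<bar>bX - bXhat t\<bar> \<le> C2" using in_Linf_timeE[OF BbXt] by blast
  define Cb where "Cb = \<bar>b\<bar> + C1"
  have Cb: "\<bar>bhat t\<bar> \<le> Cb" if "0 \<le> t" for t using C1(2)[OF that] by (auto simp: Cb_def)
  have Cb0: "0 \<le> Cb" using C1 by (simp add: Cb_def)
  have B\<eta>: "in_Linf_time (\<lambda>t. L2norm (\<lambda>x. \<eta> x t))"
  proof (rule in_Linf_timeI)
    fix t :: real assume t: "0 \<le> t"
    have "L2norm (\<lambda>x. \<eta> x t) \<le> L2norm \<eta>0 + (Cb * Cux) / (- bbar) + G"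
    proof (rule transport_solution_bound[OF \<eta>_pde init(4) bhat_cont bhat_range bbar(1) _ G(2) t])
      fix t :: real assume t: "0 \<le> t"
      have "\<bar>bhat t\<bar> * L2norm (\<lambda>x. ux x t) \<le> Cb * Cux" using t Cb0 by (intro mult_mono Cb Cux) auto
      then show "L2norm (\<lambda>x. - bhat t * ux x t) \<le> Cb * Cux" unfolding L2norm_cmult by simp
    qed
    then show "\<bar>L2norm (\<lambda>x. \<eta> x t)\<bar> \<le> L2norm \<eta>0 + (Cb * Cux) / (- bbar) + G" by simp
  qed
  have Bne: "in_Linf_time ne"
  proof (rule continuous_eventually_bounded[OF cne])
    fix t assume tt: "t0 \<le> t"
    then have t: "0 \<le> t" using t0 by simp
    note L = Lt[OF t]
    have "L2norm (\<lambda>x. ehat x t) \<le> L2norm (\<lambda>x. e x t + (b - bhat t) * v x t) + L2norm (\<lambda>x. (bX - bXhat t) * p x t)"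
      unfolding ehat_eq by (intro L2norm_triangle in_L2_add in_L2_cmult L)
    also have "L2norm (\<lambda>x. e x t + (b - bhat t) * v x t) \<le> L2norm (\<lambda>x. e x t) + L2norm (\<lambda>x. (b - bhat t) * v x t)"
      by (intro L2norm_triangle in_L2_cmult L)
    finally have "L2norm (\<lambda>x. ehat x t) \<le> \<bar>b - bhat t\<bar> * L2norm (\<lambda>x. v x t) + \<bar>bX - bXhat t\<bar> * L2norm (\<lambda>x. p x t)"
      by (simp add: L2norm_cmult e_0[OF tt])
    also have "\<dots> \<le> C1 * sqrt (D t) + C2 * sqrt (D t)"
      using C1 C2 t by (intro add_mono mult_mono v_le p_le) auto
    finally have "ne t \<le> C1 + C2" unfolding ne_def using D1[of t] by (simp add: divide_le_eq algebra_simps)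
    then show "\<bar>ne t\<bar> \<le> C1 + C2" using ne0[of t] by simp
  qed
  have db_le: "\<bar>dbhat t\<bar> \<le> \<gamma>1 * Cb * \<bar>ne t\<bar>" if t: "0 \<le> t" for t
  proof -
    have "\<bar>Proj bbar (bhat t) (I1 t / D t)\<bar> \<le> ne t" using I_le(1)[OF t] ne0[of t] by (simp add: Proj_def)
    then have "\<gamma>1 * \<bar>bhat t\<bar> * \<bar>Proj bbar (bhat t) (I1 t / D t)\<bar> \<le> \<gamma>1 * Cb * ne t"
      using gains Cb[OF t] Cb0 by (intro mult_mono mult_nonneg_nonneg) auto
    then show ?thesis unfolding dbh[OF t] using gains ne0[of t] by (simp add: abs_mult)
  qed
  have dbX_le: "\<bar>dbXhat t\<bar> \<le> \<gamma>2 * Cb * \<bar>ne t\<bar>" if t: "0 \<le> t" for t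
  proof -
    have "\<gamma>2 * \<bar>bhat t\<bar> * \<bar>I2 t / D t\<bar> \<le> \<gamma>2 * Cb * ne t"
      using gains Cb[OF t] Cb0 I_le(2)[OF t] by (intro mult_mono mult_nonneg_nonneg) auto
    then show ?thesis unfolding dbX[OF t] using gains ne0[of t] by (simp add: abs_mult)
  qed
  have c\<tau>: "continuous_on {0..} (\<lambda>t. I1 t / D t)" "continuous_on {0..} (\<lambda>t. I2 t / D t)"
    using D_nz by (intro continuous_intros cI cD; simp)+
  have mdb: "dbhat \<in> borel_measurable (lebesgue_on {0..})"
  proof -
    have [measurable]: "bhat \<in> borel_measurable (lebesgue_on {0..})" "(\<lambda>t. I1 t / D t) \<in> borel_measurable (lebesgue_on {0..})"
      by (rule continuous_halfline_measurable[OF bhat_cont], rule continuous_halfline_measurable[OF c\<tau>(1)])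
    have "(\<lambda>t. - \<gamma>1 * bhat t * Proj bbar (bhat t) (I1 t / D t)) \<in> borel_measurable (lebesgue_on {0..})"
      unfolding Proj_def by measurable
    then show ?thesis by (rule measurable_cong[THEN iffD2, rotated]) (simp add: dbh)
  qed
  have mdbX: "dbXhat \<in> borel_measurable (lebesgue_on {0..})"
  proof (rule continuous_halfline_measurable, rule continuous_on_eq)
    show "continuous_on {0..} (\<lambda>t. - \<gamma>2 * bhat t * (I2 t / D t))"
      by (intro continuous_intros bhat_cont c\<tau>[unfolded divide_inverse] c\<tau>)
  qed (simp add: dbX)
  have L2db: "in_L2_time dbhat" "in_L2_time dbXhat"
    by (rule in_L2_time_dominated[OF L2ne mdb db_le], assumption, rule in_L2_time_dominated[OF L2ne mdbX dbX_le], assumption)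
  obtain Cn where Cn: "\<And>t. 0 \<le> t \<Longrightarrow> \<bar>ne t\<bar> \<le> Cn" using in_Linf_timeE[OF Bne] by blast
  have Bdb: "in_Linf_time dbhat"
  proof (rule in_Linf_timeI)
    fix t :: real assume t: "0 \<le> t"
    have "\<gamma>1 * Cb * \<bar>ne t\<bar> \<le> \<gamma>1 * Cb * Cn" using gains Cb0 Cn[OF t] by (intro mult_left_mono) auto
    then show "\<bar>dbhat t\<bar> \<le> \<gamma>1 * Cb * Cn" using db_le[OF t] by linarith
  qed
  have BdbX: "in_Linf_time dbXhat"
  proof (rule in_Linf_timeI)
    fix t :: real assume t: "0 \<le> t"
    have "\<gamma>2 * Cb * \<bar>ne t\<bar> \<le> \<gamma>2 * Cb * Cn" using gains Cb0 Cn[OF t] by (intro mult_left_mono) auto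
    then show "\<bar>dbXhat t\<bar> \<le> \<gamma>2 * Cb * Cn" using dbX_le[OF t] by linarith
  qed
  have ne_eq: "(\<lambda>t. L2norm (\<lambda>x. ehat x t) / sqrt (1 + (L2norm (\<lambda>x. v x t))\<^sup>2 + (L2norm (\<lambda>x. p x t))\<^sup>2)) = ne"
    by (simp add: ne_def D_alt fun_eq_iff)
  have n\<epsilon>_eq: "(\<lambda>t. \<bar>epshat t\<bar> / sqrt (1 + (\<Omega> t)\<^sup>2)) = n\<epsilon>"
    by (simp add: n\<epsilon>_def fun_eq_iff)
  show ?thesis
    unfolding ne_eq n\<epsilon>_eq
    using Bux Bu BV BX Bv Bp B\<eta> B\<Omega> B\<Omega>0 Bbt BbXt Bat L2db L2dah L2ne L2n\<epsilon> Bdb BdbX Bdah Bne Bn\<epsilon> conv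
    by blast
qed

end
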